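(* The Unconstrained $k$-near Chain Editing problem is NP-hard.
   Context: The input is a bipartite graph $G=(S\cup Q,E)$ (students $S$, questions $Q$; $sq\in E$ means student $s$ answered question $q$ correctly), a bijection $\alpha:S\to\{1,\dots,|S|\}$ (initial student ordering) and a positive integer $k$. For a vertex $x$, $N(x)$ denotes its neighborhood. An ordering (bijection) $\pi:S\to\{1,\dots,|S|\}$ is nested if $\pi(s_1)\ge \pi(s_2)$ implies $N(s_1)\supseteq N(s_2)$. An edge edit is the addition or deletion of a student–question pair. The Unconstrained $k$-near Chain Editing problem asks for a minimum-size set of edge edits such that in the edited graph there is a nested student ordering $\pi$ with $\pi(s)\in[\alpha(s)-k,\alpha(s)+k]$ for all $s\in S$; the questions may be ordered arbitrarily. (NP-hardness refers to the decision version: given additionally an integer $t$, decide whether such an edit set of size at most $t$ exists.) *)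

theory Defs
  imports Complex_Main "HOL-Computational_Algebra.Polynomial"
begin

section \<open>Deterministic multi-tape Turing machines\<close>

text \<open>
  Tapes are infinite in both directions. Tape symbols are the numbers below \<open>num_symbols\<close>: the
  blank is 0, and the input/output bits \<open>False\<close> and \<open>True\<close> are the symbols 1 and 2. The
  non-halting states are the numbers below \<open>num_states\<close>, the start state is 0 and the number
  \<open>num_states\<close> itself is the halting state.
\<close>

datatype direction = Left | Stay | Right

record tm =
  num_tapes :: nat
  num_symbols :: nat
  num_states :: nat
  trans :: "nat \<Rightarrow> nat list \<Rightarrow> nat \<times> (nat \<times> direction) list"

definition wf_tm :: "tm \<Rightarrow> bool" where
  "wf_tm M \<longleftrightarrow> num_tapes M \<ge> 1 \<and> num_symbols M \<ge> 3 \<and>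
     (\<forall>q < num_states M. \<forall>rs. length rs = num_tapes M \<and> set rs \<subseteq> {..<num_symbols M} \<longrightarrow>
        (case trans M q rs of (q', as) \<Rightarrow>
           q' \<le> num_states M \<and> length as = num_tapes M \<and> fst ` set as \<subseteq> {..<num_symbols M}))"

type_synonym tape = "int \<times> (int \<Rightarrow> nat)"  \<comment> \<open>head position, contents\<close>
type_synonym tm_config = "nat \<times> tape list"

definition read_tape :: "tape \<Rightarrow> nat" where
  "read_tape t = snd t (fst t)"

definition move_head :: "direction \<Rightarrow> int \<Rightarrow> int" where
  "move_head d h = (case d of Left \<Rightarrow> h - 1 | Stay \<Rightarrow> h | Right \<Rightarrow> h + 1)"

definition act_tape :: "nat \<times> direction \<Rightarrow> tape \<Rightarrow> tape" where
  "act_tape a t = (move_head (snd a) (fst t), (snd t)(fst t := fst a))"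

definition tm_step :: "tm \<Rightarrow> tm_config \<Rightarrow> tm_config" where
  "tm_step M c = (case c of (q, ts) \<Rightarrow>
     if q < num_states M
     then (case trans M q (map read_tape ts) of (q', as) \<Rightarrow> (q', map2 act_tape as ts))
     else (q, ts))"

definition bit_symbol :: "bool \<Rightarrow> nat" where
  "bit_symbol b = (if b then 2 else 1)"

definition input_tape :: "bool list \<Rightarrow> tape" where
  "input_tape x =
     (0, \<lambda>i. if 0 \<le> i \<and> i < int (length x) then bit_symbol (x ! nat i) else 0)"

definition tm_init :: "tm \<Rightarrow> bool list \<Rightarrow> tm_config" where
  "tm_init M x = (0, input_tape x # replicate (num_tapes M - 1) (0, \<lambda>_. 0))"

definition tm_halted :: "tm \<Rightarrow> tm_config \<Rightarrow> bool" where
  "tm_halted M c \<longleftrightarrow> fst c = num_states M"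

text \<open>The output is read off the last tape, from cell 0 up to the first blank.\<close>

definition tm_output :: "tm_config \<Rightarrow> bool list \<Rightarrow> bool" where
  "tm_output c y \<longleftrightarrow>
     (\<forall>i < length y. snd (last (snd c)) (int i) = bit_symbol (y ! i)) \<and>
     snd (last (snd c)) (int (length y)) = 0"

definition tm_computes_in_time :: "tm \<Rightarrow> (bool list \<Rightarrow> bool list) \<Rightarrow> (nat \<Rightarrow> nat) \<Rightarrow> bool" where
  "tm_computes_in_time M f T \<longleftrightarrow>
     (\<forall>x. \<exists>n \<le> T (length x). tm_halted M ((tm_step M ^^ n) (tm_init M x)) \<and>
            tm_output ((tm_step M ^^ n) (tm_init M x)) (f x))"


section \<open>NP-hardness\<close>

type_synonym language = "bool list set"

definition poly_time_computable :: "(bool list \<Rightarrow> bool list) \<Rightarrow> bool" where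
  "poly_time_computable f \<longleftrightarrow> (\<exists>M. \<exists>p :: nat poly. wf_tm M \<and> tm_computes_in_time M f (poly p))"

definition class_P :: "language set" where
  "class_P = {L. poly_time_computable (\<lambda>x. [x \<in> L])}"

text \<open>Every bit of the first component is preceded by \<open>True\<close>; \<open>False\<close> marks its end.\<close>

definition pair_words :: "bool list \<Rightarrow> bool list \<Rightarrow> bool list" where
  "pair_words x u = concat (map (\<lambda>b. [True, b]) x) @ False # u"

definition class_NP :: "language set" where
  "class_NP = {L. \<exists>R \<in> class_P. \<exists>p :: nat poly.
     \<forall>x. x \<in> L \<longleftrightarrow> (\<exists>u. length u \<le> poly p (length x) \<and> pair_words x u \<in> R)}"

definition poly_reducible :: "language \<Rightarrow> language \<Rightarrow> bool" where
  "poly_reducible A B \<longleftrightarrow> (\<exists>f. poly_time_computable f \<and> (\<forall>x. x \<in> A \<longleftrightarrow> f x \<in> B))"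

definition NP_hard :: "language \<Rightarrow> bool" where
  "NP_hard B \<longleftrightarrow> (\<forall>A \<in> class_NP. poly_reducible A B)"


section \<open>Unconstrained k-near chain editing\<close>

text \<open>
  The edges of the bipartite graph are represented as pairs (student, question). A set \<open>F\<close> of edge
  edits consists of the student-question pairs that are toggled, so the edited edge set is the
  symmetric difference of \<open>E\<close> and \<open>F\<close>.
\<close>

definition nbhd :: "('s \<times> 'q) set \<Rightarrow> 's \<Rightarrow> 'q set" where
  "nbhd E s = {q. (s, q) \<in> E}"

definition is_ordering :: "'s set \<Rightarrow> ('s \<Rightarrow> nat) \<Rightarrow> bool" where
  "is_ordering S \<pi> \<longleftrightarrow> bij_betw \<pi> S {1..card S}"

definition nested_ordering :: "'s set \<Rightarrow> ('s \<times> 'q) set \<Rightarrow> ('s \<Rightarrow> nat) \<Rightarrow> bool" where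
  "nested_ordering S E \<pi> \<longleftrightarrow> is_ordering S \<pi> \<and>
     (\<forall>s\<^sub>1 \<in> S. \<forall>s\<^sub>2 \<in> S. \<pi> s\<^sub>1 \<ge> \<pi> s\<^sub>2 \<longrightarrow> nbhd E s\<^sub>1 \<supseteq> nbhd E s\<^sub>2)"

definition apply_edits :: "('s \<times> 'q) set \<Rightarrow> ('s \<times> 'q) set \<Rightarrow> ('s \<times> 'q) set" where
  "apply_edits E F = (E - F) \<union> (F - E)"

definition k_near :: "'s set \<Rightarrow> ('s \<Rightarrow> nat) \<Rightarrow> nat \<Rightarrow> ('s \<Rightarrow> nat) \<Rightarrow> bool" where
  "k_near S \<alpha> k \<pi> \<longleftrightarrow> (\<forall>s \<in> S. int (\<pi> s) \<in> {int (\<alpha> s) - int k .. int (\<alpha> s) + int k})"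

definition chain_edit_set ::
  "'s set \<Rightarrow> 'q set \<Rightarrow> ('s \<times> 'q) set \<Rightarrow> ('s \<Rightarrow> nat) \<Rightarrow> nat \<Rightarrow> ('s \<times> 'q) set \<Rightarrow> bool" where
  "chain_edit_set S Q E \<alpha> k F \<longleftrightarrow> F \<subseteq> S \<times> Q \<and>
     (\<exists>\<pi>. nested_ordering S (apply_edits E F) \<pi> \<and> k_near S \<alpha> k \<pi>)"

definition near_chain_instance ::
  "'s set \<Rightarrow> 'q set \<Rightarrow> ('s \<times> 'q) set \<Rightarrow> ('s \<Rightarrow> nat) \<Rightarrow> nat \<Rightarrow> bool" where
  "near_chain_instance S Q E \<alpha> k \<longleftrightarrow>
     finite S \<and> finite Q \<and> E \<subseteq> S \<times> Q \<and> is_ordering S \<alpha> \<and> k > 0"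

text \<open>
  For the encoding as bit strings, the students are \<open>0, \<dots>, n - 1\<close> and the questions are
  \<open>0, \<dots>, m - 1\<close>. The numbers of vertices are written in unary, the graph as its
  \<open>n \<times> m\<close> biadjacency matrix, and the values of \<open>\<alpha>\<close>, \<open>k\<close> and \<open>t\<close> in binary (least significant
  bit first, made self-delimiting by \<^const>\<open>pair_words\<close>).
\<close>

fun binary :: "nat \<Rightarrow> bool list" where
  "binary n = (if n = 0 then [] else odd n # binary (n div 2))"

declare binary.simps [simp del]

definition encode_unary :: "nat \<Rightarrow> bool list" where
  "encode_unary n = replicate n True @ [False]"

definition encode_nat :: "nat \<Rightarrow> bool list" where
  "encode_nat n = pair_words (binary n) []"

definition encode_near_chain ::
  "nat \<Rightarrow> nat \<Rightarrow> (nat \<times> nat) set \<Rightarrow> (nat \<Rightarrow> nat) \<Rightarrow> nat \<Rightarrow> nat \<Rightarrow> bool list" where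
  "encode_near_chain n m E \<alpha> k t =
     encode_unary n @ encode_unary m @
     concat (map (\<lambda>i. map (\<lambda>j. (i, j) \<in> E) [0..<m]) [0..<n]) @
     concat (map (\<lambda>i. encode_nat (\<alpha> i)) [0..<n]) @
     encode_nat k @ encode_nat t"

definition UNCONSTRAINED_NEAR_CHAIN_EDITING :: language where
  "UNCONSTRAINED_NEAR_CHAIN_EDITING =
     {encode_near_chain n m E \<alpha> k t | n m E \<alpha> k t.
        near_chain_instance {..<n} {..<m} E \<alpha> k \<and>
        (\<exists>F. chain_edit_set {..<n} {..<m} E \<alpha> k F \<and> card F \<le> t)}"


section \<open>The encodings are injective\<close>

lemma pair_words_inject: "pair_words x u = pair_words y v \<longleftrightarrow> x = y \<and> u = v"
proof (induction x arbitrary: y)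
  case Nil
  show ?case by (cases y) (auto simp: pair_words_def)
next
  case (Cons b x)
  show ?case
  proof (cases y)
    case Nil
    then show ?thesis by (simp add: pair_words_def)
  next
    case (Cons c y')
    then show ?thesis using Cons.IH[of y'] by (auto simp: pair_words_def)
  qed
qed

lemma binary_inject: "binary a = binary b \<longleftrightarrow> a = b"
proof
  show "a = b" if "binary a = binary b"
    using that
  proof (induction a arbitrary: b rule: less_induct)
    case (less a)
    show ?case
    proof (cases "a = 0 \<or> b = 0")
      case True
      then show ?thesis
        using less.prems by (auto simp: binary.simps[of a] binary.simps[of b] split: if_splits)
    next
      case False
      then have "odd a = odd b" and "binary (a div 2) = binary (b div 2)"
        using less.prems by (simp_all add: binary.simps[of a] binary.simps[of b])
      then have "odd a = odd b" and "a div 2 = b div 2"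
        using less.IH[of "a div 2" "b div 2"] False by simp_all
      then show ?thesis by presburger
    qed
  qed
qed simp

lemma encode_unary_append_inject:
  "encode_unary a @ x = encode_unary b @ y \<longleftrightarrow> a = b \<and> x = y"
proof (induction a arbitrary: b)
  case 0
  show ?case by (cases b) (auto simp: encode_unary_def)
next
  case (Suc a)
  show ?case
  proof (cases b)
    case 0
    then show ?thesis by (simp add: encode_unary_def)
  next
    case (Suc b')
    then show ?thesis using Suc.IH[of b'] by (simp add: encode_unary_def)
  qed
qed

lemma encode_nat_append_inject: "encode_nat a @ x = encode_nat b @ y \<longleftrightarrow> a = b \<and> x = y"
proof -
  have "encode_nat c @ z = pair_words (binary c) z" for c z
    by (simp add: encode_nat_def pair_words_def)
  then show ?thesis by (simp add: pair_words_inject binary_inject)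
qed

lemma concat_map_encode_nat_append_inject:
  "concat (map (\<lambda>i. encode_nat (f i)) is) @ x = concat (map (\<lambda>i. encode_nat (g i)) is) @ y \<longleftrightarrow>
     (\<forall>i \<in> set is. f i = g i) \<and> x = y"
  by (induction "is") (auto simp: encode_nat_append_inject)

lemma concat_map_rows_append_inject:
  assumes "\<And>i. length (f i) = length (g i)"
  shows "concat (map f is) @ x = concat (map g is) @ y \<longleftrightarrow>
     (\<forall>i \<in> set is. f i = g i) \<and> x = y"
  by (induction "is") (use assms in auto)

lemma encode_near_chain_inject:
  assumes "E \<subseteq> {..<n} \<times> {..<m}" and "E' \<subseteq> {..<n'} \<times> {..<m'}"
    and eq: "encode_near_chain n m E \<alpha> k t = encode_near_chain n' m' E' \<alpha>' k' t'"
  shows "n = n' \<and> m = m' \<and> E = E' \<and> (\<forall>i < n. \<alpha> i = \<alpha>' i) \<and> k = k' \<and> t = t'"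
proof -
  have nm: "n = n'" "m = m'"
    using eq by (auto simp: encode_near_chain_def encode_unary_append_inject)
  have *: "encode_nat k @ encode_nat t = encode_nat k' @ encode_nat t' \<longleftrightarrow> k = k' \<and> t = t'"
    using encode_nat_append_inject[of t "[]" t' "[]"] by (simp add: encode_nat_append_inject)
  have "(\<forall>i<n. \<forall>j<m. (i, j) \<in> E \<longleftrightarrow> (i, j) \<in> E') \<and> (\<forall>i<n. \<alpha> i = \<alpha>' i) \<and> k = k' \<and> t = t'"
    using eq unfolding encode_near_chain_def nm
    by (simp add: encode_unary_append_inject concat_map_rows_append_inject
        concat_map_encode_nat_append_inject *)
  moreover have "E = E'" if "\<forall>i<n. \<forall>j<m. (i, j) \<in> E \<longleftrightarrow> (i, j) \<in> E'"
  proof -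
    have "p \<in> E \<longleftrightarrow> p \<in> E'" for p
    proof (cases "p \<in> {..<n} \<times> {..<m}")
      case True
      then show ?thesis using that by (cases p) simp
    next
      case False
      then show ?thesis using assms(1,2) nm by blast
    qed
    then show ?thesis by blast
  qed
  ultimately show ?thesis using nm by simp
qed

end

theory Submission
  imports Defs "HOL-Library.Countable"
begin

text \<open>
  Satisfiability of conjunctive normal forms reduces to chain editing already for \<open>k = 1\<close>: clauses become
  questions, and the initial ordering consists of blocks of six students, one per variable, the truth
  value being whether the first two students of the block are interchanged. For a fixed student ordering the
  cost of a question is its distance to the nearest threshold function; the columns are chosen such that
  this is \<open>3 N - 1\<close> if the clause is satisfied and \<open>3 N\<close> otherwise, \<open>N\<close> being the number of variables.

  The formulas come from the tableau of a polynomial time verifier. As the verifier is deterministic, Horn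
  clauses that propagate the facts of its run suffice, apart from the clauses that guess the certificate.
  The literals of the clauses are given by arithmetic expressions in the clause number, so that the
  instance can be printed by nested loops over counters with polynomially bounded values, and such
  programs run on a Turing machine step by step.
\<close>

section \<open>From satisfiability to chain editing\<close>

text \<open>After editing, a column is determined by its set \<open>D\<close> of zeros, which must
  be an initial segment of the final order. Its cost is the number \<open>3 N\<close> of original
  zeros plus the sum over \<open>D\<close> of +1 for every original one and -1 for every original
  zero. The final order cannot be prescribed, only kept near: with displacement 1 an initial segment
  is a prefix, or a prefix with its last student exchanged for the next one. So the gadget must keep
  all these sums nonnegative for exchanges anywhere, also across block borders, and admit -1 only at
  true literals. Every column then costs at least \<open>3 N - 1\<close>, the budget
  \<open>m * (3 N - 1)\<close> leaves no slack, and since all columns share one order, one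
  assignment satisfies all clauses. A column may have any number of nontrivial blocks, so clauses of
  any width are allowed; but a variable must not occur with both signs in a clause, as its block
  would begin with two zeros. In the tableau only the final clause has no positive literal. Extra
  facts in an assignment therefore do no harm, and no clauses for the uniqueness of state, head or
  symbol are required.\<close>

text \<open>
  For every variable \<open>v\<close> there are six students \<open>6 v, \<dots>, 6 v + 5\<close>; the column of a clause on them is
  101100, 011100 or 111000 if \<open>v\<close> occurs positively, negatively or not at all.
\<close>

definition gadget :: "(nat \<Rightarrow> bool) \<Rightarrow> (nat \<Rightarrow> bool) \<Rightarrow> nat \<Rightarrow> bool" where
  "gadget p n i = (let v = i div 6; r = i mod 6 in
     if r = 0 then \<not> n v else if r = 1 then \<not> p v else if r = 2 then True
     else if r = 3 then p v \<or> n v else False)"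

text \<open>
  Reading a column upwards as a walk with steps \<open>\<plusminus>1\<close>, each block is an excursion from 0 to 0 whose peaks
  have height at least 2, except at the pair \<open>6 v, 6 v + 1\<close>. A transposition of neighbours changes the
  walk only at one point, and lowers it (by 2) only at a peak. Hence the walk reaches \<open>-1\<close> exactly at
  the pair of a satisfied literal.
\<close>

definition weight :: "(nat \<Rightarrow> bool) \<Rightarrow> nat \<Rightarrow> int" where
  "weight b i = (if b i then 1 else -1)"

text \<open>Positions in a block are iterated \<open>Suc\<close> terms, so that prefix sums unfold
  one student at a time.\<close>

lemma gadget_simps:
  "gadget p n (6*v) = (\<not> n v)"
  "gadget p n (Suc (6*v)) = (\<not> p v)"
  "gadget p n (Suc (Suc (6*v))) = True"
  "gadget p n (Suc (Suc (Suc (6*v)))) = (p v \<or> n v)"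
  "gadget p n (Suc (Suc (Suc (Suc (6*v))))) = False"
  "gadget p n (Suc (Suc (Suc (Suc (Suc (6*v)))))) = False"
proof -
  have *: "(6*v) div 6 = v" "Suc (6*v) div 6 = v" "Suc (Suc (6*v)) div 6 = v"
    "Suc (Suc (Suc (6*v))) div 6 = v" "Suc (Suc (Suc (Suc (6*v)))) div 6 = v"
    "Suc (Suc (Suc (Suc (Suc (6*v))))) div 6 = v"
    "(6*v) mod 6 = 0" "Suc (6*v) mod 6 = 1" "Suc (Suc (6*v)) mod 6 = 2"
    "Suc (Suc (Suc (6*v))) mod 6 = 3" "Suc (Suc (Suc (Suc (6*v)))) mod 6 = 4"
    "Suc (Suc (Suc (Suc (Suc (6*v))))) mod 6 = 5"
    by presburger+
  show "gadget p n (6*v) = (\<not> n v)"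
    "gadget p n (Suc (6*v)) = (\<not> p v)"
    "gadget p n (Suc (Suc (6*v))) = True"
    "gadget p n (Suc (Suc (Suc (6*v)))) = (p v \<or> n v)"
    "gadget p n (Suc (Suc (Suc (Suc (6*v))))) = False"
    "gadget p n (Suc (Suc (Suc (Suc (Suc (6*v)))))) = False"
    unfolding gadget_def Let_def * by simp_all
qed

lemma sixfold_Suc: "6 * Suc v = Suc (Suc (Suc (Suc (Suc (Suc (6*v))))))"
  by simp

lemma sixfold_cases:
  obtains v where "i = 6*v" | v where "i = Suc (6*v)" | v where "i = Suc (Suc (6*v))"
  | v where "i = Suc (Suc (Suc (6*v)))" | v where "i = Suc (Suc (Suc (Suc (6*v))))"
  | v where "i = Suc (Suc (Suc (Suc (Suc (6*v)))))"
proof -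
  define v where "v = i div 6"
  have "i = 6*v \<or> i = Suc (6*v) \<or> i = Suc (Suc (6*v)) \<or> i = Suc (Suc (Suc (6*v)))
      \<or> i = Suc (Suc (Suc (Suc (6*v)))) \<or> i = Suc (Suc (Suc (Suc (Suc (6*v)))))"
    unfolding v_def by presburger
  then show thesis using that by blast
qed

text \<open>If displacements are at most 1 and \<open>s' + 2 \<le> s\<close>, then \<open>s'\<close>
  is ranked before \<open>s\<close>; so the zero set of an edited column satisfies
  \<open>down\<close>. Below its maximum only the immediate predecessor can be missing.\<close>

lemma two_down_set_cases:
  fixes D :: "nat set"
  assumes "finite D" and down: "\<And>s s'. s \<in> D \<Longrightarrow> s' + 2 \<le> s \<Longrightarrow> s' \<in> D"
  obtains "D = {}" | i where "D = {..i}" | i where "D = insert (Suc i) {..<i}"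
proof (cases "D = {}")
  case False
  define m where "m = Max D"
  have m: "m \<in> D" "\<And>s. s \<in> D \<Longrightarrow> s \<le> m" using assms(1) False by (auto simp: m_def)
  have low: "s \<in> D" if "s + 2 \<le> m" for s using down m(1) that by blast
  show thesis
  proof (cases "m = 0 \<or> m - 1 \<in> D")
    case True
    have "s \<in> D" if le: "s \<le> m" for s
    proof -
      have "s + 2 \<le> m \<or> s = m \<or> m \<noteq> 0 \<and> s = m - 1" using le by arith
      then show ?thesis using True low m(1) by auto
    qed
    then have "D = {..m}" using m by auto
    then show thesis using that by blast
  next
    case F: False
    then obtain i where i: "m = Suc i" by (cases m) auto
    have "D = insert (Suc i) {..<i}"
    proof (intro set_eqI iffI)
      fix s assume "s \<in> D"
      then have "s \<le> Suc i" "s \<noteq> i" using m(2)[of s] F i by auto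
      then show "s \<in> insert (Suc i) {..<i}" by auto
    qed (use m(1) low i in auto)
    then show thesis using that by blast
  qed
qed (use that in blast)

section \<open>The cost of one column\<close>

locale clause_gadget =
  fixes p n :: "nat \<Rightarrow> bool"
  assumes disj: "\<And>v. \<not> (p v \<and> n v)"
begin

abbreviation w where "w \<equiv> weight (gadget p n)"

lemma weight_simps:
  "w (6*v) = (if n v then -1 else 1)"
  "w (Suc (6*v)) = (if p v then -1 else 1)"
  "w (Suc (Suc (6*v))) = 1"
  "w (Suc (Suc (Suc (6*v)))) = (if p v \<or> n v then 1 else -1)"
  "w (Suc (Suc (Suc (Suc (6*v))))) = -1"
  "w (Suc (Suc (Suc (Suc (Suc (6*v)))))) = -1"
  by (simp_all add: weight_def gadget_simps)

text \<open>Each of the three patterns has three ones and three zeros; \<open>disj\<close> excludes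
  the unbalanced 001100.\<close>

lemma sum_weight_block: "sum w {..<6*v} = 0"
proof (induction v)
  case (Suc v)
  then show ?case using disj[of v] unfolding sixfold_Suc
    by (auto simp: weight_simps)
qed simp

text \<open>The heights after each student of a block are 1 0 1 2 1 0, -1 0 1 2 1 0 and 1 2 3 2 1 0
  for a positive, negative and absent variable.\<close>

lemma sum_weight_atMost:
  "sum w {..i} \<ge> 0 \<or> sum w {..i} = -1 \<and> (\<exists>v. i = 6*v \<and> n v)"
proof -
  note simps = lessThan_Suc_atMost[symmetric] sum_weight_block weight_simps
  show ?thesis
  proof (cases i rule: sixfold_cases)
    case (1 v) then show ?thesis by (auto simp: simps)
  next
    case (2 v) then show ?thesis using disj[of v] by (simp add: simps)
  next
    case (3 v) then show ?thesis using disj[of v] by (simp add: simps)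
  next
    case (4 v) then show ?thesis using disj[of v] by (simp add: simps)
  next
    case (5 v) then show ?thesis using disj[of v] by (simp add: simps)
  next
    case (6 v) then show ?thesis using disj[of v] by (simp add: simps)
  qed
qed

lemma sum_weight_skip:
  "sum w {..<i} + w (Suc i) \<ge> 0 \<or>
   sum w {..<i} + w (Suc i) = -1 \<and> (\<exists>v. i = 6*v \<and> p v)"
proof -
  note simps = sum_weight_block weight_simps
  show ?thesis
  proof (cases i rule: sixfold_cases)
    case (1 v) then show ?thesis by (auto simp: simps)
  next
    case (2 v) then show ?thesis using disj[of v] by (simp add: simps)
  next
    case (3 v) then show ?thesis using disj[of v] by (simp add: simps)
  next
    case (4 v) then show ?thesis using disj[of v] by (simp add: simps)
  next
    case (5 v) then show ?thesis using disj[of v] by (simp add: simps)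
  next
    \<comment> \<open>\<open>Suc i\<close> belongs to the next block and has unknown weight; the
      height 1 before the last student of this block absorbs it.\<close>
    case (6 v)
    have "w (Suc i) \<ge> -1" by (simp add: weight_def)
    moreover have "sum w {..<i} = 1" using 6 disj[of v] by (simp add: simps)
    ultimately show ?thesis by simp
  qed
qed

lemma sum_weight_down_set:
  assumes "finite D" and "\<And>s s'. s \<in> D \<Longrightarrow> s' + 2 \<le> s \<Longrightarrow> s' \<in> D"
  shows "sum w D \<ge> 0 \<or> sum w D = -1 \<and>
    (\<exists>v. n v \<and> 6*v \<in> D \<and> Suc (6*v) \<notin> D \<or> p v \<and> Suc (6*v) \<in> D \<and> 6*v \<notin> D)"
proof (rule two_down_set_cases[OF assms])
  fix i assume D: "D = {..i}"
  show ?thesis unfolding D using sum_weight_atMost[of i] by auto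
next
  fix i assume D: "D = insert (Suc i) {..<i}"
  have "sum w D = sum w {..<i} + w (Suc i)" unfolding D by simp
  then show ?thesis using sum_weight_skip[of i] unfolding D by auto
qed auto

text \<open>The entries counted are those to be toggled when \<open>D\<close> becomes the zero set:
  ones in \<open>D\<close> and zeros outside. Twice the indicator of such an entry is
  \<open>1 - w s\<close>, plus \<open>2 * w s\<close> on \<open>D\<close>, and the total weight is
  0.\<close>

lemma card_mismatch:
  assumes "D \<subseteq> {..<6*N}"
  shows "int (card {s. s < 6*N \<and> (gadget p n s \<longleftrightarrow> s \<in> D)}) = 3 * int N + sum w D"
proof -
  let ?b = "gadget p n" and ?S = "{..<6*N}"
  have "2 * int (card {s. s < 6*N \<and> (?b s \<longleftrightarrow> s \<in> D)})
      = (\<Sum>s<6*N. if ?b s \<longleftrightarrow> s \<in> D then 2 else 0)"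
    by (simp add: sum.If_cases Int_def)
  also have "\<dots> = (\<Sum>s<6*N. 1 - w s + (if s \<in> D then 2 * w s else 0))"
    by (intro sum.cong) (auto simp: weight_def)
  also have "\<dots> = 6 * int N - sum w ?S + (\<Sum>s<6*N. if s \<in> D then 2 * w s else 0)"
    by (simp add: sum.distrib sum_subtractf)
  also have "(\<Sum>s<6*N. if s \<in> D then 2 * w s else 0) = sum (\<lambda>s. 2 * w s) D"
    using assms by (simp add: sum.If_cases Int_absorb1)
  finally show ?thesis by (simp add: sum_weight_block sum_distrib_left[symmetric])
qed

end

section \<open>Formulas as chain editing instances\<close>

definition cnf_sat :: "nat \<Rightarrow> nat \<Rightarrow> (nat \<Rightarrow> nat \<Rightarrow> bool) \<Rightarrow> (nat \<Rightarrow> nat \<Rightarrow> bool) \<Rightarrow> bool" where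
  "cnf_sat N m pos neg \<longleftrightarrow>
     (\<exists>A. \<forall>c<m. \<exists>v<N. pos v c \<and> A v \<or> neg v c \<and> \<not> A v)"

definition cnf_graph ::
  "nat \<Rightarrow> nat \<Rightarrow> (nat \<Rightarrow> nat \<Rightarrow> bool) \<Rightarrow> (nat \<Rightarrow> nat \<Rightarrow> bool) \<Rightarrow> (nat \<times> nat) set" where
  "cnf_graph N m pos neg =
     {(i, c). i < 6*N \<and> c < m \<and> gadget (\<lambda>v. pos v c) (\<lambda>v. neg v c) i}"

text \<open>A variable is true if its first two students are interchanged.\<close>

definition swap_order :: "(nat \<Rightarrow> bool) \<Rightarrow> nat \<Rightarrow> nat" where
  "swap_order A s = (let v = s div 6 in
     if A v \<and> s = 6*v then s + 2 else if A v \<and> s = Suc (6*v) then s else s + 1)"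

lemma swap_order_simps:
  "swap_order A (6*v) = (if A v then 6*v + 2 else 6*v + 1)"
  "swap_order A (Suc (6*v)) = (if A v then Suc (6*v) else 6*v + 2)"
proof -
  have "(6*v) div 6 = v" "Suc (6*v) div 6 = v" by presburger+
  then show "swap_order A (6*v) = (if A v then 6*v + 2 else 6*v + 1)"
    "swap_order A (Suc (6*v)) = (if A v then Suc (6*v) else 6*v + 2)"
    by (simp_all add: swap_order_def)
qed

text \<open>The initial segment that ends with whichever student of the pair of \<open>v\<close>
  comes first: the cut used by a clause that is satisfied through \<open>v\<close>.\<close>

lemma swap_order_le_iff:
  "swap_order A s \<le> Suc (6*v) \<longleftrightarrow> s < 6*v \<or> s = (if A v then Suc (6*v) else 6*v)"
proof -
  consider "s = 6*v" | "s = Suc (6*v)" | "s < 6*v" | "s > Suc (6*v)" by linarith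
  then show ?thesis
  proof cases
    case 3
    have "swap_order A s \<le> s + 2" by (auto simp: swap_order_def Let_def)
    moreover have "swap_order A s \<le> s + 1" if "s = 6*v - 1"
    proof -
      obtain u where "v = Suc u" using 3 by (cases v) auto
      then have s: "s = 6*u + 5" using that by simp
      then have "s div 6 = u" by simp
      then have "s \<noteq> 6 * (s div 6)" "s \<noteq> Suc (6 * (s div 6))" using s by simp_all
      then show ?thesis by (auto simp: swap_order_def Let_def)
    qed
    ultimately have "swap_order A s \<le> Suc (6*v)" using 3 by (cases "s = 6*v - 1") auto
    then show ?thesis using 3 by blast
  next
    case 4
    have "swap_order A s \<ge> s" by (auto simp: swap_order_def Let_def)
    then show ?thesis using 4 by auto
  qed (auto simp: swap_order_simps)
qed

lemma swap_order_inj: "inj (swap_order A)"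
proof (rule inj_on_inverseI)
  let ?g = "\<lambda>r. (let u = r - 1; v = u div 6 in
     if A v \<and> u = 6*v then u + 1 else if A v \<and> u = Suc (6*v) then u - 1 else u)"
  fix s assume "s \<in> (UNIV :: nat set)"
  show "?g (swap_order A s) = s"
  proof -
    define v where "v = s div 6"
    have "Suc (6*v) div 6 = v" "(6*v) div 6 = v" by presburger+
    consider "s = 6*v" | "s = Suc (6*v)" | "s \<noteq> 6*v" "s \<noteq> Suc (6*v)" by blast
    then show ?thesis
    proof cases
      case 1
      show ?thesis unfolding 1 swap_order_simps using \<open>Suc (6*v) div 6 = v\<close> by (simp add: Let_def)
    next
      case 2
      show ?thesis unfolding 2 swap_order_simps using \<open>Suc (6*v) div 6 = v\<close> by (simp add: Let_def)
    next
      case 3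
      then show ?thesis by (simp add: Let_def swap_order_def v_def[symmetric])
    qed
  qed
qed

lemma swap_order_near: "s \<le> swap_order A s" "swap_order A s \<le> s + 2"
  by (auto simp: swap_order_def Let_def)

lemma swap_order_range: assumes "s < 6*N" shows "swap_order A s \<in> {1..6*N}"
proof -
  have "swap_order A s \<ge> 1" by (auto simp: swap_order_def Let_def)
  moreover have "swap_order A s \<le> 6*N" 
  proof (cases "s = 6 * (s div 6)")
    case True
    then obtain v where v: "s = 6*v" by blast
    then have "Suc v \<le> N" using assms by simp
    then show ?thesis using swap_order_near(2)[of A s] v by linarith
  qed (use assms in \<open>auto simp: swap_order_def Let_def\<close>)
  ultimately show ?thesis by simp
qed

lemma swap_order_is_ordering: "is_ordering {..<6*N} (swap_order A)"
proof -
  have inj: "inj_on (swap_order A) {..<6*N}" using swap_order_inj inj_on_subset by blast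
  moreover have "swap_order A ` {..<6*N} = {1..6*N}"
    by (rule card_subset_eq) (use swap_order_range inj in \<open>auto simp: card_image\<close>)
  ultimately show ?thesis by (simp add: is_ordering_def bij_betw_def)
qed

text \<open>The budget is the sum of the lower bounds of the columns, so every column has to attain
  its own. \<open>N > 0\<close> makes the truncated \<open>3*N - 1\<close> a true
  predecessor.\<close>

theorem cnf_sat_iff_chain_edit:
  assumes disj: "\<And>v c. \<not> (pos v c \<and> neg v c)" and N: "N > 0"
  shows "cnf_sat N m pos neg \<longleftrightarrow>
    (\<exists>F. chain_edit_set {..<6*N} {..<m} (cnf_graph N m pos neg) Suc 1 F \<and> card F \<le> m * (3*N - 1))"
    (is "_ \<longleftrightarrow> ?R")
proof -
  let ?E = "cnf_graph N m pos neg"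
  let ?b = "\<lambda>c. gadget (\<lambda>v. pos v c) (\<lambda>v. neg v c)"
  have gad: "clause_gadget (\<lambda>v. pos v c) (\<lambda>v. neg v c)" for c
    using disj by (simp add: clause_gadget_def)
  \<comment> \<open>Once the order is fixed, the questions are edited independently, so the cost
    splits over columns.\<close>
  have slice: "card F = (\<Sum>c<m. card {s. s < 6*N \<and> (s, c) \<in> F})" if "F \<subseteq> {..<6*N} \<times> {..<m}" for F
  proof -
    have "F = prod.swap ` (SIGMA c:{..<m}. {s. s < 6*N \<and> (s, c) \<in> F})"
      using that by (auto simp: image_iff)
    then have "card F = card (SIGMA c:{..<m}. {s. s < 6*N \<and> (s, c) \<in> F})"
      by (metis (no_types, lifting) card_image inj_swap inj_on_subset subset_UNIV)
    also have "\<dots> = (\<Sum>c<m. card {s. s < 6*N \<and> (s, c) \<in> F})" by (simp add: card_SigmaI)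
    finally show ?thesis .
  qed
  show ?thesis
  proof
    assume "cnf_sat N m pos neg"
    then obtain A where "\<forall>c<m. \<exists>v<N. pos v c \<and> A v \<or> neg v c \<and> \<not> A v"
      unfolding cnf_sat_def by blast
    then obtain V where A: "\<And>c. c < m \<Longrightarrow> V c < N \<and> (pos (V c) c \<and> A (V c) \<or> neg (V c) c \<and> \<not> A (V c))"
      by metis
    \<comment> \<open>The zeros of the edited column: the cut at the pair of a variable
      \<open>V c\<close> whose literal satisfies \<open>c\<close>.\<close>
    define D where "D c = {s. s < 6*N \<and> swap_order A s \<le> Suc (6 * V c)}" for c
    define F where "F = {(s, c). s < 6*N \<and> c < m \<and> (?b c s \<longleftrightarrow> s \<in> D c)}"
    have sub: "F \<subseteq> {..<6*N} \<times> {..<m}" by (auto simp: F_def)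
    have ed: "apply_edits ?E F = {(s, c). s < 6*N \<and> c < m \<and> s \<notin> D c}"
      by (auto simp: apply_edits_def F_def cnf_graph_def)
    have "nested_ordering {..<6*N} (apply_edits ?E F) (swap_order A)"
      unfolding ed nested_ordering_def using swap_order_is_ordering
      by (auto simp: nbhd_def D_def)
    moreover have "k_near {..<6*N} Suc 1 (swap_order A)"
      unfolding k_near_def
    proof
      fix s
      show "int (swap_order A s) \<in> {int (Suc s) - int 1..int (Suc s) + int 1}"
        using swap_order_near(1)[of s A] swap_order_near(2)[of A s] by simp
    qed
    ultimately have "chain_edit_set {..<6*N} {..<m} ?E Suc 1 F"
      using sub unfolding chain_edit_set_def by blast
    moreover have "card {s. s < 6*N \<and> (s, c) \<in> F} = 3*N - 1" if c: "c < m" for c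
    proof -
      note sum_weight_block = clause_gadget.sum_weight_block[OF gad[of c]]
        and weight_simps = clause_gadget.weight_simps[OF gad[of c]]
        and card_mismatch = clause_gadget.card_mismatch[OF gad[of c]]
      let ?w = "weight (?b c)"
      define v where "v = V c"
      have v: "v < N" "pos v c \<and> A v \<or> neg v c \<and> \<not> A v" using A[OF c] by (auto simp: v_def)
      have D: "D c = insert (if A v then Suc (6*v) else 6*v) {..<6*v}"
        using v(1) by (auto simp: D_def swap_order_le_iff v_def[symmetric])
      have "sum ?w (D c) = -1"
        using v(2) disj[of v c] unfolding D
        by (auto simp: sum_weight_block weight_simps)
      moreover have "{s. s < 6*N \<and> (s, c) \<in> F} = {s. s < 6*N \<and> (?b c s \<longleftrightarrow> s \<in> D c)}"
        using c by (auto simp: F_def)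
      moreover have "D c \<subseteq> {..<6*N}" by (auto simp: D_def)
      ultimately show ?thesis using card_mismatch[where D="D c" and N=N] by simp
    qed
    ultimately show ?R using slice[OF sub] by (intro exI[of _ F]) simp
  next
    assume ?R
    then obtain F \<pi> where sub: "F \<subseteq> {..<6*N} \<times> {..<m}"
      and nest: "nested_ordering {..<6*N} (apply_edits ?E F) \<pi>"
      and near: "k_near {..<6*N} Suc 1 \<pi>" and le: "card F \<le> m * (3*N - 1)"
      unfolding chain_edit_set_def by blast
    \<comment> \<open>Only the relative order of each pair is read off; \<open>\<pi>\<close> may
      interchange other neighbours as well.\<close>
    define A where "A v \<longleftrightarrow> \<pi> (Suc (6*v)) < \<pi> (6*v)" for v
    let ?f = "\<lambda>c. card {s. s < 6*N \<and> (s, c) \<in> F}"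
    have near': "s \<le> \<pi> s" "\<pi> s \<le> s + 2" if "s < 6*N" for s
      using near that unfolding k_near_def by force+
    have key: "?f c \<ge> 3*N \<or> ?f c = 3*N - 1 \<and> (\<exists>v<N. pos v c \<and> A v \<or> neg v c \<and> \<not> A v)"
      if c: "c < m" for c
    proof -
      note sum_weight_down_set = clause_gadget.sum_weight_down_set[OF gad[of c]]
        and card_mismatch = clause_gadget.card_mismatch[OF gad[of c]]
      let ?w = "weight (?b c)"
      define D where "D = {s. s < 6*N \<and> (s, c) \<notin> apply_edits ?E F}"
      have down: "s' \<in> D" if "s \<in> D" "s' < 6*N" "\<pi> s' \<le> \<pi> s" for s s'
      proof -
        have "nbhd (apply_edits ?E F) s' \<subseteq> nbhd (apply_edits ?E F) s"
          using nest that unfolding nested_ordering_def D_def by blast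
        then show ?thesis using that by (auto simp: D_def nbhd_def)
      qed
      have D2: "s' \<in> D" if "s \<in> D" "s' + 2 \<le> s" for s s'
      proof -
        have "s < 6*N" using that by (simp add: D_def)
        then have "s' < 6*N" "\<pi> s' \<le> \<pi> s" using near'(1)[of s] near'(2)[of s'] that by linarith+
        then show ?thesis using down that(1) by blast
      qed
      have "{s. s < 6*N \<and> (s, c) \<in> F} = {s. s < 6*N \<and> (?b c s \<longleftrightarrow> s \<in> D)}"
        using c by (auto simp: D_def apply_edits_def cnf_graph_def)
      moreover have Dsub: "D \<subseteq> {..<6*N}" by (auto simp: D_def)
      ultimately have f: "int (?f c) = 3 * int N + sum ?w D" using card_mismatch[where D=D and N=N] by simp
      have "finite D" using Dsub finite_subset by blast
      from sum_weight_down_set[OF this D2] show ?thesis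
      proof
        assume "0 \<le> sum ?w D"
        then have "int (3*N) \<le> int (?f c)" using f by simp
        then show ?thesis unfolding of_nat_le_iff by blast
      next
        assume *: "sum ?w D = -1 \<and> (\<exists>v. neg v c \<and> 6*v \<in> D \<and> Suc (6*v) \<notin> D \<or> pos v c \<and> Suc (6*v) \<in> D \<and> 6*v \<notin> D)"
        then obtain v where v: "neg v c \<and> 6*v \<in> D \<and> Suc (6*v) \<notin> D \<or> pos v c \<and> Suc (6*v) \<in> D \<and> 6*v \<notin> D"
          by blast
        then have "6*v < 6*N \<or> Suc (6*v) < 6*N" using Dsub by blast
        then have "v < N" by linarith
        then have vN: "v < N" "6*v < 6*N" "Suc (6*v) < 6*N" by simp_all
        have "pos v c \<and> A v \<or> neg v c \<and> \<not> A v"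
          using v
        proof
          assume *: "neg v c \<and> 6*v \<in> D \<and> Suc (6*v) \<notin> D"
          then have "\<not> \<pi> (Suc (6*v)) \<le> \<pi> (6*v)" using down[of "6*v" "Suc (6*v)"] vN(3) by blast
          then show ?thesis using * by (simp add: A_def)
        next
          assume *: "pos v c \<and> Suc (6*v) \<in> D \<and> 6*v \<notin> D"
          then have "\<not> \<pi> (6*v) \<le> \<pi> (Suc (6*v))" using down[of "Suc (6*v)" "6*v"] vN(2) by blast
          then show ?thesis using * by (simp add: A_def)
        qed
        moreover have "?f c = 3*N - 1" using f conjunct1[OF *] N by simp
        ultimately show ?thesis using vN(1) by blast
      qed
    qed
    have "\<exists>v<N. pos v c \<and> A v \<or> neg v c \<and> \<not> A v" if c: "c < m" for c
    proof (rule ccontr)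
      assume "\<not> ?thesis"
      then have "?f c \<ge> 3*N" using key[OF c] by blast
      \<comment> \<open>No column is below \<open>3*N - 1\<close> and column \<open>c\<close> is
        above it, which exceeds the budget.\<close>
      then have "(\<Sum>c<m. 3*N - 1) < (\<Sum>c<m. ?f c)"
      proof (intro sum_strict_mono_ex1)
        show "\<forall>c\<in>{..<m}. 3*N - 1 \<le> ?f c" 
        proof
          fix c assume "c \<in> {..<m}"
          then have "3*N \<le> ?f c \<or> ?f c = 3*N - 1" using key[of c] by blast
          then show "3*N - 1 \<le> ?f c" by linarith
        qed
        show "\<exists>c\<in>{..<m}. 3*N - 1 < ?f c" 
          by (rule bexI[of _ c]) (use c \<open>?f c \<ge> 3*N\<close> N in linarith, use c in simp)
      qed simp
      then show False using le slice[OF sub] by simp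
    qed
    then show "cnf_sat N m pos neg" unfolding cnf_sat_def by blast
  qed
qed

section \<open>Counter programs on Turing machines\<close>

text \<open>
  Besides the input tape and the output tape, a program has counters. A counter is a tape with a
  marker on cell 0, its value is the head position; so each instruction is a single Turing machine step.
\<close>

datatype test = Zero nat | InOne | InBlank

datatype com = Skip | Inc nat | Dec nat | InR | InL | Emit bool
  | Seq com com | Cond test com com | Until test com

text \<open>Position of the input head, register contents, output so far.\<close>

type_synonym cstate = "int \<times> (nat \<Rightarrow> nat) \<times> bool list"

fun holds :: "bool list \<Rightarrow> cstate \<Rightarrow> test \<Rightarrow> bool" where
  "holds x (h, R, ys) (Zero r) = (R r = 0)"
| "holds x (h, R, ys) InOne = (snd (input_tape x) h = 2)"
| "holds x (h, R, ys) InBlank = (snd (input_tape x) h = 0)"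

fun effect :: "com \<Rightarrow> cstate \<Rightarrow> cstate" where
  "effect (Inc r) (h, R, ys) = (h, R(r := Suc (R r)), ys)"
| "effect (Dec r) (h, R, ys) = (h, R(r := R r - 1), ys)"
| "effect InR (h, R, ys) = (h + 1, R, ys)"
| "effect InL (h, R, ys) = (h - 1, R, ys)"
| "effect (Emit b) (h, R, ys) = (h, R, ys @ [b])"
| "effect _ s = s"

text \<open>Test outcomes enter as a parameter, so that the same function drives the program (via
  \<open>holds\<close>) and the machine, which sees only scanned symbols (via
  \<open>sym_test\<close>).\<close>

fun next_cont :: "(test \<Rightarrow> bool) \<Rightarrow> com list \<Rightarrow> com list" where
  "next_cont f [] = []"
| "next_cont f (Seq a b # K) = a # b # K"
| "next_cont f (Cond t a b # K) = (if f t then a else b) # K"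
| "next_cont f (Until t c # K) = (if f t then K else c # Until t c # K)"
| "next_cont f (_ # K) = K"

fun cstep :: "bool list \<Rightarrow> com list \<times> cstate \<Rightarrow> com list \<times> cstate" where
  "cstep x (K, s) = (next_cont (holds x s) K, case K of [] \<Rightarrow> s | c # _ \<Rightarrow> effect c s)"

text \<open>
  The stacks of commands that can occur while \<open>c\<close> is executed on top of \<open>K\<close>: finitely many, they are
  the states of the Turing machine.
\<close>

fun conts :: "com \<Rightarrow> com list \<Rightarrow> com list set" where
  "conts (Seq a b) K = {Seq a b # K} \<union> conts a (b # K) \<union> conts b K"
| "conts (Cond t a b) K = {Cond t a b # K} \<union> conts a K \<union> conts b K"
| "conts (Until t c) K = {Until t c # K} \<union> conts c (Until t c # K)"
| "conts c K = {c # K}"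

fun regs :: "com \<Rightarrow> nat set" where
  "regs (Inc r) = {r}"
| "regs (Dec r) = {r}"
| "regs (Seq a b) = regs a \<union> regs b"
| "regs (Cond t a b) = (case t of Zero r \<Rightarrow> {r} | _ \<Rightarrow> {}) \<union> regs a \<union> regs b"
| "regs (Until t c) = (case t of Zero r \<Rightarrow> {r} | _ \<Rightarrow> {}) \<union> regs c"
| "regs _ = {}"

lemma finite_regs: "finite (regs c)"
  by (induction c) (auto split: test.splits)

lemma finite_conts: "finite (conts c K)"
  by (induction c arbitrary: K) auto

lemma Cons_in_conts: "c # K \<in> conts c K"
  by (cases c) auto

lemma Nil_notin_conts: "[] \<notin> conts c K"
  by (induction c arbitrary: K) auto

text \<open>Executing a stack of \<open>conts c K\<close> leads to another such stack until
  \<open>c\<close> is finished and \<open>K\<close> is uncovered; so the state set of the machine is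
  closed under steps.\<close>

lemma next_cont_in_conts: "L \<in> conts c K \<Longrightarrow> next_cont f L \<in> insert K (conts c K)"
proof (induction c arbitrary: K)
  case (Seq a b)
  then show ?case using Cons_in_conts[of a "b # K"] Cons_in_conts[of b K] by fastforce
next
  case (Cond t a b)
  from Cond.prems consider "L = Cond t a b # K" | "L \<in> conts a K" | "L \<in> conts b K" by auto
  then show ?case
    by cases (use Cond.IH Cons_in_conts[of a K] Cons_in_conts[of b K] in auto)
next
  case (Until t c)
  from Until.prems consider "L = Until t c # K" | "L \<in> conts c (Until t c # K)" by auto
  then show ?case
    by cases (use Until.IH Cons_in_conts[of c "Until t c # K"] in auto)
qed auto

lemma regs_conts: "L \<in> conts c K \<Longrightarrow> \<Union> (regs ` set L) \<subseteq> regs c \<union> \<Union> (regs ` set K)"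
proof (induction c arbitrary: K)
  case (Seq a b)
  from Seq.prems consider "L = Seq a b # K" | "L \<in> conts a (b # K)" | "L \<in> conts b K" by auto
  then show ?case
  proof cases
    case 2 then show ?thesis using Seq.IH(1)[OF 2] by auto
  next
    case 3 then show ?thesis using Seq.IH(2)[OF 3] by auto
  qed auto
next
  case (Cond t a b)
  from Cond.prems consider "L = Cond t a b # K" | "L \<in> conts a K" | "L \<in> conts b K" by auto
  then show ?case
  proof cases
    case 2 then show ?thesis using Cond.IH(1)[OF 2] by auto
  next
    case 3 then show ?thesis using Cond.IH(2)[OF 3] by auto
  qed auto
next
  case (Until t c)
  from Until.prems consider "L = Until t c # K" | "L \<in> conts c (Until t c # K)" by auto
  then show ?case
  proof cases
    case 2 then show ?thesis using Until.IH[OF 2] by auto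
  qed auto
qed auto

section \<open>Simulation of programs by Turing machines\<close>

definition marker :: "int \<Rightarrow> nat" where
  "marker = (\<lambda>_. 0)(0 := 1)"

text \<open>The output tape has the contents of an input tape with its head on the first free cell,
  which is the format that \<open>tm_output\<close> expects.\<close>

fun tapes :: "nat \<Rightarrow> bool list \<Rightarrow> cstate \<Rightarrow> tape list" where
  "tapes C x (h, R, ys) = (h, snd (input_tape x)) #
     map (\<lambda>r. (int (R r), marker)) [0..<C] @ [(int (length ys), snd (input_tape ys))]"

text \<open>A counter is 0 exactly if its head scans the marker, which is symbol 1; symbol 2 is the
  bit \<open>True\<close>.\<close>

fun sym_test :: "nat list \<Rightarrow> test \<Rightarrow> bool" where
  "sym_test rs (Zero r) = (rs ! Suc r = 1)"
| "sym_test rs InOne = (rs ! 0 = 2)"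
| "sym_test rs InBlank = (rs ! 0 = 0)"

text \<open>Apart from \<open>Emit\<close>, scanned symbols are written back unchanged.
  \<open>Dec\<close> does not move off the marker, in agreement with truncated subtraction.\<close>

fun actions :: "nat \<Rightarrow> com \<Rightarrow> nat list \<Rightarrow> (nat \<times> direction) list" where
  "actions C (Inc r) rs = (map (\<lambda>a. (a, Stay)) rs)[Suc r := (rs ! Suc r, Right)]"
| "actions C (Dec r) rs =
     (map (\<lambda>a. (a, Stay)) rs)[Suc r := (rs ! Suc r, if rs ! Suc r = 1 then Stay else Left)]"
| "actions C InR rs = (map (\<lambda>a. (a, Stay)) rs)[0 := (rs ! 0, Right)]"
| "actions C InL rs = (map (\<lambda>a. (a, Stay)) rs)[0 := (rs ! 0, Left)]"
| "actions C (Emit b) rs = (map (\<lambda>a. (a, Stay)) rs)[Suc C := (bit_symbol b, Right)]"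
| "actions C _ rs = map (\<lambda>a. (a, Stay)) rs"

lemma length_tapes [simp]: "length (tapes C x s) = C + 2"
  by (cases s) auto

lemma nth_tapes:
  "tapes C x (h, R, ys) ! 0 = (h, snd (input_tape x))"
  "r < C \<Longrightarrow> tapes C x (h, R, ys) ! Suc r = (int (R r), marker)"
  "tapes C x (h, R, ys) ! Suc C = (int (length ys), snd (input_tape ys))"
  by (auto simp: nth_append)

lemma tape_index_cases:
  assumes "i < C + 2"
  obtains "i = 0" | r where "i = Suc r" "r < C" | "i = Suc C"
  using assms by (cases i) (auto simp: less_Suc_eq)

lemma tapes_eqI:
  assumes "length ts = C + 2" "ts ! 0 = (h, snd (input_tape x))"
    "\<And>r. r < C \<Longrightarrow> ts ! Suc r = (int (R r), marker)"
    "ts ! Suc C = (int (length ys), snd (input_tape ys))"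
  shows "ts = tapes C x (h, R, ys)"
proof (rule nth_equalityI)
  fix i assume "i < length ts"
  then have "i < C + 2" using assms(1) by simp
  then show "ts ! i = tapes C x (h, R, ys) ! i"
    by (cases rule: tape_index_cases) (use assms nth_tapes in \<open>simp_all del: tapes.simps\<close>)
qed (use assms in \<open>simp del: tapes.simps\<close>)

lemma act_tape_read: "act_tape (read_tape t, Stay) t = t"
  by (simp add: act_tape_def read_tape_def move_head_def)

lemma map2_act_tape_id: "map2 act_tape (map (\<lambda>a. (a, Stay)) (map read_tape ts)) ts = ts"
  by (induction ts) (auto simp: act_tape_read)

lemma map2_act_tape_update:
  "map2 act_tape ((map (\<lambda>a. (a, Stay)) (map read_tape ts))[i := a]) ts = ts[i := act_tape a (ts ! i)]"
proof (rule nth_equalityI)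
  fix j assume "j < length (map2 act_tape ((map (\<lambda>a. (a, Stay)) (map read_tape ts))[i := a]) ts)"
  then show "map2 act_tape ((map (\<lambda>a. (a, Stay)) (map read_tape ts))[i := a]) ts ! j =
      ts[i := act_tape a (ts ! i)] ! j"
    by (cases "i = j") (simp_all add: act_tape_read)
qed simp

lemma input_tape_snoc:
  "snd (input_tape (ys @ [b])) = (snd (input_tape ys))(int (length ys) := bit_symbol b)"
  by (rule ext) (auto simp: input_tape_def nth_append nat_less_iff)

lemma marker_simps:
  "marker 0 = 1" "n > 0 \<Longrightarrow> marker (int n) = 0"
  "marker(0 := Suc 0) = marker" "n > 0 \<Longrightarrow> marker(int n := 0) = marker"
  by (auto simp: marker_def)

lemma read_counter: "r < C \<Longrightarrow> read_tape (tapes C x (h, R, ys) ! Suc r) = (if R r = 0 then 1 else 0)"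
  by (simp add: nth_tapes read_tape_def marker_def del: tapes.simps)

lemma read_input: "read_tape (tapes C x (h, R, ys) ! 0) = snd (input_tape x) h"
  by (simp add: read_tape_def)

lemma map2_actions:
  assumes "regs c \<subseteq> {..<C}"
  shows "map2 act_tape (actions C c (map read_tape (tapes C x s))) (tapes C x s) = tapes C x (effect c s)"
proof -
  obtain h R ys where s: "s = (h, R, ys)" by (metis prod_cases3)
  note simps = map2_act_tape_update nth_list_update nth_tapes act_tape_def read_tape_def move_head_def
  show ?thesis
  proof (cases c)
    case (Inc r)
    then have "r < C" using assms by simp
    then show ?thesis unfolding s Inc actions.simps effect.simps map2_act_tape_update
      by (cases "R r = 0"; intro tapes_eqI)
        (auto simp: simps read_tape_def marker_simps simp del: tapes.simps)
  next
    case (Dec r)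
    then have "r < C" using assms by simp
    then show ?thesis unfolding s Dec actions.simps effect.simps map2_act_tape_update
      by (cases "R r = 0"; intro tapes_eqI)
        (auto simp: simps read_tape_def marker_simps simp del: tapes.simps)
  next
    case InR
    then show ?thesis unfolding s InR actions.simps effect.simps map2_act_tape_update
      by (intro tapes_eqI) (auto simp: simps simp del: tapes.simps)
  next
    case InL
    then show ?thesis unfolding s InL actions.simps effect.simps map2_act_tape_update
      by (intro tapes_eqI) (auto simp: simps simp del: tapes.simps)
  next
    case (Emit b)
    then show ?thesis unfolding s Emit actions.simps effect.simps map2_act_tape_update
      by (intro tapes_eqI) (auto simp: simps input_tape_snoc simp del: tapes.simps)
  qed (use map2_act_tape_id in \<open>auto simp del: tapes.simps\<close>)
qed

lemma next_cont_sym_test: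
  assumes "\<Union> (regs ` set K) \<subseteq> {..<C}"
  shows "next_cont (sym_test (map read_tape (tapes C x s))) K = next_cont (holds x s) K"
proof -
  obtain h R ys where s: "s = (h, R, ys)" by (metis prod_cases3)
  have *: "sym_test (map read_tape (tapes C x s)) t = holds x s t"
    if "case t of Zero r \<Rightarrow> r < C | _ \<Rightarrow> True" for t
    using that unfolding s by (cases t) (auto simp: read_counter read_input simp del: tapes.simps)
  show ?thesis
  proof (cases K)
    case (Cons c L)
    then have "regs c \<subseteq> {..<C}" using assms by auto
    then show ?thesis unfolding Cons
    proof (cases c)
      case (Cond t a b)
      then have "case t of Zero r \<Rightarrow> r < C | _ \<Rightarrow> True"
        using \<open>regs c \<subseteq> {..<C}\<close> by (auto split: test.splits)
      then show "next_cont (sym_test (map read_tape (tapes C x s))) (c # L) = next_cont (holds x s) (c # L)"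
        using *[of t] Cond by (simp del: tapes.simps sym_test.simps holds.simps)
    next
      case (Until t a)
      then have "case t of Zero r \<Rightarrow> r < C | _ \<Rightarrow> True"
        using \<open>regs c \<subseteq> {..<C}\<close> by (auto split: test.splits)
      then show "next_cont (sym_test (map read_tape (tapes C x s))) (c # L) = next_cont (holds x s) (c # L)"
        using *[of t] Until by (simp del: tapes.simps sym_test.simps holds.simps)
    qed auto
  qed simp
qed

text \<open>Counter tapes start blank, so state 0 is spent on writing the markers. Nonempty stacks
  are numbered from 1 on, and the empty stack is the halting state.\<close>

definition com_tm :: "nat \<Rightarrow> com \<Rightarrow> (com list \<Rightarrow> nat) \<Rightarrow> tm" where
  "com_tm C P g = \<lparr>num_tapes = C + 2, num_symbols = 3, num_states = Suc (card (conts P [])),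
     trans = \<lambda>q rs. if q = 0
       then (Suc (g [P]), map (\<lambda>i. (if 1 \<le> i \<and> i \<le> C then 1 else rs ! i, Stay)) [0..<C + 2])
       else (let K = inv_into (conts P []) g (q - 1); K' = next_cont (sym_test rs) K in
         (if K' = [] then Suc (card (conts P [])) else Suc (g K'), actions C (hd K) rs))\<rparr>"

lemma actions_range: "fst ` set (actions C c rs) \<subseteq> {1, 2} \<union> set rs"
proof -
  have upd: "fst ` set ((map (\<lambda>a. (a, Stay)) rs)[i := (a, d)]) \<subseteq> insert a (set rs)" for i a d
  proof -
    have "set ((map (\<lambda>a. (a, Stay)) rs)[i := (a, d)]) \<subseteq> insert (a, d) (set (map (\<lambda>a. (a, Stay)) rs))"
      by (rule set_update_subset_insert)
    then show ?thesis by fastforce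
  qed
  have upd': "fst ` set ((map (\<lambda>a. (a, Stay)) rs)[i := (rs ! i, d)]) \<subseteq> set rs" for i d
    using upd[of i "rs ! i" d] nth_mem[of i rs]
    by (cases "i < length rs") (auto simp: list_update_beyond)
  show ?thesis
  proof (cases c)
    case (Inc r) then show ?thesis using upd'[of "Suc r" Right] by auto
  next
    case (Dec r) then show ?thesis using upd'[of "Suc r" Stay] upd'[of "Suc r" Left]
      unfolding Dec actions.simps by (simp only: split: if_splits) blast
  next
    case InR then show ?thesis using upd'[of 0 Right] by auto
  next
    case InL then show ?thesis using upd'[of 0 Left] by auto
  next
    case (Emit b) then show ?thesis using upd[of "Suc C" "bit_symbol b" Right]
      by (auto simp: bit_symbol_def split: if_splits)
  qed auto
qed

lemma length_actions: "length (actions C c rs) = length rs"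
  by (cases c) auto

text \<open>The machine follows the program step for step; writing the markers adds 1 to the time
  bound.\<close>

theorem poly_time_computable_com:
  assumes run: "\<And>x. \<exists>n s. n \<le> poly p (length x) \<and> (cstep x ^^ n) ([P], (0, \<lambda>_. 0, [])) = ([], s) \<and> snd (snd s) = f x"
  shows "poly_time_computable f"
proof -
  let ?S = "conts P []"
  obtain C where C: "regs P \<subseteq> {..<C}"
    using finite_regs finite_nat_iff_bounded by blast
  obtain g where g: "bij_betw g ?S {0..<card ?S}"
    using ex_bij_betw_finite_nat[OF finite_conts] by blast
  define M where "M = com_tm C P g"
  define idx where "idx K = (if K = [] then Suc (card ?S) else Suc (g K))" for K
  have M: "num_tapes M = C + 2" "num_symbols M = 3" "num_states M = Suc (card ?S)"
    by (simp_all add: M_def com_tm_def)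
  have P: "[P] \<in> ?S" by (rule Cons_in_conts)
  have gS: "g K < card ?S" if "K \<in> ?S" for K using g that by (auto simp: bij_betw_def)
  have wf: "wf_tm M"
    unfolding wf_tm_def M
  proof (intro conjI allI impI)
    fix q and rs :: "nat list" assume q: "q < Suc (card ?S)" and rs: "length rs = C + 2 \<and> set rs \<subseteq> {..<3}"
    have nth: "rs ! i < 3" if "i < length rs" for i using rs that nth_mem by blast
    show "case trans M q rs of (q', as) \<Rightarrow>
        q' \<le> Suc (card ?S) \<and> length as = C + 2 \<and> fst ` set as \<subseteq> {..<3}"
    proof (cases "q = 0")
      case True
      then show ?thesis using gS[OF P] rs nth
        by (auto simp: M_def com_tm_def simp del: upt_Suc)
    next
      case False
      define K where "K = inv_into ?S g (q - 1)"
      have "q - 1 \<in> g ` ?S" using g q False by (auto simp: bij_betw_def)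
      then have "K \<in> ?S" unfolding K_def by (rule inv_into_into)
      then have "next_cont (sym_test rs) K \<in> insert [] ?S" by (rule next_cont_in_conts)
      moreover have "fst ` set (actions C (hd K) rs) \<subseteq> {..<3}"
        using actions_range[of C "hd K" rs] rs nth by fastforce
      ultimately show ?thesis using False rs gS length_actions
        by (auto simp: M_def com_tm_def Let_def K_def[symmetric, simplified] less_imp_le)
    qed
  qed simp_all
  have sim: "tm_step M (idx K, tapes C x s) = (case cstep x (K, s) of (K', s') \<Rightarrow> (idx K', tapes C x s'))"
    if K: "K \<in> ?S" for K x s
  proof -
    obtain c L where cL: "K = c # L" using K Nil_notin_conts by (cases K) auto
    have "inv_into ?S g (g K) = K" using g K by (simp add: bij_betw_def)
    moreover have rK: "\<Union> (regs ` set K) \<subseteq> {..<C}" using regs_conts[OF K] C by auto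
    moreover have "regs c \<subseteq> {..<C}" using rK cL by auto
    ultimately show ?thesis
      using gS[OF K] next_cont_sym_test[OF rK, of x s] map2_actions[of c C x s] cL
      by (simp add: tm_step_def M idx_def M_def com_tm_def Let_def del: tapes.simps)
  qed
  \<comment> \<open>This holds for every \<open>n\<close>, also past the end: neither an empty stack
    nor a halted machine moves.\<close>
  have steps: "(cstep x ^^ n) ([P], s) = (K', s') \<Longrightarrow> K' \<in> insert [] ?S \<and>
      (tm_step M ^^ n) (idx [P], tapes C x s) = (idx K', tapes C x s')" for n x s K' s'
  proof (induction n arbitrary: K' s')
    case 0
    then show ?case using P by simp
  next
    case (Suc n)
    obtain K1 s1 where 1: "(cstep x ^^ n) ([P], s) = (K1, s1)"
      using prod.exhaust by blast
    then have st: "cstep x (K1, s1) = (K', s')" using Suc.prems by simp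
    note IH = Suc.IH[OF 1]
    show ?case
    proof (cases "K1 = []")
      case True
      then have "K' = []" "s' = s1" using st by auto
      then show ?thesis using IH True by (simp add: tm_step_def idx_def M)
    next
      case False
      then have "K1 \<in> ?S" using IH by simp
      then show ?thesis using IH sim[of K1 x s1] st next_cont_in_conts[of K1 P "[]"] by auto
    qed
  qed
  have init: "tm_step M (tm_init M x) = (idx [P], tapes C x (0, \<lambda>_. 0, []))" for x
  proof -
    let ?ts = "input_tape x # replicate (Suc C) (0, \<lambda>_. 0)"
    let ?as = "map (\<lambda>i. (if 1 \<le> i \<and> i \<le> C then 1 else map read_tape ?ts ! i, Stay)) [0..<C + 2]"
    have "map2 act_tape ?as ?ts = tapes C x (0, \<lambda>_. 0, [])"
    proof (rule tapes_eqI)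
      show "map2 act_tape ?as ?ts ! 0 = (0, snd (input_tape x))"
        by (simp add: act_tape_read del: upt_Suc) (simp add: input_tape_def)
      show "map2 act_tape ?as ?ts ! Suc r = (int 0, marker)" if "r < C" for r
        using that by (simp add: act_tape_def move_head_def marker_def del: upt_Suc replicate_Suc)
      show "map2 act_tape ?as ?ts ! Suc C = (int (length []), snd (input_tape []))"
        by (simp add: act_tape_def move_head_def read_tape_def input_tape_def fun_eq_iff del: upt_Suc replicate_Suc)
    qed simp
    then show ?thesis
      by (simp add: tm_step_def tm_init_def M idx_def M_def com_tm_def del: upt_Suc replicate_Suc tapes.simps)
  qed
  have "tm_computes_in_time M f (poly (p + 1))"
    unfolding tm_computes_in_time_def
  proof
    fix x
    from run[of x] obtain n s where n: "n \<le> poly p (length x)"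
      and r: "(cstep x ^^ n) ([P], (0, \<lambda>_. 0, [])) = ([], s)" and out: "snd (snd s) = f x" by blast
    have fin: "(tm_step M ^^ Suc n) (tm_init M x) = (num_states M, tapes C x s)"
      using steps[OF r] by (simp add: funpow_swap1 init idx_def M del: funpow.simps tapes.simps)
        (simp add: funpow_Suc_right init idx_def del: funpow.simps tapes.simps)
    obtain h R where s: "s = (h, R, f x)" using out by (metis prod.collapse)
    have "tm_output (num_states M, tapes C x s) (f x)"
      by (auto simp: tm_output_def s input_tape_def)
    then show "\<exists>n\<le>poly (p + 1) (length x). tm_halted M ((tm_step M ^^ n) (tm_init M x)) \<and>
        tm_output ((tm_step M ^^ n) (tm_init M x)) (f x)"
      using fin n by (intro exI[of _ "Suc n"]) (simp add: tm_halted_def del: funpow.simps tapes.simps)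
  qed
  then show ?thesis using wf unfolding poly_time_computable_def by blast
qed

section \<open>Arithmetic expressions\<close>

text \<open>The number of steps is only bounded by \<open>n\<close>, but it must not depend on the
  stack \<open>K\<close> below; this makes runs of consecutive commands composable.\<close>

definition runs :: "bool list \<Rightarrow> com \<Rightarrow> cstate \<Rightarrow> nat \<Rightarrow> cstate \<Rightarrow> bool" where
  "runs x c s n s' \<longleftrightarrow> (\<exists>k\<le>n. \<forall>K. (cstep x ^^ k) (c # K, s) = (K, s'))"

lemma runsD:
  assumes "runs x c s n s'"
  obtains k where "k \<le> n" "\<And>K. (cstep x ^^ k) (c # K, s) = (K, s')"
  using assms unfolding runs_def by blast

lemma runs_mono: "runs x c s n s' \<Longrightarrow> n \<le> m \<Longrightarrow> runs x c s m s'"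
  unfolding runs_def using le_trans by blast

lemma runs_step:
  assumes "\<And>K. cstep x (c # K, s) = (c' # K, s')" "runs x c' s' n s''"
  shows "runs x c s (Suc n) s''"
proof -
  obtain k where "k \<le> n" "\<And>K. (cstep x ^^ k) (c' # K, s') = (K, s'')" by (rule runsD[OF assms(2)]) blast
  then show ?thesis unfolding runs_def
    by (intro exI[of _ "Suc k"]) (simp add: funpow_Suc_right assms(1) del: funpow.simps cstep.simps)
qed

lemma runs_atom: "(\<And>K. cstep x (c # K, s) = (K, s')) \<Longrightarrow> 1 \<le> n \<Longrightarrow> runs x c s n s'"
  unfolding runs_def by (intro exI[of _ 1]) (simp del: cstep.simps)

lemma runs_atoms:
  "runs x Skip s 1 s"
  "runs x (Inc r) (h, R, ys) 1 (h, R(r := Suc (R r)), ys)"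
  "runs x (Dec r) (h, R, ys) 1 (h, R(r := R r - 1), ys)"
  "runs x InR (h, R, ys) 1 (h + 1, R, ys)"
  "runs x InL (h, R, ys) 1 (h - 1, R, ys)"
  "runs x (Emit b) (h, R, ys) 1 (h, R, ys @ [b])"
  by (rule runs_atom; simp)+

lemma runs_Seq:
  assumes "runs x a s n s'" "runs x b s' m s''"
  shows "runs x (Seq a b) s (n + m + 1) s''"
proof -
  obtain k where k: "k \<le> n" "\<And>K. (cstep x ^^ k) (a # K, s) = (K, s')" by (rule runsD[OF assms(1)]) blast
  obtain l where l: "l \<le> m" "\<And>K. (cstep x ^^ l) (b # K, s') = (K, s'')" by (rule runsD[OF assms(2)]) blast
  have "(cstep x ^^ (l + k + 1)) (Seq a b # K, s) = (K, s'')" for K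
  proof -
    have "(cstep x ^^ (l + k + 1)) (Seq a b # K, s) = (cstep x ^^ l) ((cstep x ^^ k) (a # b # K, s))"
      by (simp add: funpow_Suc_right funpow_add del: funpow.simps)
    then show ?thesis using k(2) l(2) by simp
  qed
  then show ?thesis unfolding runs_def using k(1) l(1) by (intro exI[of _ "l + k + 1"]) simp
qed

lemma runs_Seq':
  assumes "runs x a s n s'" "runs x b s' m s''" "n + m + 1 \<le> t"
  shows "runs x (Seq a b) s t s''"
  using runs_Seq[OF assms(1,2)] assms(3) runs_mono by blast

lemma runs_Cond:
  assumes "runs x (if holds x s t then a else b) s n s'"
  shows "runs x (Cond t a b) s (Suc n) s'"
  by (rule runs_step[OF _ assms]) simp

lemma runs_Until_step:
  assumes "\<not> holds x s t" "runs x c s n s'" "runs x (Until t c) s' m s''"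
  shows "runs x (Until t c) s (n + m + 1) s''"
proof -
  obtain k where k: "k \<le> n" "\<And>K. (cstep x ^^ k) (c # K, s) = (K, s')" by (rule runsD[OF assms(2)]) blast
  obtain l where l: "l \<le> m" "\<And>K. (cstep x ^^ l) (Until t c # K, s') = (K, s'')"
    by (rule runsD[OF assms(3)]) blast
  have "(cstep x ^^ (l + k + 1)) (Until t c # K, s) = (K, s'')" for K
  proof -
    have "(cstep x ^^ (l + k + 1)) (Until t c # K, s) = (cstep x ^^ l) ((cstep x ^^ k) (c # Until t c # K, s))"
      using assms(1) by (simp add: funpow_Suc_right funpow_add del: funpow.simps)
    then show ?thesis using k(2) l(2) by simp
  qed
  then show ?thesis unfolding runs_def using k(1) l(1) by (intro exI[of _ "l + k + 1"]) simp
qed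

lemma runs_Until_end: "holds x s t \<Longrightarrow> runs x (Until t c) s 1 s"
  by (rule runs_atom) auto

text \<open>\<open>S i\<close> is the explicit state after \<open>i\<close> rounds, and
  \<open>b\<close> a uniform bound for the cost of one round.\<close>

lemma runs_Until:
  assumes "\<And>i. i < n \<Longrightarrow> \<not> holds x (S i) t \<and> runs x c (S i) b (S (Suc i))" "holds x (S n) t"
  shows "runs x (Until t c) (S 0) (n * (b + 1) + 1) (S n)"
  using assms
proof (induction n arbitrary: S)
  case 0
  then show ?case using runs_Until_end by simp
next
  case (Suc n)
  have "runs x (Until t c) (S 1) (n * (b + 1) + 1) (S (Suc n))"
    using Suc.IH[of "\<lambda>i. S (Suc i)"] Suc.prems by simp
  then have "runs x (Until t c) (S 0) (b + (n * (b + 1) + 1) + 1) (S (Suc n))"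
    using runs_Until_step[of x "S 0" t c b "S 1"] Suc.prems(1)[of 0] by (metis One_nat_def zero_less_Suc)
  then show ?case by (rule runs_mono) simp
qed

lemma runs_Until':
  assumes "s = S 0" "s' = S n" "n * (b + 1) + 1 \<le> m"
    and "\<And>i. i < n \<Longrightarrow> \<not> holds x (S i) t" "\<And>i. i < n \<Longrightarrow> runs x c (S i) b (S (Suc i))" "holds x (S n) t"
  shows "runs x (Until t c) s m s'"
  using runs_mono[OF runs_Until[of n x S t c b] assms(3)] assms by blast

definition move :: "nat \<Rightarrow> nat \<Rightarrow> com" where
  "move a b = Until (Zero a) (Seq (Dec a) (Inc b))"

definition clear :: "nat \<Rightarrow> com" where
  "clear a = Until (Zero a) (Dec a)"

text \<open>A counter can only be read by counting it down, so \<open>tmp\<close> keeps the value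
  for restoring \<open>a\<close>.\<close>

definition copy :: "nat \<Rightarrow> nat \<Rightarrow> nat \<Rightarrow> com" where
  "copy a b tmp = Seq (move a tmp) (Until (Zero tmp) (Seq (Dec tmp) (Seq (Inc a) (Inc b))))"

lemma cstate_eqI: "h = h' \<Longrightarrow> (\<And>r. R r = R' r) \<Longrightarrow> ys = ys' \<Longrightarrow> (h, R, ys) = (h', R', ys')"
  for R R' :: "nat \<Rightarrow> nat"
  by auto

lemma runs_eq: "runs x c s n s'' \<Longrightarrow> s'' = s' \<Longrightarrow> runs x c s n s'"
  by simp

lemma runs_move:
  assumes "a \<noteq> b"
  shows "runs x (move a b) (h, R, ys) (4 * R a + 1) (h, R(a := 0, b := R b + R a), ys)"
  unfolding move_def
proof (rule runs_Until'[where n = "R a" and b = 3 and S = "\<lambda>i. (h, R(a := R a - i, b := R b + i), ys)"])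
  fix i assume i: "i < R a"
  show "runs x (Seq (Dec a) (Inc b)) (h, R(a := R a - i, b := R b + i), ys) 3
      (h, R(a := R a - Suc i, b := R b + Suc i), ys)"
    by (rule runs_eq[OF runs_Seq'[OF runs_atoms(3) runs_atoms(2)]])
      (use assms i in \<open>auto intro!: cstate_eqI\<close>)
qed (use assms in \<open>auto intro!: cstate_eqI\<close>)

lemma runs_clear: "runs x (clear a) (h, R, ys) (2 * R a + 1) (h, R(a := 0), ys)"
  unfolding clear_def
proof (rule runs_Until'[where n = "R a" and b = 1 and S = "\<lambda>i. (h, R(a := R a - i), ys)"])
  fix i assume i: "i < R a"
  show "runs x (Dec a) (h, R(a := R a - i), ys) 1 (h, R(a := R a - Suc i), ys)"
    by (rule runs_eq[OF runs_atoms(3)]) (auto intro!: cstate_eqI)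
qed (auto intro!: cstate_eqI)

lemma runs_copy:
  assumes "a \<noteq> b" "a \<noteq> e" "b \<noteq> e" "R e = 0"
  shows "runs x (copy a b e) (h, R, ys) (10 * R a + 3) (h, R(b := R b + R a), ys)"
  unfolding copy_def
proof (rule runs_Seq'[OF runs_move])
  show "runs x (Until (Zero e) (Seq (Dec e) (Seq (Inc a) (Inc b)))) (h, R(a := 0, e := R e + R a), ys)
      (6 * R a + 1) (h, R(b := R b + R a), ys)"
  proof (rule runs_Until'[where n = "R a" and b = 5 and
        S = "\<lambda>i. (h, R(a := i, b := R b + i, e := R a - i), ys)"])
    fix i assume i: "i < R a"
    show "runs x (Seq (Dec e) (Seq (Inc a) (Inc b))) (h, R(a := i, b := R b + i, e := R a - i), ys) 5
      (h, R(a := Suc i, b := R b + Suc i, e := R a - Suc i), ys)"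
      by (rule runs_eq[OF runs_Seq'[OF runs_atoms(3) runs_Seq[OF runs_atoms(2) runs_atoms(2)]]])
        (use assms i in \<open>auto intro!: cstate_eqI\<close>)
  qed (use assms in \<open>auto intro!: cstate_eqI\<close>)
qed (use assms in auto)

section \<open>Compilation of expressions with polynomial bounds\<close>

datatype exp = Const nat | Var nat | Len | InBit exp
  | Add exp exp | Sub exp exp | Mul exp exp | Div exp exp

text \<open>Division by 0 returns the dividend: this is what the subtraction loop computes.\<close>

fun eval :: "bool list \<Rightarrow> exp \<Rightarrow> (nat \<Rightarrow> nat) \<Rightarrow> nat" where
  "eval x (Const n) R = n"
| "eval x (Var i) R = R i"
| "eval x Len R = length x"
| "eval x (InBit e) R = of_bool (eval x e R < length x \<and> x ! eval x e R)"
| "eval x (Add a b) R = eval x a R + eval x b R"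
| "eval x (Sub a b) R = eval x a R - eval x b R"
| "eval x (Mul a b) R = eval x a R * eval x b R"
| "eval x (Div a b) R = (if eval x b R = 0 then eval x a R else eval x a R div eval x b R)"

fun vars_below :: "exp \<Rightarrow> nat \<Rightarrow> bool" where
  "vars_below (Var i) d = (i < d)"
| "vars_below (InBit e) d = vars_below e d"
| "vars_below (Add a b) d = (vars_below a d \<and> vars_below b d)"
| "vars_below (Sub a b) d = (vars_below a d \<and> vars_below b d)"
| "vars_below (Mul a b) d = (vars_below a d \<and> vars_below b d)"
| "vars_below (Div a b) d = (vars_below a d \<and> vars_below b d)"
| "vars_below _ d = True"

lemma vars_below_mono: "vars_below e d \<Longrightarrow> d \<le> d' \<Longrightarrow> vars_below e d'"
  by (induction e) auto

lemma eval_upd: "vars_below e d \<Longrightarrow> d \<le> r \<Longrightarrow> eval x e (R(r := v)) = eval x e R"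
  by (induction e) auto

primrec incs :: "nat \<Rightarrow> nat \<Rightarrow> com" where
  "incs d 0 = Skip"
| "incs d (Suc n) = Seq (Inc d) (incs d n)"

text \<open>The second count in \<open>Suc d\<close> serves to bring the input head back to cell 0,
  where all code expects it.\<close>

definition len_code :: "nat \<Rightarrow> com" where
  "len_code d = Seq (Until InBlank (Seq InR (Seq (Inc d) (Inc (Suc d)))))
     (Until (Zero (Suc d)) (Seq (Dec (Suc d)) InL))"

text \<open>Past the end of the input the scanned cell is blank and fails \<open>InOne\<close>, so
  such positions yield 0.\<close>

definition bit_code :: "nat \<Rightarrow> com" where
  "bit_code d = Seq (Until (Zero d) (Seq (Dec d) (Seq InR (Inc (Suc d)))))
     (Seq (Cond InOne (Inc d) Skip) (Until (Zero (Suc d)) (Seq (Dec (Suc d)) InL)))"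

definition sub_code :: "nat \<Rightarrow> com" where
  "sub_code d = Until (Zero (Suc d)) (Seq (Dec (Suc d)) (Dec d))"

definition mul_code :: "nat \<Rightarrow> com" where
  "mul_code d = Seq (Until (Zero (Suc d)) (Seq (Dec (Suc d)) (copy d (d + 2) (d + 3))))
     (Seq (clear d) (move (d + 2) d))"

text \<open>Register \<open>d + 2\<close> is a copy of the divisor that is counted down and
  refilled, \<open>d + 3\<close> the quotient. For divisor 0 the copy is 0 in every round, so each
  round increments the quotient.\<close>

definition div_code :: "nat \<Rightarrow> com" where
  "div_code d = Seq (copy (d + 1) (d + 2) (d + 4))
     (Seq (Until (Zero d) (Seq (Dec d) (Seq (Dec (d + 2))
        (Cond (Zero (d + 2)) (Seq (Inc (d + 3)) (copy (d + 1) (d + 2) (d + 4))) Skip))))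
     (Seq (clear (d + 1)) (Seq (clear (d + 2)) (move (d + 3) d))))"

text \<open>
  \<open>code d e\<close> expects all registers from \<open>d\<close> on to be 0, and leaves the value of \<open>e\<close> in register \<open>d\<close>.
\<close>

fun code :: "nat \<Rightarrow> exp \<Rightarrow> com" where
  "code d (Const n) = incs d n"
| "code d (Var i) = copy i d (Suc d)"
| "code d Len = len_code d"
| "code d (InBit e) = Seq (code d e) (bit_code d)"
| "code d (Add a b) = Seq (code d a) (Seq (code (Suc d) b) (move (Suc d) d))"
| "code d (Sub a b) = Seq (code d a) (Seq (code (Suc d) b) (sub_code d))"
| "code d (Mul a b) = Seq (code d a) (Seq (code (Suc d) b) (mul_code d))"
| "code d (Div a b) = Seq (code d a) (Seq (code (Suc d) b) (div_code d))"

lemma runs_incs: "runs x (incs d n) (h, R, ys) (2 * n + 1) (h, R(d := R d + n), ys)"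
proof (induction n arbitrary: R)
  case 0
  show ?case using runs_atoms(1) by simp
next
  case (Suc n)
  show ?case unfolding incs.simps
    by (rule runs_eq[OF runs_Seq'[OF runs_atoms(2) Suc.IH]]) (auto intro!: cstate_eqI)
qed

lemma runs_rewind:
  "runs x (Until (Zero r) (Seq (Dec r) InL)) (h, R, ys) (4 * R r + 1) (h - int (R r), R(r := 0), ys)"
proof (rule runs_Until'[where n = "R r" and b = 3 and S = "\<lambda>i. (h - int i, R(r := R r - i), ys)"])
  fix i assume i: "i < R r"
  show "runs x (Seq (Dec r) InL) (h - int i, R(r := R r - i), ys) 3 (h - int (Suc i), R(r := R r - Suc i), ys)"
    by (rule runs_eq[OF runs_Seq'[OF runs_atoms(3) runs_atoms(5)]]) (use i in \<open>auto intro!: cstate_eqI\<close>)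
qed (auto intro!: cstate_eqI)

lemma runs_len_code:
  assumes "R d = 0" "R (Suc d) = 0"
  shows "runs x (len_code d) (0, R, ys) (10 * length x + 3) (0, R(d := length x), ys)"
  unfolding len_code_def
proof (rule runs_Seq'[OF _ runs_eq[OF runs_rewind]])
  show "runs x (Until InBlank (Seq InR (Seq (Inc d) (Inc (Suc d))))) (0, R, ys) (6 * length x + 1)
    (int (length x), R(d := length x, Suc d := length x), ys)"
  proof (rule runs_Until'[where n = "length x" and b = 5 and S = "\<lambda>i. (int i, R(d := i, Suc d := i), ys)"])
    fix i assume i: "i < length x"
    show "runs x (Seq InR (Seq (Inc d) (Inc (Suc d)))) (int i, R(d := i, Suc d := i), ys) 5
        (int (Suc i), R(d := Suc i, Suc d := Suc i), ys)"
      by (rule runs_eq[OF runs_Seq'[OF runs_atoms(4) runs_Seq[OF runs_atoms(2) runs_atoms(2)]]])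
        (use i in \<open>auto intro!: cstate_eqI\<close>)
    show "\<not> holds x (int i, R(d := i, Suc d := i), ys) InBlank"
      using i by (simp add: input_tape_def bit_symbol_def)
  qed (use assms in \<open>auto intro!: cstate_eqI simp: input_tape_def\<close>)
qed (use assms in \<open>auto intro!: cstate_eqI\<close>)

lemma runs_bit_code:
  assumes "R (Suc d) = 0"
  shows "runs x (bit_code d) (0, R, ys) (10 * R d + 6) (0, R(d := of_bool (R d < length x \<and> x ! R d)), ys)"
  unfolding bit_code_def
proof (rule runs_Seq'[OF _ runs_Seq[OF runs_Cond runs_eq[OF runs_rewind]]])
  let ?s = "(int (R d), R(d := 0, Suc d := R d), ys)"
  show "runs x (Until (Zero d) (Seq (Dec d) (Seq InR (Inc (Suc d))))) (0, R, ys) (6 * R d + 1) ?s"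
  proof (rule runs_Until'[where n = "R d" and b = 5 and S = "\<lambda>i. (int i, R(d := R d - i, Suc d := i), ys)"])
    fix i assume i: "i < R d"
    show "runs x (Seq (Dec d) (Seq InR (Inc (Suc d)))) (int i, R(d := R d - i, Suc d := i), ys) 5
        (int (Suc i), R(d := R d - Suc i, Suc d := Suc i), ys)"
      by (rule runs_eq[OF runs_Seq'[OF runs_atoms(3) runs_Seq[OF runs_atoms(4) runs_atoms(2)]]])
        (use i in \<open>auto intro!: cstate_eqI\<close>)
  qed (use assms in \<open>auto intro!: cstate_eqI\<close>)
  have "holds x ?s InOne \<longleftrightarrow> R d < length x \<and> x ! R d"
    by (simp add: input_tape_def bit_symbol_def)
  then show "runs x (if holds x ?s InOne then Inc d else Skip) ?s 1
      (int (R d), R(d := of_bool (R d < length x \<and> x ! R d), Suc d := R d), ys)"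
    using runs_atoms(2)[of x d "int (R d)" "R(d := 0, Suc d := R d)" ys] runs_atoms(1)[of x ?s]
    by (auto elim!: runs_eq simp del: holds.simps intro!: ext)
qed (use assms in \<open>auto intro!: cstate_eqI\<close>)

lemma runs_sub_code:
  "runs x (sub_code d) (0, R, ys) (4 * R (Suc d) + 1) (0, R(d := R d - R (Suc d), Suc d := 0), ys)"
  unfolding sub_code_def
proof (rule runs_Until'[where n = "R (Suc d)" and b = 3 and S = "\<lambda>i. (0, R(d := R d - i, Suc d := R (Suc d) - i), ys)"])
  fix i assume i: "i < R (Suc d)"
  show "runs x (Seq (Dec (Suc d)) (Dec d)) (0, R(d := R d - i, Suc d := R (Suc d) - i), ys) 3
      (0, R(d := R d - Suc i, Suc d := R (Suc d) - Suc i), ys)"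
    by (rule runs_eq[OF runs_Seq'[OF runs_atoms(3) runs_atoms(3)]]) (use i in \<open>auto intro!: cstate_eqI\<close>)
qed (auto intro!: cstate_eqI)

lemma runs_mul_code:
  assumes z: "\<And>r. r \<ge> d + 2 \<Longrightarrow> R r = 0"
  shows "runs x (mul_code d) (0, R, ys) (30 * (R d + 1) * (R (Suc d) + 1))
    (0, R(d := R d * R (Suc d), Suc d := 0), ys)"
  unfolding mul_code_def
proof (rule runs_Seq'[OF _ runs_Seq[OF runs_clear runs_eq[OF runs_move]]])
  let ?a = "R d" and ?b = "R (Suc d)"
  let ?S = "\<lambda>i. (0, R(Suc d := ?b - i, d + 2 := ?a * i), ys)"
  show "runs x (Until (Zero (Suc d)) (Seq (Dec (Suc d)) (copy d (d + 2) (d + 3)))) (0, R, ys)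
      (?b * (10 * ?a + 6) + 1) (?S ?b)"
  proof (rule runs_Until'[where n = ?b and b = "10 * ?a + 5" and S = ?S])
    fix i assume i: "i < ?b"
    show "runs x (Seq (Dec (Suc d)) (copy d (d + 2) (d + 3))) (?S i) (10 * ?a + 5) (?S (Suc i))"
      by (rule runs_eq[OF runs_Seq'[OF runs_atoms(3) runs_copy]])
        (use i z in \<open>auto intro!: cstate_eqI\<close>)
  qed (use z in \<open>auto intro!: cstate_eqI\<close>)
qed (use z in \<open>auto intro!: cstate_eqI simp: algebra_simps\<close>)

lemma runs_div_code:
  assumes z: "\<And>r. r \<ge> d + 2 \<Longrightarrow> R r = 0"
  shows "runs x (div_code d) (0, R, ys) (30 * (R d + 1) * (R (Suc d) + 1))
    (0, R(d := if R (Suc d) = 0 then R d else R d div R (Suc d), Suc d := 0), ys)"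
  unfolding div_code_def
proof (rule runs_Seq'[OF runs_copy runs_Seq[OF _ runs_Seq[OF runs_clear runs_Seq[OF runs_clear runs_eq[OF runs_move]]]]])
  let ?a = "R d" and ?b = "R (Suc d)"
  let ?c = "\<lambda>i. if ?b = 0 then 0 else ?b - i mod ?b" and ?q = "\<lambda>i. if ?b = 0 then i else i div ?b"
  let ?S = "\<lambda>i. (0, R(d := ?a - i, d + 2 := ?c i, d + 3 := ?q i), ys)"
  show "runs x (Until (Zero d) (Seq (Dec d) (Seq (Dec (d + 2))
        (Cond (Zero (d + 2)) (Seq (Inc (d + 3)) (copy (d + 1) (d + 2) (d + 4))) Skip))))
      (0, R(d + 2 := R (d + 2) + R (d + 1)), ys)
      (?a * (10 * ?b + 11) + 1) (?S ?a)"
  proof (rule runs_Until'[where n = ?a and b = "10 * ?b + 10" and S = ?S])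
    fix i assume i: "i < ?a"
    let ?R1 = "R(d := ?a - Suc i, d + 2 := ?c i - 1, d + 3 := ?q i)"
    show "runs x (Seq (Dec d) (Seq (Dec (d + 2))
        (Cond (Zero (d + 2)) (Seq (Inc (d + 3)) (copy (d + 1) (d + 2) (d + 4))) Skip))) (?S i) (10 * ?b + 10) (?S (Suc i))"
    proof (rule runs_Seq'[OF runs_atoms(3) runs_Seq[OF runs_eq[OF runs_atoms(3)] runs_Cond]])
      show "runs x (if holds x (0, ?R1, ys) (Zero (d + 2)) then Seq (Inc (d + 3)) (copy (d + 1) (d + 2) (d + 4)) else Skip)
         (0, ?R1, ys) (10 * ?b + 5) (?S (Suc i))"
      proof (cases "?c i - 1 = 0")
        case True
        have *: "?q (Suc i) = Suc (?q i)" "?c (Suc i) = ?b"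
        proof -
          have "Suc (i mod ?b) = ?b" if "?b \<noteq> 0" 
            by (rule le_antisym) (use True that in \<open>auto simp: Suc_le_eq\<close>)
          then show "?q (Suc i) = Suc (?q i)" "?c (Suc i) = ?b" by (auto simp: div_Suc mod_Suc)
        qed
        have "runs x (Seq (Inc (d + 3)) (copy (d + 1) (d + 2) (d + 4))) (0, ?R1, ys) (10 * ?b + 5) (?S (Suc i))"
          by (rule runs_eq[OF runs_Seq'[OF runs_atoms(2) runs_copy]])
            (use z * True in \<open>auto intro!: cstate_eqI\<close>)
        then show ?thesis using True by simp
      next
        case False
        then have "?b \<noteq> 0" "Suc (i mod ?b) \<noteq> ?b" by (auto split: if_splits)
        then have *: "?q (Suc i) = ?q i" "?c (Suc i) = ?c i - 1" by (auto simp: div_Suc mod_Suc)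
        have "runs x Skip (0, ?R1, ys) (10 * ?b + 5) (?S (Suc i))"
          by (rule runs_mono[OF runs_eq[OF runs_atoms(1)]]) (use * \<open>?b \<noteq> 0\<close> in \<open>auto intro!: cstate_eqI\<close>)
        then show ?thesis using False by simp
      qed
    qed (use i in \<open>auto intro!: cstate_eqI\<close>)
  qed (use z in \<open>auto intro!: cstate_eqI\<close>)
qed (use z in \<open>auto intro!: cstate_eqI simp: algebra_simps\<close>,
  use div_le_dividend[of "R d" "R (Suc d)"] in linarith)

lemma poly_nat_mono: "a \<le> b \<Longrightarrow> poly p a \<le> poly p b" for p :: "nat poly"
  by (induction p) (auto intro!: add_mono mult_mono)

text \<open>One polynomial bounds both value and time, in terms of a common bound \<open>B\<close>
  on registers and input length; this is what lets the bounds compose.\<close>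

definition code_bound :: "exp \<Rightarrow> nat poly \<Rightarrow> bool" where
  "code_bound e p \<longleftrightarrow> (\<forall>d x R B ys. vars_below e d \<longrightarrow> (\<forall>r\<ge>d. R r = 0) \<longrightarrow> (\<forall>r. R r \<le> B) \<longrightarrow>
     length x \<le> B \<longrightarrow> eval x e R \<le> poly p B \<and>
     runs x (code d e) (0, R, ys) (poly p B) (0, R(d := eval x e R), ys))"

lemma code_boundD:
  assumes "code_bound e p" "vars_below e d" "\<And>r. r \<ge> d \<Longrightarrow> R r = 0" "\<And>r. R r \<le> B" "length x \<le> B"
  shows "eval x e R \<le> poly p B" "runs x (code d e) (0, R, ys) (poly p B) (0, R(d := eval x e R), ys)"
  using assms unfolding code_bound_def by blast+

text \<open>All four binary operations are handled at once, since their loops obey the same crude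
  bound \<open>30 * (m + 1) * (n + 1)\<close> for operands \<open>m\<close> and
  \<open>n\<close>.\<close>

lemma code_bound_binary:
  assumes a: "code_bound a p" and b: "code_bound b q"
    and vars: "\<And>d. vars_below e d \<Longrightarrow> vars_below a d \<and> vars_below b d"
    and code: "\<And>d. code d e = Seq (code d a) (Seq (code (Suc d) b) (c d))"
    and eval: "\<And>x R. eval x e R = f (eval x a R) (eval x b R)"
    and run: "\<And>x d R ys. (\<And>r. r \<ge> d + 2 \<Longrightarrow> R r = 0) \<Longrightarrow>
      runs x (c d) (0, R, ys) (30 * (R d + 1) * (R (Suc d) + 1)) (0, R(d := f (R d) (R (Suc d)), Suc d := 0), ys)"
    and bound: "\<And>m n. f m n \<le> (m + 1) * (n + 1)"
  shows "\<exists>p. code_bound e p"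
proof
  \<comment> \<open>The second operand is computed while register \<open>d\<close> holds the first
    value, so registers are then bounded by \<open>B + poly p B\<close>; hence the
    composition.\<close>
  let ?r = "p + pcompose q ([:0, 1:] + p) + 30 * (p + 1) * (q + 1) + 2"
  show "code_bound e ?r"
    unfolding code_bound_def
  proof (intro allI impI)
    fix d and x :: "bool list" and R :: "nat \<Rightarrow> nat" and B ys
    assume v: "vars_below e d" and z: "\<forall>r\<ge>d. R r = 0" and B: "\<forall>r. R r \<le> B" and x: "length x \<le> B"
    let ?m = "eval x a R" and ?n = "eval x b R"
    note A = code_boundD[OF a, of d R B x]
    have m: "?m \<le> poly p B" and ra: "runs x (code d a) (0, R, ys) (poly p B) (0, R(d := ?m), ys)"
      using A vars[OF v] z B x by auto
    have n: "?n \<le> poly q B" using code_boundD(1)[OF b, of d R B x] vars[OF v] z B x by auto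
    let ?R = "R(d := ?m)"
    have "runs x (code (Suc d) b) (0, ?R, ys) (poly q (B + poly p B)) (0, ?R(Suc d := eval x b ?R), ys)"
    proof (rule code_boundD(2)[OF b])
      show "vars_below b (Suc d)" using vars[OF v] vars_below_mono by auto
      show "?R r \<le> B + poly p B" for r using B m by (auto intro: trans_le_add1 trans_le_add2)
    qed (use z x in auto)
    moreover have "eval x b ?R = ?n" using eval_upd vars[OF v] by blast
    ultimately have rb: "runs x (code (Suc d) b) (0, ?R, ys) (poly q (B + poly p B)) (0, ?R(Suc d := ?n), ys)"
      by simp
    let ?R2 = "?R(Suc d := ?n)"
    have rc: "runs x (c d) (0, ?R2, ys) (30 * (?m + 1) * (?n + 1)) (0, R(d := eval x e R), ys)"
      by (rule runs_eq[OF runs_mono[OF run]]) (use z in \<open>auto intro!: cstate_eqI simp: eval\<close>)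
    have le: "(?m + 1) * (?n + 1) \<le> (poly p B + 1) * (poly q B + 1)"
      using m n by (intro mult_mono) auto
    have pr: "poly ?r B = poly p B + poly q (B + poly p B) + 30 * ((poly p B + 1) * (poly q B + 1)) + 2"
      by (simp add: poly_pcompose algebra_simps)
    have "runs x (code d e) (0, R, ys) (poly ?r B) (0, R(d := eval x e R), ys)"
      unfolding code
    proof (rule runs_Seq'[OF ra runs_Seq[OF rb rc]])
      show "poly p B + (poly q (B + poly p B) + 30 * (?m + 1) * (?n + 1) + 1) + 1 \<le> poly ?r B"
        unfolding pr using le mult.assoc[of 30 "?m + 1" "?n + 1"] by linarith
    qed
    moreover have "eval x e R \<le> poly ?r B"
      unfolding pr eval using bound[of ?m ?n] le by linarith
    ultimately show "eval x e R \<le> poly ?r B \<and>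
        runs x (code d e) (0, R, ys) (poly ?r B) (0, R(d := eval x e R), ys)" by blast
  qed
qed

lemma ex_code_bound: "\<exists>p. code_bound e p"
proof (induction e)
  case (Const n)
  have "code_bound (Const n) [:2 * n + 1:]"
    unfolding code_bound_def 
  proof (intro allI impI)
    fix d x ys B and R :: "nat \<Rightarrow> nat" assume "\<forall>r\<ge>d. R r = 0"
    then show "eval x (Const n) R \<le> poly [:2 * n + 1:] B \<and>
        runs x (code d (Const n)) (0, R, ys) (poly [:2 * n + 1:] B) (0, R(d := eval x (Const n) R), ys)"
      using runs_incs[of x d n 0 R ys] by simp
  qed
  then show ?case by blast
next
  case (Var i)
  have "code_bound (Var i) [:3, 10:]"
    unfolding code_bound_def
  proof (intro allI impI)
    fix d and x :: "bool list" and R :: "nat \<Rightarrow> nat" and B ys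
    assume v: "vars_below (Var i) d" and z: "\<forall>r\<ge>d. R r = 0" and B: "\<forall>r. R r \<le> B"
    have "R i \<le> B" using B by blast
    moreover have "runs x (copy i d (Suc d)) (0, R, ys) (10 * R i + 3) (0, R(d := R i), ys)"
      by (rule runs_eq[OF runs_copy]) (use v z in auto)
    ultimately show "eval x (Var i) R \<le> poly [:3, 10:] B \<and>
        runs x (code d (Var i)) (0, R, ys) (poly [:3, 10:] B) (0, R(d := eval x (Var i) R), ys)"
      by (auto intro: runs_mono)
  qed
  then show ?case by blast
next
  case Len
  have "code_bound Len [:3, 10:]"
    unfolding code_bound_def using runs_mono[OF runs_len_code] by auto
  then show ?case by blast
next
  case (InBit e)
  then obtain p where p: "code_bound e p" by blast
  have "code_bound (InBit e) (11 * p + 7)"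
    unfolding code_bound_def
  proof (intro allI impI)
    fix d and x :: "bool list" and R :: "nat \<Rightarrow> nat" and B ys
    assume v: "vars_below (InBit e) d" and z: "\<forall>r\<ge>d. R r = 0" and B: "\<forall>r. R r \<le> B" and x: "length x \<le> B"
    have e: "eval x e R \<le> poly p B" "runs x (code d e) (0, R, ys) (poly p B) (0, R(d := eval x e R), ys)"
      using code_boundD[OF p, of d R B x] v z B x by auto
    have "runs x (code d (InBit e)) (0, R, ys) (11 * poly p B + 7) (0, R(d := eval x (InBit e) R), ys)"
      unfolding code.simps
      by (rule runs_Seq'[OF e(2) runs_eq[OF runs_bit_code]]) (use z e(1) in auto)
    then show "eval x (InBit e) R \<le> poly (11 * p + 7) B \<and>
        runs x (code d (InBit e)) (0, R, ys) (poly (11 * p + 7) B) (0, R(d := eval x (InBit e) R), ys)"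
      by simp
  qed
  then show ?case by blast
next
  case (Add a b)
  then obtain p q where pq: "code_bound a p" "code_bound b q" by blast
  show ?case
  proof (rule code_bound_binary[OF pq, where c = "\<lambda>d. move (Suc d) d" and f = "(+)"])
    fix x d ys and R :: "nat \<Rightarrow> nat"
    show "runs x (move (Suc d) d) (0, R, ys) (30 * (R d + 1) * (R (Suc d) + 1)) (0, R(d := R d + R (Suc d), Suc d := 0), ys)"
      by (rule runs_eq[OF runs_mono[OF runs_move]]) (auto intro!: cstate_eqI simp: algebra_simps)
  qed auto
next
  case (Sub a b)
  then obtain p q where pq: "code_bound a p" "code_bound b q" by blast
  show ?case
  proof (rule code_bound_binary[OF pq, where c = sub_code and f = "(-)"])
    fix x d ys and R :: "nat \<Rightarrow> nat"
    show "runs x (sub_code d) (0, R, ys) (30 * (R d + 1) * (R (Suc d) + 1)) (0, R(d := R d - R (Suc d), Suc d := 0), ys)"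
      by (rule runs_mono[OF runs_sub_code]) (simp add: algebra_simps)
  qed auto
next
  case (Mul a b)
  then obtain p q where pq: "code_bound a p" "code_bound b q" by blast
  show ?case
    by (rule code_bound_binary[OF pq _ _ _ runs_mul_code]) auto
next
  case (Div a b)
  then obtain p q where pq: "code_bound a p" "code_bound b q" by blast
  show ?case
  proof (rule code_bound_binary[OF pq _ _ _ runs_div_code])
    fix m n :: nat
    show "(if n = 0 then m else m div n) \<le> (m + 1) * (n + 1)"
      by (rule le_trans[of _ m]) auto
  qed auto
qed

section \<open>Programs that print words\<close>

datatype pgm = Put exp | PutNat exp | For exp pgm | Then pgm pgm

primrec pgm_vars_below :: "pgm \<Rightarrow> nat \<Rightarrow> bool" where
  "pgm_vars_below (Put e) d = vars_below e d"
| "pgm_vars_below (PutNat e) d = vars_below e d"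
| "pgm_vars_below (For e b) d = (vars_below e d \<and> pgm_vars_below b (d + 2))"
| "pgm_vars_below (Then a b) d = (pgm_vars_below a d \<and> pgm_vars_below b d)"

text \<open>In a loop at depth \<open>d\<close>, register \<open>d\<close> counts down and register \<open>d + 1\<close> is the loop variable.\<close>

primrec printed :: "bool list \<Rightarrow> pgm \<Rightarrow> nat \<Rightarrow> (nat \<Rightarrow> nat) \<Rightarrow> bool list" where
  "printed x (Put e) d R = [eval x e R \<noteq> 0]"
| "printed x (PutNat e) d R = encode_nat (eval x e R)"
| "printed x (For e b) d R = (let n = eval x e R in
     concat (map (\<lambda>i. printed x b (d + 2) (R(d := n - Suc i, Suc d := i))) [0..<n]))"
| "printed x (Then a b) d R = printed x a d R @ printed x b d R"

definition put_code :: "nat \<Rightarrow> exp \<Rightarrow> com" where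
  "put_code d e = Seq (code d e) (Seq (Cond (Zero d) (Emit False) (Emit True)) (clear d))"

text \<open>One digit in the format of \<open>encode_nat\<close>: the continuation bit
  \<open>True\<close>, the parity as \<open>n - 2 * (n div 2)\<close>, then halving.\<close>

definition digit_code :: "nat \<Rightarrow> com" where
  "digit_code d = Seq (Emit True) (Seq (put_code (Suc d) (Sub (Var d) (Mul (Const 2) (Div (Var d) (Const 2)))))
     (Seq (code (Suc d) (Div (Var d) (Const 2))) (Seq (clear d) (move (Suc d) d))))"

primrec pgm_code :: "nat \<Rightarrow> pgm \<Rightarrow> com" where
  "pgm_code d (Put e) = put_code d e"
| "pgm_code d (PutNat e) = Seq (code d e) (Seq (Until (Zero d) (digit_code d)) (Emit False))"
| "pgm_code d (For e b) = Seq (code d e) (Seq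
     (Until (Zero d) (Seq (Dec d) (Seq (pgm_code (d + 2) b) (Inc (Suc d))))) (clear (Suc d)))"
| "pgm_code d (Then a b) = Seq (pgm_code d a) (pgm_code d b)"

lemma runs_put_code:
  assumes "code_bound e p" "vars_below e d" "\<And>r. r \<ge> d \<Longrightarrow> R r = 0" "\<And>r. R r \<le> B" "length x \<le> B"
  shows "runs x (put_code d e) (0, R, ys) (3 * poly p B + 5) (0, R, ys @ [eval x e R \<noteq> 0])"
  unfolding put_code_def
proof (rule runs_Seq'[OF code_boundD(2)[OF assms] runs_Seq[OF runs_Cond runs_eq[OF runs_clear]]])
  let ?s = "(0, R(d := eval x e R), ys)"
  show "runs x (if holds x ?s (Zero d) then Emit False else Emit True) ?s 1
      (0, R(d := eval x e R), ys @ [eval x e R \<noteq> 0])"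
    using runs_atoms(6) by auto
qed (use code_boundD(1)[OF assms] assms(3) in \<open>auto intro!: cstate_eqI\<close>)

lemma ex_digit_bound:
  "\<exists>p. \<forall>x R B ys. (\<forall>r>d. R r = 0) \<longrightarrow> (\<forall>r. R r \<le> B) \<longrightarrow> length x \<le> B \<longrightarrow>
     runs x (digit_code d) (0, R, ys) (poly p B) (0, R(d := R d div 2), ys @ [True, odd (R d)])"
proof -
  let ?e = "Sub (Var d) (Mul (Const 2) (Div (Var d) (Const 2)))" and ?f = "Div (Var d) (Const 2)"
  obtain p where p: "code_bound ?e p" using ex_code_bound by blast
  obtain q where q: "code_bound ?f q" using ex_code_bound by blast
  show ?thesis
  proof (intro exI allI impI)
    fix x :: "bool list" and R :: "nat \<Rightarrow> nat" and B ys
    assume z: "\<forall>r>d. R r = 0" and B: "\<forall>r. R r \<le> B" and x: "length x \<le> B"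
    have "(R d - 2 * (R d div 2) \<noteq> 0) = odd (R d)" by presburger
    then have e: "(eval x ?e R \<noteq> 0) = odd (R d)" by simp
    have rp: "runs x (put_code (Suc d) ?e) (0, R, ys @ [True]) (3 * poly p B + 5) (0, R, (ys @ [True]) @ [odd (R d)])"
      unfolding e[symmetric] by (rule runs_put_code[OF p]) (use z B x in auto)
    have rq: "runs x (code (Suc d) ?f) (0, R, (ys @ [True]) @ [odd (R d)]) (poly q B)
        (0, R(Suc d := eval x ?f R), (ys @ [True]) @ [odd (R d)])"
      by (rule code_boundD(2)[OF q]) (use z B x in auto)
    have "R d \<le> B" using B by blast
    then have "R d div 2 \<le> B" using div_le_dividend le_trans by blast
    show "runs x (digit_code d) (0, R, ys) (poly (3 * p + q + [:12, 6:]) B)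
       (0, R(d := R d div 2), ys @ [True, odd (R d)])"
      unfolding digit_code_def
      by (rule runs_Seq'[OF runs_atoms(6) runs_Seq[OF rp runs_Seq[OF rq runs_Seq[OF runs_clear runs_eq[OF runs_move]]]]])
        (use z \<open>R d \<le> B\<close> \<open>R d div 2 \<le> B\<close> in \<open>auto intro!: cstate_eqI\<close>)
  qed
qed

text \<open>The number of rounds is bounded by the value itself instead of its logarithm, which
  suffices because all values are polynomially bounded.\<close>

lemma runs_digits:
  assumes p: "\<And>R ys. (\<And>r. r > d \<Longrightarrow> R r = 0) \<Longrightarrow> (\<And>r. R r \<le> B) \<Longrightarrow>
     runs x (digit_code d) (0, R, ys) t (0, R(d := R d div 2), ys @ [True, odd (R d)])"
    and z: "\<And>r. r > d \<Longrightarrow> R r = 0" and B: "\<And>r. R r \<le> B"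
  shows "runs x (Until (Zero d) (digit_code d)) (0, R, ys) (R d * (t + 1) + 1)
     (0, R(d := 0), ys @ concat (map (\<lambda>b. [True, b]) (binary (R d))))"
  using z B
proof (induction "R d" arbitrary: R ys rule: less_induct)
  case less
  show ?case
  proof (cases "R d = 0")
    case True
    then have "R(d := 0) = R" by auto
    then show ?thesis using True runs_Until_end[of x "(0, R, ys)" "Zero d"]
      by (simp add: binary.simps[of 0])
  next
    case False
    let ?R = "R(d := R d div 2)"
    have bin: "binary (R d) = odd (R d) # binary (R d div 2)" using False by (simp add: binary.simps[of "R d"])
    have "?R r \<le> B" for r using less.prems(2)[of r] less.prems(2)[of d] by auto
    then have "runs x (Until (Zero d) (digit_code d)) (0, ?R, ys @ [True, odd (R d)]) (?R d * (t + 1) + 1)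
       (0, ?R(d := 0), (ys @ [True, odd (R d)]) @ concat (map (\<lambda>b. [True, b]) (binary (?R d))))"
      by (intro less.hyps) (use False less.prems(1) in auto)
    then have "runs x (Until (Zero d) (digit_code d)) (0, R, ys) (t + (?R d * (t + 1) + 1) + 1)
       (0, ?R(d := 0), (ys @ [True, odd (R d)]) @ concat (map (\<lambda>b. [True, b]) (binary (?R d))))"
      using False by (intro runs_Until_step[OF _ p]) (use less.prems in auto)
    moreover have "t + (?R d * (t + 1) + 1) + 1 \<le> R d * (t + 1) + 1"
    proof -
      have "Suc (R d div 2) \<le> R d" using False by linarith
      then have "Suc (R d div 2) * (t + 1) \<le> R d * (t + 1)" by (rule mult_le_mono1)
      then show ?thesis by simp
    qed
    ultimately show ?thesis using runs_mono by (simp add: bin)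
  qed
qed

definition pgm_bound :: "nat \<Rightarrow> pgm \<Rightarrow> nat poly \<Rightarrow> bool" where
  "pgm_bound d P p \<longleftrightarrow> (\<forall>x R B ys. pgm_vars_below P d \<longrightarrow> (\<forall>r\<ge>d. R r = 0) \<longrightarrow> (\<forall>r. R r \<le> B) \<longrightarrow>
     length x \<le> B \<longrightarrow> runs x (pgm_code d P) (0, R, ys) (poly p B) (0, R, ys @ printed x P d R))"

lemma pgm_boundD:
  assumes "pgm_bound d P p" "pgm_vars_below P d" "\<And>r. r \<ge> d \<Longrightarrow> R r = 0" "\<And>r. R r \<le> B" "length x \<le> B"
  shows "runs x (pgm_code d P) (0, R, ys) (poly p B) (0, R, ys @ printed x P d R)"
  using assms unfolding pgm_bound_def by blast

text \<open>Loop counts are values of expressions and hence polynomial in \<open>B\<close>; the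
  nesting depth is fixed by the program.\<close>

lemma ex_pgm_bound: "\<exists>p. pgm_bound d P p"
proof (induction P arbitrary: d)
  case (Put e)
  obtain p where p: "code_bound e p" using ex_code_bound by blast
  have "pgm_bound d (Put e) (3 * p + 5)"
    unfolding pgm_bound_def using runs_put_code[OF p] by auto
  then show ?case by blast
next
  case (PutNat e)
  obtain p where p: "code_bound e p" using ex_code_bound by blast
  obtain q where q: "\<And>x R B ys. (\<forall>r>d. R r = 0) \<Longrightarrow> (\<forall>r. R r \<le> B) \<Longrightarrow> length x \<le> B \<Longrightarrow>
     runs x (digit_code d) (0, R, ys) (poly q B) (0, R(d := R d div 2), ys @ [True, odd (R d)])"
    using ex_digit_bound by blast
  let ?q = "pcompose q ([:0, 1:] + p)"
  have "pgm_bound d (PutNat e) (p + p * (?q + 1) + 4)"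
    unfolding pgm_bound_def
  proof (intro allI impI)
    fix x :: "bool list" and R :: "nat \<Rightarrow> nat" and B ys
    assume v: "pgm_vars_below (PutNat e) d" and z: "\<forall>r\<ge>d. R r = 0" and B: "\<forall>r. R r \<le> B" and x: "length x \<le> B"
    let ?n = "eval x e R" and ?t = "poly q (B + poly p B)"
    have n: "?n \<le> poly p B" and r: "runs x (code d e) (0, R, ys) (poly p B) (0, R(d := ?n), ys)"
      using code_boundD[OF p, of d R B x] v z B x by auto
    have "runs x (Until (Zero d) (digit_code d)) (0, R(d := ?n), ys) ((R(d := ?n)) d * (?t + 1) + 1)
      (0, (R(d := ?n))(d := 0), ys @ concat (map (\<lambda>b. [True, b]) (binary ((R(d := ?n)) d))))"
    proof (rule runs_digits)
      show "(R(d := ?n)) r \<le> B + poly p B" for r using B n by (auto intro: trans_le_add1 trans_le_add2)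
    qed (use q x z in auto)
    then have l: "runs x (Until (Zero d) (digit_code d)) (0, R(d := ?n), ys) (poly p B * (?t + 1) + 1)
      (0, R(d := 0), ys @ concat (map (\<lambda>b. [True, b]) (binary ?n)))"
      using n by (elim runs_mono[OF runs_eq]) (auto intro!: add_mono mult_le_mono1)
    show "runs x (pgm_code d (PutNat e)) (0, R, ys) (poly (p + p * (?q + 1) + 4) B) (0, R, ys @ printed x (PutNat e) d R)"
      unfolding pgm_code.simps
      by (rule runs_eq[OF runs_Seq'[OF r runs_Seq[OF l runs_atoms(6)]]])
        (use z in \<open>auto intro!: cstate_eqI simp: encode_nat_def pair_words_def poly_pcompose\<close>)
  qed
  then show ?case by blast
next
  case (For e b)
  obtain p where p: "code_bound e p" using ex_code_bound by blast
  obtain q where q: "pgm_bound (d + 2) b q" using For by blast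
  let ?q = "pcompose q ([:0, 1:] + p)"
  have "pgm_bound d (For e b) (p + p * (?q + 5) + 2 * p + 4)"
    unfolding pgm_bound_def
  proof (intro allI impI)
    fix x :: "bool list" and R :: "nat \<Rightarrow> nat" and B ys
    assume v: "pgm_vars_below (For e b) d" and z: "\<forall>r\<ge>d. R r = 0" and B: "\<forall>r. R r \<le> B" and x: "length x \<le> B"
    let ?n = "eval x e R" and ?t = "poly q (B + poly p B)"
    let ?o = "\<lambda>i. printed x b (d + 2) (R(d := ?n - Suc i, Suc d := i))"
    let ?S = "\<lambda>i. (0, R(d := ?n - i, Suc d := i), ys @ concat (map ?o [0..<i]))"
    have n: "?n \<le> poly p B" and r: "runs x (code d e) (0, R, ys) (poly p B) (0, R(d := ?n), ys)"
      using code_boundD[OF p, of d R B x] v z B x by auto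
    have l: "runs x (Until (Zero d) (Seq (Dec d) (Seq (pgm_code (d + 2) b) (Inc (Suc d)))))
        (0, R(d := ?n), ys) (poly p B * (?t + 5) + 1) (?S ?n)"
    proof (rule runs_Until'[where n = ?n and b = "?t + 4" and S = ?S])
      show "?n * (?t + 4 + 1) + 1 \<le> poly p B * (?t + 5) + 1"
        using mult_le_mono1[OF n, of "?t + 5"] by (simp add: algebra_simps)
      fix i assume i: "i < ?n"
      let ?R = "R(d := ?n - Suc i, Suc d := i)"
      let ?ys = "ys @ concat (map ?o [0..<i])"
      have "?R r \<le> B + poly p B" for r using B n i by (auto intro: trans_le_add1 trans_le_add2)
      then have rb: "runs x (pgm_code (d + 2) b) (0, ?R, ?ys) ?t (0, ?R, ?ys @ ?o i)"
        by (intro pgm_boundD[OF q]) (use v z x in auto)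
      have rd: "runs x (Dec d) (?S i) 1 (0, ?R, ?ys)"
        by (rule runs_eq[OF runs_atoms(3)]) (auto intro!: cstate_eqI)
      show "runs x (Seq (Dec d) (Seq (pgm_code (d + 2) b) (Inc (Suc d)))) (?S i) (?t + 4) (?S (Suc i))"
        by (rule runs_eq[OF runs_Seq'[OF rd runs_Seq[OF rb runs_atoms(2)]]]) (auto intro!: cstate_eqI)
    qed (use z in \<open>auto intro!: cstate_eqI\<close>)
    show "runs x (pgm_code d (For e b)) (0, R, ys) (poly (p + p * (?q + 5) + 2 * p + 4) B) (0, R, ys @ printed x (For e b) d R)"
      unfolding pgm_code.simps
      by (rule runs_eq[OF runs_Seq'[OF r runs_Seq[OF l runs_clear]]])
        (use z n in \<open>auto intro!: cstate_eqI simp: poly_pcompose Let_def\<close>)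
  qed
  then show ?case by blast
next
  case (Then a b)
  then obtain p q where p: "pgm_bound d a p" and q: "pgm_bound d b q" by blast
  have "pgm_bound d (Then a b) (p + q + 1)"
    unfolding pgm_bound_def
  proof (intro allI impI)
    fix x :: "bool list" and R :: "nat \<Rightarrow> nat" and B ys
    assume v: "pgm_vars_below (Then a b) d" and *: "\<forall>r\<ge>d. R r = 0" "\<forall>r. R r \<le> B" "length x \<le> B"
    have "runs x (pgm_code d a) (0, R, ys) (poly p B) (0, R, ys @ printed x a d R)"
      "runs x (pgm_code d b) (0, R, ys @ printed x a d R) (poly q B) (0, R, (ys @ printed x a d R) @ printed x b d R)"
      by (rule pgm_boundD[OF p] pgm_boundD[OF q]; use v * in simp)+
    from runs_Seq[OF this] show "runs x (pgm_code d (Then a b)) (0, R, ys) (poly (p + q + 1) B) (0, R, ys @ printed x (Then a b) d R)"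
      by simp
  qed
  then show ?case by blast
qed

theorem poly_time_computable_output:
  assumes "pgm_vars_below P 0"
  shows "poly_time_computable (\<lambda>x. printed x P 0 (\<lambda>_. 0))"
proof -
  obtain p where p: "pgm_bound 0 P p" using ex_pgm_bound by blast
  show ?thesis
  proof (rule poly_time_computable_com)
    fix x
    have "runs x (pgm_code 0 P) (0, \<lambda>_. 0, []) (poly p (length x)) (0, \<lambda>_. 0, [] @ printed x P 0 (\<lambda>_. 0))"
      by (rule pgm_boundD[OF p assms]) simp_all
    then obtain k where "k \<le> poly p (length x)"
      "\<And>K. (cstep x ^^ k) (pgm_code 0 P # K, (0, \<lambda>_. 0, [])) = (K, (0, \<lambda>_. 0, [] @ printed x P 0 (\<lambda>_. 0)))"
      by (rule runsD) blast
    then show "\<exists>n s. n \<le> poly p (length x) \<and>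
        (cstep x ^^ n) ([pgm_code 0 P], (0, \<lambda>_. 0, [])) = ([], s) \<and> snd (snd s) = printed x P 0 (\<lambda>_. 0)"
      by (intro exI[of _ k] exI[of _ "(0, \<lambda>_. 0, [] @ printed x P 0 (\<lambda>_. 0))"]) simp
  qed
qed

section \<open>Closure properties of functions given by expressions\<close>

definition definable :: "nat \<Rightarrow> (bool list \<Rightarrow> (nat \<Rightarrow> nat) \<Rightarrow> nat) \<Rightarrow> bool" where
  "definable d g \<longleftrightarrow> (\<exists>e. vars_below e d \<and> (\<forall>x R. eval x e R = g x R))"

definition decidable :: "nat \<Rightarrow> (bool list \<Rightarrow> (nat \<Rightarrow> nat) \<Rightarrow> bool) \<Rightarrow> bool" where
  "decidable d P \<longleftrightarrow> definable d (\<lambda>x R. of_bool (P x R))"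

lemma definable_const: "definable d (\<lambda>x R. n)"
  unfolding definable_def by (intro exI[of _ "Const n"]) simp

lemma definable_var: "i < d \<Longrightarrow> definable d (\<lambda>x R. R i)"
  unfolding definable_def by (intro exI[of _ "Var i"]) simp

lemma definable_length: "definable d (\<lambda>x R. length x)"
  unfolding definable_def by (intro exI[of _ Len]) simp

lemma definable_add:
  assumes "definable d f" "definable d g"
  shows "definable d (\<lambda>x R. f x R + g x R)"
proof -
  obtain a b where "vars_below a d" "\<forall>x R. eval x a R = f x R" "vars_below b d" "\<forall>x R. eval x b R = g x R"
    using assms unfolding definable_def by blast
  then show ?thesis unfolding definable_def by (intro exI[of _ "Add a b"]) simp
qed

lemma definable_diff:
  assumes "definable d f" "definable d g"
  shows "definable d (\<lambda>x R. f x R - g x R)"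
proof -
  obtain a b where "vars_below a d" "\<forall>x R. eval x a R = f x R" "vars_below b d" "\<forall>x R. eval x b R = g x R"
    using assms unfolding definable_def by blast
  then show ?thesis unfolding definable_def by (intro exI[of _ "Sub a b"]) simp
qed

lemma definable_mult:
  assumes "definable d f" "definable d g"
  shows "definable d (\<lambda>x R. f x R * g x R)"
proof -
  obtain a b where "vars_below a d" "\<forall>x R. eval x a R = f x R" "vars_below b d" "\<forall>x R. eval x b R = g x R"
    using assms unfolding definable_def by blast
  then show ?thesis unfolding definable_def by (intro exI[of _ "Mul a b"]) simp
qed

lemma definable_Suc: "definable d f \<Longrightarrow> definable d (\<lambda>x R. Suc (f x R))"
  using definable_add[OF _ definable_const, of d f 1] by simp

text \<open>The divisor has the form \<open>Suc\<close>, so the convention of \<open>eval\<close>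
  for division by 0 never matters.\<close>

lemma definable_div:
  assumes "definable d f" "definable d g"
  shows "definable d (\<lambda>x R. f x R div Suc (g x R))"
proof -
  from assms(1) definable_Suc[OF assms(2)] obtain a b where
    "vars_below a d" "\<forall>x R. eval x a R = f x R" "vars_below b d" "\<forall>x R. eval x b R = Suc (g x R)"
    unfolding definable_def by blast
  then show ?thesis unfolding definable_def by (intro exI[of _ "Div a b"]) simp
qed

lemma definable_mod:
  assumes "definable d f" "definable d g"
  shows "definable d (\<lambda>x R. f x R mod Suc (g x R))"
  unfolding minus_mult_div_eq_mod[symmetric]
  by (intro definable_diff definable_mult definable_Suc definable_div assms)

lemma definable_poly:
  "definable d f \<Longrightarrow> definable d (\<lambda>x R. poly p (f x R))" for p :: "nat poly"
  by (induction p) (auto intro: definable_const definable_add definable_mult)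

lemma decidable_input_bit:
  assumes "definable d f"
  shows "decidable d (\<lambda>x R. f x R < length x \<and> x ! f x R)"
proof -
  obtain e where "vars_below e d" "\<forall>x R. eval x e R = f x R" using assms unfolding definable_def by blast
  then show ?thesis unfolding decidable_def definable_def by (intro exI[of _ "InBit e"]) simp
qed

lemma decidable_not: "decidable d P \<Longrightarrow> decidable d (\<lambda>x R. \<not> P x R)"
proof -
  have "of_bool (\<not> P x R) = 1 - (of_bool (P x R) :: nat)" for x R by simp
  then show "decidable d P \<Longrightarrow> decidable d (\<lambda>x R. \<not> P x R)"
    unfolding decidable_def by (simp only:) (intro definable_diff definable_const)
qed

lemma decidable_conj: "decidable d P \<Longrightarrow> decidable d Q \<Longrightarrow> decidable d (\<lambda>x R. P x R \<and> Q x R)"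
  using definable_mult[of d "\<lambda>x R. of_bool (P x R)" "\<lambda>x R. of_bool (Q x R)"]
  by (simp add: decidable_def of_bool_conj)

lemma decidable_disj: "decidable d P \<Longrightarrow> decidable d Q \<Longrightarrow> decidable d (\<lambda>x R. P x R \<or> Q x R)"
  using decidable_not[OF decidable_conj[OF decidable_not decidable_not], of d P Q] by simp

lemma decidable_less:
  assumes "definable d f" "definable d g"
  shows "decidable d (\<lambda>x R. f x R < g x R)"
proof -
  \<comment> \<open>Truncated subtraction from 1, applied twice, maps every positive difference to
    1.\<close>
  have "of_bool (f x R < g x R) = 1 - (1 - (g x R - f x R))" for x R by simp
  then show ?thesis unfolding decidable_def
    by (simp only:) (intro definable_diff definable_const assms)
qed

lemma decidable_eq:
  assumes "definable d f" "definable d g"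
  shows "decidable d (\<lambda>x R. f x R = g x R)"
proof -
  have "(f x R = g x R) = (\<not> f x R < g x R \<and> \<not> g x R < f x R)" for x R by auto
  then show ?thesis by (simp only:) (intro decidable_conj decidable_not decidable_less assms)
qed

lemma decidable_const: "decidable d (\<lambda>x R. b)"
  unfolding decidable_def by (rule definable_const)

text \<open>The list does not depend on the input, so the quantifier is a finite
  disjunction.\<close>

lemma decidable_Bex_list:
  "(\<And>a. a \<in> set as \<Longrightarrow> decidable d (P a)) \<Longrightarrow> decidable d (\<lambda>x R. \<exists>a\<in>set as. P a x R)"
  by (induction as) (auto intro: decidable_const decidable_disj)

lemma definable_div_const: "definable d f \<Longrightarrow> 0 < n \<Longrightarrow> definable d (\<lambda>x R. f x R div n)"
  using definable_div[OF _ definable_const, of d f "n - 1"] by simp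

lemma definable_mod_const: "definable d f \<Longrightarrow> 0 < n \<Longrightarrow> definable d (\<lambda>x R. f x R mod n)"
  using definable_mod[OF _ definable_const, of d f "n - 1"] by simp

lemmas definable_intros = definable_const definable_var definable_length definable_add definable_diff
  definable_mult definable_Suc definable_div definable_mod definable_poly
  definable_div_const definable_mod_const

lemmas decidable_intros = decidable_not decidable_conj decidable_disj decidable_less decidable_eq decidable_const

section \<open>The tableau of a verifier\<close>

text \<open>\<open>KRead j c\<close> says that tape \<open>j\<close> scans \<open>c\<close> and
  forgets where. A transition can thus depend on all scanned symbols without naming a position for
  each tape.\<close>

datatype kind = KState nat | KHead nat | KCell nat nat | KRead nat nat

instance kind :: countable
  by countable_datatype

type_synonym fact = "kind \<times> nat \<times> nat"
type_synonym param = "bool list \<Rightarrow> nat \<Rightarrow> nat \<Rightarrow> nat \<Rightarrow> nat"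
type_synonym literal = "kind \<times> param \<times> param"
type_synonym rule = "(bool list \<Rightarrow> nat \<Rightarrow> nat \<Rightarrow> nat \<Rightarrow> bool) \<times> literal list \<times> literal list"

text \<open>
  A fact is a kind with a time and a tape position (the position is 0 if it has no meaning). The literals
  of a rule are facts depending on parameters: the input, a time \<open>t\<close> and two positions \<open>a\<close>, \<open>b\<close>.
\<close>

definition inst :: "bool list \<Rightarrow> nat \<Rightarrow> nat \<Rightarrow> nat \<Rightarrow> literal \<Rightarrow> fact" where
  "inst x t a b l = (case l of (k, f, g) \<Rightarrow> (k, f x t a b, g x t a b))"

definition rule_sat :: "bool list \<Rightarrow> (fact \<Rightarrow> bool) \<Rightarrow> nat \<Rightarrow> nat \<Rightarrow> nat \<Rightarrow> rule \<Rightarrow> bool" where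
  "rule_sat x \<phi> t a b r = (case r of (G, ns, ps) \<Rightarrow> G x t a b \<longrightarrow>
     (\<exists>l\<in>set ns. \<not> \<phi> (inst x t a b l)) \<or> (\<exists>l\<in>set ps. \<phi> (inst x t a b l)))"

lemma length_pair_words: "length (pair_words x u) = 2 * length x + 1 + length u"
  by (induction x) (auto simp: pair_words_def)

lemma nth_pair_words:
  "i < 2 * length x \<Longrightarrow> pair_words x u ! i = (even i \<or> x ! (i div 2))"
  "pair_words x u ! (2 * length x) = False"
  "pair_words x u ! (2 * length x + 1 + i) = u ! i"
proof (induction x arbitrary: i)
  case (Cons c x)
  have e: "pair_words (c # x) u = True # c # pair_words x u" by (simp add: pair_words_def)
  {
    case 1
    show ?case
    proof (cases "i < 2")
      case True
      then show ?thesis by (cases "i = 0") (auto simp: e less_2_cases_iff)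
    next
      case False
      then obtain j where "i = Suc (Suc j)" by (metis add_2_eq_Suc less_eqE not_less)
      then show ?thesis using Cons.IH(1)[of j] 1 by (simp add: e)
    qed
  next
    case 2
    show ?case using Cons.IH(2) by (simp add: e)
  next
    case 3
    show ?case using Cons.IH(3)[of i] by (simp add: e)
  }
qed (auto simp: pair_words_def)

section \<open>Runs of the verifier\<close>

locale verifier =
  fixes M :: tm and q p :: "nat poly" and L :: language
  assumes wf: "wf_tm M" and computes: "tm_computes_in_time M (\<lambda>x. [x \<in> L]) (poly q)"
begin

abbreviation "k \<equiv> num_tapes M"
abbreviation "g \<equiv> num_symbols M"
abbreviation "s \<equiv> num_states M"

text \<open>The halting state is continued by the identity, so that the tableau can run up to one
  fixed time.\<close>

definition tr :: "nat \<Rightarrow> nat list \<Rightarrow> nat \<times> (nat \<times> direction) list" where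
  "tr st rs = (if st < s then trans M st rs else (st, map (\<lambda>c. (c, Stay)) rs))"

definition valid :: "nat \<Rightarrow> nat list \<Rightarrow> bool" where
  "valid st rs \<longleftrightarrow> st \<le> s \<and> length rs = k \<and> set rs \<subseteq> {..<g}"

lemma k_pos: "k \<ge> 1" and g_ge: "g \<ge> 3"
  using wf by (auto simp: wf_tm_def)

lemma tr_valid:
  assumes "valid st rs" "tr st rs = (st', as)"
  shows "st' \<le> s" "length as = k" "fst ` set as \<subseteq> {..<g}"
proof -
  have "st' \<le> s \<and> length as = k \<and> fst ` set as \<subseteq> {..<g}"
  proof (cases "st < s")
    case True
    then have "case trans M st rs of (q', as) \<Rightarrow> q' \<le> s \<and> length as = k \<and> fst ` set as \<subseteq> {..<g}"
      using wf assms(1) unfolding wf_tm_def valid_def by simp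
    then show ?thesis using assms(2) True by (simp add: tr_def)
  next
    case False
    then have "st' = st" "as = map (\<lambda>c. (c, Stay)) rs" using assms(2) by (auto simp: tr_def)
    then show ?thesis using assms(1) by (auto simp: valid_def)
  qed
  then show "st' \<le> s" "length as = k" "fst ` set as \<subseteq> {..<g}" by auto
qed

definition conf :: "bool list \<Rightarrow> nat \<Rightarrow> tm_config" where
  "conf y t = (tm_step M ^^ t) (tm_init M y)"

definition state :: "bool list \<Rightarrow> nat \<Rightarrow> nat" where
  "state y t = fst (conf y t)"

definition head :: "bool list \<Rightarrow> nat \<Rightarrow> nat \<Rightarrow> int" where
  "head y t j = fst (snd (conf y t) ! j)"

definition cell :: "bool list \<Rightarrow> nat \<Rightarrow> nat \<Rightarrow> int \<Rightarrow> nat" where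
  "cell y t j = snd (snd (conf y t) ! j)"

definition scan :: "bool list \<Rightarrow> nat \<Rightarrow> nat list" where
  "scan y t = map read_tape (snd (conf y t))"

lemma tm_step_tr: "tm_step M (st, ts) = (case tr st (map read_tape ts) of (st', as) \<Rightarrow> (st', map2 act_tape as ts))"
  by (simp add: tm_step_def tr_def map2_act_tape_id del: map_map)

lemma conf_Suc: "conf y (Suc t) = (case tr (state y t) (scan y t) of (st', as) \<Rightarrow>
    (st', map2 act_tape as (snd (conf y t))))"
  by (cases "conf y t") (simp add: conf_def state_def scan_def tm_step_tr)

lemma conf_0: "conf y 0 = (0, input_tape y # replicate (k - 1) (0, \<lambda>_. 0))"
  by (simp add: conf_def tm_init_def)

lemma scan_range:
  assumes "length (snd (conf y t)) = k" "\<And>j i. j < k \<Longrightarrow> cell y t j i < g"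
  shows "set (scan y t) \<subseteq> {..<g}"
proof
  fix c assume "c \<in> set (scan y t)"
  then obtain j where "j < k" "c = cell y t j (head y t j)"
    using assms(1) by (auto simp: scan_def in_set_conv_nth read_tape_def cell_def head_def)
  then show "c \<in> {..<g}" using assms(2) by simp
qed

text \<open>A head moves at most one cell per step; this confines runs of length \<open>T x\<close>
  to the window of the tableau.\<close>

lemma conf_inv:
  "valid (state y t) (scan y t) \<and> length (snd (conf y t)) = k \<and> (\<forall>j<k. \<forall>i. cell y t j i < g) \<and> (\<forall>j<k. \<bar>head y t j\<bar> \<le> int t)"
proof (induction t)
  case 0
  have len: "length (snd (conf y 0)) = k" using k_pos by (simp add: conf_0)
  have c: "cell y 0 j i < g" if "j < k" for j i
  proof (cases j)
    case 0
    then show ?thesis using g_ge by (simp add: cell_def conf_0 input_tape_def bit_symbol_def)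
  next
    case (Suc j')
    then show ?thesis using g_ge that by (simp add: cell_def conf_0)
  qed
  have h: "head y 0 j = 0" if "j < k" for j
  proof (cases j)
    case 0
    then show ?thesis by (simp add: head_def conf_0 input_tape_def)
  next
    case (Suc j')
    then show ?thesis using that by (simp add: head_def conf_0)
  qed
  have "set (scan y 0) \<subseteq> {..<g}"
    using scan_range[OF len c] .
  then show ?case using len c h by (auto simp: valid_def state_def conf_0 scan_def)
next
  case (Suc t)
  obtain st' as where tr: "tr (state y t) (scan y t) = (st', as)" by fastforce
  note v = tr_valid[OF conjunct1[OF Suc] tr]
  have cS: "conf y (Suc t) = (st', map2 act_tape as (snd (conf y t)))" using conf_Suc tr by simp
  have len: "length (snd (conf y (Suc t))) = k" using v Suc by (simp add: cS)
  have tape: "snd (conf y (Suc t)) ! j = act_tape (as ! j) (snd (conf y t) ! j)" if "j < k" for j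
    using v(2) Suc that by (simp add: cS)
  have "fst (as ! j) < g" if "j < k" for j using v that by (metis image_subset_iff lessThan_iff nth_mem)
  then have c: "cell y (Suc t) j i < g" if "j < k" for j i
    using Suc that by (auto simp: cell_def tape act_tape_def)
  have h: "\<bar>head y (Suc t) j\<bar> \<le> int (Suc t)" if "j < k" for j
  proof -
    have "\<bar>head y t j\<bar> \<le> int t" using Suc that by blast
    then show ?thesis using that
      by (auto simp: head_def tape act_tape_def move_head_def split: direction.splits)
  qed
  have "set (scan y (Suc t)) \<subseteq> {..<g}"
    using scan_range[OF len c] .
  then show ?case using len c h v by (auto simp: valid_def state_def cS scan_def)
qed

lemma conf_valid: "valid (state y t) (scan y t)"
  and length_conf: "length (snd (conf y t)) = k"
  and cell_bound: "j < k \<Longrightarrow> cell y t j i < g"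
  and head_bound: "j < k \<Longrightarrow> \<bar>head y t j\<bar> \<le> int t"
  using conf_inv[of y t] by auto

lemma scan_nth: "j < k \<Longrightarrow> scan y t ! j = cell y t j (head y t j)"
  by (simp add: scan_def cell_def head_def read_tape_def length_conf)

lemma run_step:
  assumes "tr (state y t) (scan y t) = (st', as)"
  shows "state y (Suc t) = st'"
    "j < k \<Longrightarrow> head y (Suc t) j = move_head (snd (as ! j)) (head y t j)"
    "j < k \<Longrightarrow> cell y (Suc t) j i = (if i = head y t j then fst (as ! j) else cell y t j i)"
  using assms tr_valid(2)[OF conf_valid assms] length_conf[of y t]
  by (auto simp: state_def head_def cell_def conf_Suc act_tape_def)

lemma run_init:
  "state y 0 = 0"
  "j < k \<Longrightarrow> head y 0 j = 0"
  "cell y 0 0 i = (if 0 \<le> i \<and> i < int (length y) then bit_symbol (y ! nat i) else 0)"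
  "0 < j \<Longrightarrow> j < k \<Longrightarrow> cell y 0 j i = 0"
proof -
  show "head y 0 j = 0" if "j < k"
    using that by (cases j) (simp_all add: head_def conf_0 input_tape_def)
  show "cell y 0 j i = 0" if "0 < j" "j < k"
    using that by (cases j) (simp_all add: cell_def conf_0)
qed (simp_all add: state_def cell_def conf_0 input_tape_def)

definition len_bound :: "bool list \<Rightarrow> nat" where
  "len_bound x = 2 * length x + 1 + poly p (length x)"

text \<open>The first summand bounds the time on every admissible \<open>pair_words x u\<close>, the
  others ensure that such a word fits into the window.\<close>

definition T :: "bool list \<Rightarrow> nat" where
  "T x = poly q (len_bound x) + len_bound x + 1"

text \<open>Tape cell \<open>i\<close> has position \<open>i + T x\<close>.\<close>

definition W :: "bool list \<Rightarrow> nat" where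
  "W x = Suc (2 * T x)"

text \<open>Monotonicity of \<open>poly q\<close> replaces the actual word length by
  \<open>len_bound x\<close>, and a halted configuration persists until \<open>T x\<close>.\<close>

lemma output_cell:
  assumes "length u \<le> poly p (length x)"
  shows "cell (pair_words x u) (T x) (k - 1) 0 = bit_symbol (pair_words x u \<in> L)"
proof -
  let ?y = "pair_words x u"
  obtain n where n: "n \<le> poly q (length ?y)" and h: "tm_halted M (conf ?y n)" and out: "tm_output (conf ?y n) [?y \<in> L]"
    using computes unfolding tm_computes_in_time_def conf_def by blast
  have "length ?y \<le> len_bound x" using assms by (simp add: length_pair_words len_bound_def)
  then have "n \<le> T x" using n poly_nat_mono[of "length ?y" "len_bound x" q] by (simp add: T_def)
  then obtain m where m: "T x = m + n" by (metis add.commute le_Suc_ex)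
  have "(tm_step M ^^ m) (conf ?y n) = conf ?y n"
    using h by (induction m) (auto simp: tm_step_def tm_halted_def split: prod.splits)
  then have "conf ?y (T x) = conf ?y n" by (simp add: conf_def m funpow_add)
  moreover have "snd (conf ?y n) ! (k - 1) = last (snd (conf ?y n))"
    using length_conf[of ?y n] k_pos by (metis last_conv_nth length_0_conv not_one_le_zero)
  ultimately show ?thesis using out by (simp add: cell_def tm_output_def)
qed

section \<open>The clauses of the tableau\<close>

definition pre :: "nat \<Rightarrow> nat list \<Rightarrow> literal list" where
  "pre st rs = (KState st, \<lambda>x t a b. t, \<lambda>x t a b. 0) #
     map (\<lambda>j. (KRead j (rs ! j), \<lambda>x t a b. t, \<lambda>x t a b. 0)) [0..<k]"

definition shift :: "direction \<Rightarrow> nat \<Rightarrow> nat" where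
  "shift d a = (case d of Left \<Rightarrow> a - 1 | Stay \<Rightarrow> a | Right \<Rightarrow> Suc a)"

text \<open>The start cells that do not depend on the certificate: blanks outside the longest
  possible word, and the symbols 1 and 2 of \<open>pair_words x u\<close> before \<open>u\<close>.
  Comparisons use \<open><\<close> and negation, to fit the closure lemmas for
  \<open>decidable\<close>.\<close>

definition fixed_guard :: "nat \<Rightarrow> bool list \<Rightarrow> nat \<Rightarrow> bool" where
  "fixed_guard c x a = (let i = a - T x; n = length x in
     if c = 0 then a < T x \<or> \<not> a < T x + len_bound x
     else if c = 1 then \<not> a < T x \<and> (i = 2 * n \<or> i < 2 * n \<and> i mod 2 = 1 \<and> \<not> (i div 2 < n \<and> x ! (i div 2)))
     else \<not> a < T x \<and> i < 2 * n \<and> (i mod 2 = 0 \<or> i div 2 < n \<and> x ! (i div 2)))"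

definition guess_from :: "bool list \<Rightarrow> nat" where
  "guess_from x = T x + 2 * length x + 1"

definition init_state_rule :: rule where
  "init_state_rule = (\<lambda>x t a b. True, [], [(KState 0, \<lambda>x t a b. 0, \<lambda>x t a b. 0)])"

definition init_head_rule :: "nat \<Rightarrow> rule" where
  "init_head_rule j = (\<lambda>x t a b. True, [], [(KHead j, \<lambda>x t a b. 0, \<lambda>x t a b. T x)])"

definition init_blank_rule :: "nat \<Rightarrow> rule" where
  "init_blank_rule j = (\<lambda>x t a b. True, [], [(KCell j 0, \<lambda>x t a b. 0, \<lambda>x t a b. a)])"

definition fixed_rule :: "nat \<Rightarrow> rule" where
  "fixed_rule c = (\<lambda>x t a b. fixed_guard c x a, [], [(KCell 0 c, \<lambda>x t a b. 0, \<lambda>x t a b. a)])"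

text \<open>The only rule with several positive literals. Blank is among the choices because the
  certificate may be shorter than its bound.\<close>

definition guess_rule :: rule where
  "guess_rule = (\<lambda>x t a b. \<not> a < guess_from x \<and> a < T x + len_bound x, [],
     [(KCell 0 0, \<lambda>x t a b. 0, \<lambda>x t a b. a), (KCell 0 1, \<lambda>x t a b. 0, \<lambda>x t a b. a),
      (KCell 0 2, \<lambda>x t a b. 0, \<lambda>x t a b. a)])"

text \<open>Blanks propagate to the right, so a guess amounts to a word followed by blanks.\<close>

definition chain_rule :: rule where
  "chain_rule = (\<lambda>x t a b. \<not> a < guess_from x \<and> Suc a < T x + len_bound x,
     [(KCell 0 0, \<lambda>x t a b. 0, \<lambda>x t a b. a)], [(KCell 0 0, \<lambda>x t a b. 0, \<lambda>x t a b. Suc a)])"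

definition read_rule :: "nat \<Rightarrow> nat \<Rightarrow> rule" where
  "read_rule j c = (\<lambda>x t a b. True,
     [(KHead j, \<lambda>x t a b. t, \<lambda>x t a b. a), (KCell j c, \<lambda>x t a b. t, \<lambda>x t a b. a)],
     [(KRead j c, \<lambda>x t a b. t, \<lambda>x t a b. 0)])"

text \<open>\<open>b\<close> is the position of the head; this is where a second position parameter
  is required.\<close>

definition frame_rule :: "nat \<Rightarrow> nat \<Rightarrow> rule" where
  "frame_rule j c = (\<lambda>x t a b. t < T x \<and> a \<noteq> b,
     [(KHead j, \<lambda>x t a b. t, \<lambda>x t a b. b), (KCell j c, \<lambda>x t a b. t, \<lambda>x t a b. a)],
     [(KCell j c, \<lambda>x t a b. Suc t, \<lambda>x t a b. a)])"

definition state_rule :: "nat \<Rightarrow> nat list \<Rightarrow> rule" where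
  "state_rule st rs = (\<lambda>x t a b. t < T x, pre st rs,
     [(KState (fst (tr st rs)), \<lambda>x t a b. Suc t, \<lambda>x t a b. 0)])"

text \<open>The guard keeps the new position inside the window and makes the truncated
  \<open>a - 1\<close> in \<open>shift\<close> exact.\<close>

definition head_rule :: "nat \<Rightarrow> nat list \<Rightarrow> nat \<Rightarrow> rule" where
  "head_rule st rs j = (\<lambda>x t a b. t < T x \<and> 0 < a \<and> Suc a < W x,
     (KHead j, \<lambda>x t a b. t, \<lambda>x t a b. a) # pre st rs,
     [(KHead j, \<lambda>x t a b. Suc t, \<lambda>x t a b. shift (snd (snd (tr st rs) ! j)) a)])"

definition write_rule :: "nat \<Rightarrow> nat list \<Rightarrow> nat \<Rightarrow> rule" where
  "write_rule st rs j = (\<lambda>x t a b. t < T x,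
     (KHead j, \<lambda>x t a b. t, \<lambda>x t a b. a) # pre st rs,
     [(KCell j (fst (snd (tr st rs) ! j)), \<lambda>x t a b. Suc t, \<lambda>x t a b. a)])"

text \<open>
  The verifier always ends with an answer bit, so it suffices to forbid the answer \<open>False\<close> (symbol 1).
\<close>

definition final_rule :: rule where
  "final_rule = (\<lambda>x t a b. True, [(KCell (k - 1) 1, \<lambda>x t a b. T x, \<lambda>x t a b. T x)], [])"

inductive_set rules :: "rule set" where
  init_state: "init_state_rule \<in> rules"
| init_head: "j < k \<Longrightarrow> init_head_rule j \<in> rules"
| init_blank: "0 < j \<Longrightarrow> j < k \<Longrightarrow> init_blank_rule j \<in> rules"
| fixed: "c < 3 \<Longrightarrow> fixed_rule c \<in> rules"
| guess: "guess_rule \<in> rules"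
| chain: "chain_rule \<in> rules"
| read: "j < k \<Longrightarrow> c < g \<Longrightarrow> read_rule j c \<in> rules"
| frame: "j < k \<Longrightarrow> c < g \<Longrightarrow> frame_rule j c \<in> rules"
| state: "valid st rs \<Longrightarrow> state_rule st rs \<in> rules"
| head: "valid st rs \<Longrightarrow> j < k \<Longrightarrow> head_rule st rs j \<in> rules"
| writing: "valid st rs \<Longrightarrow> j < k \<Longrightarrow> write_rule st rs j \<in> rules"
| final: "final_rule \<in> rules"

definition pre_holds :: "(fact \<Rightarrow> bool) \<Rightarrow> nat \<Rightarrow> nat \<Rightarrow> nat list \<Rightarrow> bool" where
  "pre_holds \<phi> t st rs \<longleftrightarrow> \<phi> (KState st, t, 0) \<and> (\<forall>j<k. \<phi> (KRead j (rs ! j), t, 0))"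

lemma rule_sat_simps:
  "rule_sat x \<phi> t a b init_state_rule \<longleftrightarrow> \<phi> (KState 0, 0, 0)"
  "rule_sat x \<phi> t a b (init_head_rule j) \<longleftrightarrow> \<phi> (KHead j, 0, T x)"
  "rule_sat x \<phi> t a b (init_blank_rule j) \<longleftrightarrow> \<phi> (KCell j 0, 0, a)"
  "rule_sat x \<phi> t a b (fixed_rule c) \<longleftrightarrow> (fixed_guard c x a \<longrightarrow> \<phi> (KCell 0 c, 0, a))"
  "rule_sat x \<phi> t a b guess_rule \<longleftrightarrow> (\<not> a < guess_from x \<and> a < T x + len_bound x \<longrightarrow>
     \<phi> (KCell 0 0, 0, a) \<or> \<phi> (KCell 0 1, 0, a) \<or> \<phi> (KCell 0 2, 0, a))"
  "rule_sat x \<phi> t a b chain_rule \<longleftrightarrow> (\<not> a < guess_from x \<and> Suc a < T x + len_bound x \<longrightarrow>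
     \<phi> (KCell 0 0, 0, a) \<longrightarrow> \<phi> (KCell 0 0, 0, Suc a))"
  "rule_sat x \<phi> t a b (read_rule j c) \<longleftrightarrow> (\<phi> (KHead j, t, a) \<and> \<phi> (KCell j c, t, a) \<longrightarrow> \<phi> (KRead j c, t, 0))"
  "rule_sat x \<phi> t a b (frame_rule j c) \<longleftrightarrow>
     (t < T x \<and> a \<noteq> b \<and> \<phi> (KHead j, t, b) \<and> \<phi> (KCell j c, t, a) \<longrightarrow> \<phi> (KCell j c, Suc t, a))"
  "rule_sat x \<phi> t a b (state_rule st rs) \<longleftrightarrow>
     (t < T x \<and> pre_holds \<phi> t st rs \<longrightarrow> \<phi> (KState (fst (tr st rs)), Suc t, 0))"
  "rule_sat x \<phi> t a b (head_rule st rs j) \<longleftrightarrow>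
     (t < T x \<and> 0 < a \<and> Suc a < W x \<and> \<phi> (KHead j, t, a) \<and> pre_holds \<phi> t st rs \<longrightarrow>
      \<phi> (KHead j, Suc t, shift (snd (snd (tr st rs) ! j)) a))"
  "rule_sat x \<phi> t a b (write_rule st rs j) \<longleftrightarrow>
     (t < T x \<and> \<phi> (KHead j, t, a) \<and> pre_holds \<phi> t st rs \<longrightarrow>
      \<phi> (KCell j (fst (snd (tr st rs) ! j)), Suc t, a))"
  "rule_sat x \<phi> t a b final_rule \<longleftrightarrow> \<not> \<phi> (KCell (k - 1) 1, T x, T x)"
proof -
  have "(\<exists>l\<in>set (pre st rs). \<not> \<phi> (inst x t a b l)) \<longleftrightarrow> \<not> pre_holds \<phi> t st rs" for st rs
    by (auto simp: pre_def pre_holds_def inst_def)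
  note [simp] = this
  show
    "rule_sat x \<phi> t a b (state_rule st rs) \<longleftrightarrow>
     (t < T x \<and> pre_holds \<phi> t st rs \<longrightarrow> \<phi> (KState (fst (tr st rs)), Suc t, 0))"
    "rule_sat x \<phi> t a b (head_rule st rs j) \<longleftrightarrow>
     (t < T x \<and> 0 < a \<and> Suc a < W x \<and> \<phi> (KHead j, t, a) \<and> pre_holds \<phi> t st rs \<longrightarrow>
      \<phi> (KHead j, Suc t, shift (snd (snd (tr st rs) ! j)) a))"
    "rule_sat x \<phi> t a b (write_rule st rs j) \<longleftrightarrow>
     (t < T x \<and> \<phi> (KHead j, t, a) \<and> pre_holds \<phi> t st rs \<longrightarrow>
      \<phi> (KCell j (fst (snd (tr st rs) ! j)), Suc t, a))"
    unfolding rule_sat_def state_rule_def head_rule_def write_rule_def by (auto simp: inst_def[of _ _ _ _ "(_, _)"])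
qed (auto simp: rule_sat_def inst_def init_state_rule_def init_head_rule_def init_blank_rule_def
    fixed_rule_def guess_rule_def chain_rule_def read_rule_def frame_rule_def final_rule_def)

lemma finite_valid: "finite {(st, rs). valid st rs}"
proof -
  have "{(st, rs). valid st rs} = {..s} \<times> {rs. set rs \<subseteq> {..<g} \<and> length rs = k}"
    by (auto simp: valid_def)
  then show ?thesis by (simp add: finite_lists_length_eq)
qed

lemma finite_rules: "finite rules"
proof -
  have 1: "finite {f j |j. j < n}" for f :: "nat \<Rightarrow> rule" and n
    by simp
  have 2: "finite {f j c |j c. j < k \<and> c < g}" for f :: "nat \<Rightarrow> nat \<Rightarrow> rule"
    by (rule finite_subset[OF _ finite_imageI[of "{..<k} \<times> {..<g}" "\<lambda>(j, c). f j c"]]) auto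
  have 3: "finite {f st rs j |st rs j. valid st rs \<and> j < k}" for f :: "nat \<Rightarrow> nat list \<Rightarrow> nat \<Rightarrow> rule"
    by (rule finite_subset[OF _ finite_imageI[of "{(st, rs). valid st rs} \<times> {..<k}" "\<lambda>((st, rs), j). f st rs j"]])
      (auto simp: image_iff finite_valid, blast)
  \<comment> \<open>\<open>state_rule\<close> is listed with a dummy index \<open>j\<close> to match
    the shape of \<open>3\<close>; \<open>0 < k\<close> provides a value for it.\<close>
  let ?S = "{init_state_rule, guess_rule, chain_rule, final_rule} \<union> {init_head_rule j |j. j < k} \<union>
     {init_blank_rule j |j. j < k} \<union> {fixed_rule c |c. c < 3} \<union>
     {read_rule j c |j c. j < k \<and> c < g} \<union> {frame_rule j c |j c. j < k \<and> c < g} \<union>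
     {state_rule st rs |st rs j. valid st rs \<and> j < k} \<union>
     {head_rule st rs j |st rs j. valid st rs \<and> j < k} \<union> {write_rule st rs j |st rs j. valid st rs \<and> j < k}"
  have "finite ?S" by (intro finite_UnI 1 2 3) simp
  moreover have "rules \<subseteq> ?S"
  proof
    fix r assume "r \<in> rules"
    moreover have "0 < k" using k_pos by simp
    ultimately show "r \<in> ?S" by cases blast+
  qed
  ultimately show ?thesis by (rule finite_subset[rotated])
qed

section \<open>Satisfying assignments and accepting runs\<close>

definition tableau_sat :: "bool list \<Rightarrow> (fact \<Rightarrow> bool) \<Rightarrow> bool" where
  "tableau_sat x \<phi> \<longleftrightarrow> (\<forall>r\<in>rules. \<forall>t\<le>T x. \<forall>a<W x. \<forall>b<W x. rule_sat x \<phi> t a b r)"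

fun true_fact :: "bool list \<Rightarrow> bool list \<Rightarrow> fact \<Rightarrow> bool" where
  "true_fact x y (KState st, t, a) = (state y t = st)"
| "true_fact x y (KHead j, t, a) = (head y t j = int a - int (T x))"
| "true_fact x y (KCell j c, t, a) = (cell y t j (int a - int (T x)) = c)"
| "true_fact x y (KRead j c, t, a) = (scan y t ! j = c)"

lemma pair_words_cell:
  assumes "length u \<le> poly p (length x)" "fixed_guard c x a" "c < 3"
  shows "cell (pair_words x u) 0 0 (int a - int (T x)) = c"
proof -
  define i where "i = a - T x"
  let ?n = "length x"
  have len: "length (pair_words x u) \<le> len_bound x" using assms(1) by (simp add: length_pair_words len_bound_def)
  consider "c = 0" | "c = 1" | "c = 2" using assms(3) by linarith
  then show ?thesis
  proof cases
    case 1
    then show ?thesis using assms(2) len by (auto simp: run_init fixed_guard_def Let_def)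
  next
    case 2
    then have a: "\<not> a < T x" and "i = 2 * ?n \<or> i < 2 * ?n \<and> odd i \<and> \<not> x ! (i div 2)"
      using assms(2) by (auto simp: fixed_guard_def Let_def i_def[symmetric])
    then have "\<not> pair_words x u ! i" "i \<le> 2 * ?n" by (auto simp: nth_pair_words)
    moreover have "int a - int (T x) = int i" using a by (simp add: i_def)
    ultimately show ?thesis using 2 by (simp add: run_init length_pair_words bit_symbol_def)
  next
    case 3
    then have a: "\<not> a < T x" and "i < 2 * ?n" "even i \<or> x ! (i div 2)"
      using assms(2) by (auto simp: fixed_guard_def Let_def i_def[symmetric])
    then have "pair_words x u ! i" "i \<le> 2 * ?n" by (auto simp: nth_pair_words)
    moreover have "int a - int (T x) = int i" using a by (simp add: i_def)
    ultimately show ?thesis using 3 by (simp add: run_init length_pair_words bit_symbol_def)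
  qed
qed

lemma pre_true:
  assumes "pre_holds (true_fact x y) t st rs" "valid st rs"
  shows "state y t = st" "scan y t = rs"
proof -
  show "state y t = st" using assms(1) by (simp add: pre_holds_def)
  show "scan y t = rs"
  proof (rule nth_equalityI)
    show "length (scan y t) = length rs" using assms(2) conf_valid[of y t] by (simp add: valid_def)
    fix j assume "j < length (scan y t)"
    then have "j < k" using conf_valid[of y t] by (simp add: valid_def)
    then show "scan y t ! j = rs ! j" using assms(1) by (simp add: pre_holds_def)
  qed
qed

text \<open>The facts of a run obey the propagation rules because they describe the transition
  actually taken; acceptance enters only through \<open>final_rule\<close>.\<close>

lemma tableau_complete:
  assumes u: "length u \<le> poly p (length x)" and acc: "pair_words x u \<in> L"
  shows "tableau_sat x (true_fact x (pair_words x u))"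
proof -
  let ?y = "pair_words x u"
  let ?\<phi> = "true_fact x ?y"
  have step: "state ?y (Suc t) = fst (tr st rs)"
    "j < k \<Longrightarrow> head ?y (Suc t) j = move_head (snd (snd (tr st rs) ! j)) (head ?y t j)"
    "j < k \<Longrightarrow> cell ?y (Suc t) j i = (if i = head ?y t j then fst (snd (tr st rs) ! j) else cell ?y t j i)"
    if "pre_holds ?\<phi> t st rs" "valid st rs" for t st rs j i
    using run_step[of ?y t "fst (tr st rs)" "snd (tr st rs)"] pre_true[OF that] by auto
  have "rule_sat x ?\<phi> t a b r" if "r \<in> rules" for r t a b
    using that
  proof cases
    case guess
    have "cell ?y 0 0 i = 0 \<or> cell ?y 0 0 i = 1 \<or> cell ?y 0 0 i = 2" for i
      by (simp add: run_init bit_symbol_def)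
    then show ?thesis unfolding guess rule_sat_simps true_fact.simps by blast
  next
    case chain
    show ?thesis unfolding chain rule_sat_simps true_fact.simps
      by (auto simp: run_init guess_from_def bit_symbol_def split: if_splits)
  next
    case (frame j c)
    then have "cell ?y (Suc t) j i = cell ?y t j i" if "i \<noteq> head ?y t j" for i
      using run_step(3)[of ?y t "fst (tr (state ?y t) (scan ?y t))" "snd (tr (state ?y t) (scan ?y t))" j i] that by simp
    then show ?thesis unfolding frame rule_sat_simps true_fact.simps by auto
  next
    case (state st rs)
    then show ?thesis unfolding state(1) rule_sat_simps true_fact.simps using step(1) by blast
  next
    case (head st rs j)
    have "move_head d (int a - int (T x)) = int (shift d a) - int (T x)" if "0 < a" for d
      using that by (cases d) (auto simp: move_head_def shift_def)
    then show ?thesis unfolding head(1) rule_sat_simps true_fact.simps using step(2) head(2,3) by metis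
  next
    case (writing st rs j)
    then show ?thesis unfolding writing(1) rule_sat_simps true_fact.simps using step(3) by metis
  next
    case final
    show ?thesis unfolding final rule_sat_simps true_fact.simps
      using output_cell[OF u] acc by (simp add: bit_symbol_def)
  qed (use pair_words_cell[OF u] in \<open>simp_all add: rule_sat_simps run_init(1,2,4) scan_nth\<close>)
  then show ?thesis unfolding tableau_sat_def by blast
qed

lemma tableau_satD:
  assumes "tableau_sat x \<phi>" "r \<in> rules" "t \<le> T x" "a < W x" "b < W x"
  shows "rule_sat x \<phi> t a b r"
  using assms unfolding tableau_sat_def by blast

text \<open>An assignment may assert several symbols for one cell. The certificate is cut at the
  first cell with a blank fact, and before it a bit is \<open>True\<close> if the fact for symbol 2
  holds; otherwise \<open>guess_rule\<close> provides the fact for symbol 1.\<close>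

lemma tableau_init:
  assumes sat: "tableau_sat x \<phi>"
  obtains u where "length u \<le> poly p (length x)"
    "\<And>a. a < W x \<Longrightarrow> \<phi> (KCell 0 (cell (pair_words x u) 0 0 (int a - int (T x))), 0, a)"
proof -
  let ?n = "poly p (length x)" and ?b = "guess_from x"
  define m where "m = (LEAST i. i = ?n \<or> \<phi> (KCell 0 0, 0, ?b + i))"
  define u where "u = map (\<lambda>i. \<phi> (KCell 0 2, 0, ?b + i)) [0..<m]"
  have m: "m = ?n \<or> \<phi> (KCell 0 0, 0, ?b + m)" unfolding m_def by (rule LeastI[of _ ?n]) simp
  have m_le: "m \<le> ?n" unfolding m_def by (rule Least_le) simp
  have before: "\<not> \<phi> (KCell 0 0, 0, ?b + i)" if "i < m" for i
    using not_less_Least[OF that[unfolded m_def]] by blast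
  have W0: "0 < W x" by (simp add: W_def)
  have bound: "T x + len_bound x \<le> W x" by (simp add: W_def T_def)
  have gb: "?b + ?n = T x + len_bound x" by (simp add: guess_from_def len_bound_def)
  have chain: "\<phi> (KCell 0 0, 0, ?b + i)" if "m \<le> i" "i < ?n" for i
    using that
  proof (induction i rule: dec_induct)
    case base
    then show ?case using m by auto
  next
    case (step i)
    have "Suc (?b + i) < T x + len_bound x" using step.prems gb by simp
    then show ?case using tableau_satD[OF sat rules.chain, of 0 "?b + i" 0] step W0 bound
      by (simp add: rule_sat_simps)
  qed
  have guess: "\<phi> (KCell 0 (bit_symbol (u ! i)), 0, ?b + i)" if "i < m" for i
  proof -
    have "?b + i < T x + len_bound x" using that m_le gb by simp
    then have "\<phi> (KCell 0 1, 0, ?b + i) \<or> \<phi> (KCell 0 2, 0, ?b + i)"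
      using tableau_satD[OF sat rules.guess, of 0 "?b + i" 0] before[OF that] W0 bound
      by (simp add: rule_sat_simps)
    then show ?thesis using that by (auto simp: u_def bit_symbol_def)
  qed
  have fixed: "\<phi> (KCell 0 c, 0, a)" if "fixed_guard c x a" "c < 3" "a < W x" for c a
    using tableau_satD[OF sat rules.fixed[OF that(2)], of 0 a 0] that W0 by (simp add: rule_sat_simps)
  let ?y = "pair_words x u"
  have len: "length u \<le> ?n" using m_le by (simp add: u_def)
  have "\<phi> (KCell 0 (cell ?y 0 0 (int a - int (T x))), 0, a)" if a: "a < W x" for a
  proof (cases "\<exists>c<3. fixed_guard c x a")
    case True
    then show ?thesis using fixed pair_words_cell[OF len] a by blast
  next
    case False
    \<comment> \<open>A cell that no guard determines lies in the range of the certificate.\<close>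
    have "\<not> fixed_guard 0 x a" using False by auto
    then have "\<not> a < T x" "a < T x + len_bound x" by (auto simp: fixed_guard_def Let_def)
    moreover have "\<not> a - T x \<le> 2 * length x"
    proof
      assume le: "a - T x \<le> 2 * length x"
      define i where "i = a - T x"
      have "\<not> fixed_guard 1 x a" "\<not> fixed_guard 2 x a" using False by auto
      then have "i \<noteq> 2 * length x" "\<not> (i < 2 * length x \<and> i mod 2 = 1 \<and> \<not> (i div 2 < length x \<and> x ! (i div 2)))"
        "\<not> (i < 2 * length x \<and> (i mod 2 = 0 \<or> i div 2 < length x \<and> x ! (i div 2)))"
        using \<open>\<not> a < T x\<close> by (simp_all add: fixed_guard_def Let_def i_def)
      moreover have "i mod 2 = 0 \<or> i mod 2 = 1" by linarith
      moreover have "i < 2 * length x" using le \<open>i \<noteq> 2 * length x\<close> by (simp add: i_def)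
      ultimately show False by blast
    qed
    ultimately have "?b \<le> a" "a < ?b + ?n" unfolding gb by (auto simp: guess_from_def)
    then obtain i where i: "a = ?b + i" "i < ?n" using le_Suc_ex by fastforce
    have e: "int a - int (T x) = int (2 * length x + 1 + i)" using i(1) by (simp add: guess_from_def)
    show ?thesis
    proof (cases "i < m")
      case True
      then have "cell ?y 0 0 (int a - int (T x)) = bit_symbol (u ! i)"
        unfolding e run_init using nth_pair_words(3)[of x u i]
        by (simp add: length_pair_words u_def del: of_nat_Suc of_nat_add)
      then show ?thesis using guess[OF True] i(1) by simp
    next
      case F: False
      then have "cell ?y 0 0 (int a - int (T x)) = 0"
        unfolding e run_init by (simp add: length_pair_words u_def del: of_nat_Suc of_nat_add)
      then show ?thesis using chain[of i] F i by simp
    qed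
  qed
  then show thesis using that len by blast
qed

text \<open>
  A satisfying assignment may contain spurious facts, but it contains all facts of the actual run.
\<close>

definition covers :: "bool list \<Rightarrow> bool list \<Rightarrow> (fact \<Rightarrow> bool) \<Rightarrow> nat \<Rightarrow> bool" where
  "covers x y \<phi> t \<longleftrightarrow> \<phi> (KState (state y t), t, 0) \<and>
     (\<forall>j<k. \<phi> (KHead j, t, nat (head y t j + int (T x)))) \<and>
     (\<forall>j<k. \<forall>a<W x. \<phi> (KCell j (cell y t j (int a - int (T x))), t, a))"

lemma covers_0:
  assumes sat: "tableau_sat x \<phi>"
    and cells: "\<And>a. a < W x \<Longrightarrow> \<phi> (KCell 0 (cell y 0 0 (int a - int (T x))), 0, a)"
  shows "covers x y \<phi> 0"
proof -
  have W0: "0 < W x" by (simp add: W_def)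
  note fire = tableau_satD[OF sat _ _ _ W0, of _ 0]
  have "\<phi> (KState 0, 0, 0)"
    using fire[OF rules.init_state, of 0] W0 by (simp add: rule_sat_simps)
  moreover have "\<phi> (KHead j, 0, T x)" if "j < k" for j
    using fire[OF rules.init_head[OF that], of 0] W0 by (simp add: rule_sat_simps)
  moreover have "\<phi> (KCell j 0, 0, a)" if "0 < j" "j < k" "a < W x" for j a
    using fire[OF rules.init_blank[OF that(1,2)], of a] that by (simp add: rule_sat_simps)
  moreover have "\<phi> (KCell j (cell y 0 j (int a - int (T x))), 0, a)" if "j < k" "a < W x" for j a
    using cells calculation(3) that by (cases "j = 0") (simp_all add: run_init(4))
  ultimately show ?thesis by (simp add: covers_def run_init(1,2))
qed

text \<open>Rules whose premises are facts of the run fire and give its facts at the next time.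
  \<open>t < T x\<close> keeps the heads strictly inside the window, as the guard of
  \<open>head_rule\<close> demands.\<close>

lemma covers_Suc:
  assumes sat: "tableau_sat x \<phi>" and cov: "covers x y \<phi> t" and t: "t < T x"
  shows "covers x y \<phi> (Suc t)"
proof -
  let ?st = "state y t" and ?rs = "scan y t"
  obtain st' as where tr: "tr ?st ?rs = (st', as)" by fastforce
  note v = conf_valid[of y t]
  note step = run_step[OF tr]
  define pos where "pos j = nat (head y t j + int (T x))" for j
  have W0: "0 < W x" by (simp add: W_def)
  have pos: "int (pos j) = head y t j + int (T x)" "0 < pos j" "Suc (pos j) < W x" if "j < k" for j
    using head_bound[OF that, of y t] t by (auto simp: pos_def W_def)
  have hd: "\<phi> (KHead j, t, pos j)" if "j < k" for j using cov that by (simp add: covers_def pos_def)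
  have ce: "\<phi> (KCell j (cell y t j (int a - int (T x))), t, a)" if "j < k" "a < W x" for j a
    using cov that by (simp add: covers_def)
  have rd: "\<phi> (KRead j (?rs ! j), t, 0)" if j: "j < k" for j
  proof -
    let ?c = "?rs ! j"
    have c: "?c = cell y t j (int (pos j) - int (T x))" using pos[OF j] by (simp add: scan_nth[OF j])
    have "?c < g" unfolding c by (rule cell_bound[OF j])
    moreover have "\<phi> (KCell j ?c, t, pos j)" using ce[OF j, of "pos j"] pos[OF j] c by simp
    ultimately show ?thesis
      using tableau_satD[OF sat rules.read[OF j], of ?c t "pos j" 0] hd[OF j] pos[OF j] W0 t
      by (simp add: rule_sat_simps)
  qed
  have pre: "pre_holds \<phi> t ?st ?rs" using cov rd by (simp add: pre_holds_def covers_def)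
  have "\<phi> (KState st', Suc t, 0)"
    using tableau_satD[OF sat rules.state[OF v], of t 0 0] pre W0 t by (simp add: rule_sat_simps tr)
  moreover have "\<phi> (KHead j, Suc t, nat (head y (Suc t) j + int (T x)))" if j: "j < k" for j
  proof -
    let ?d = "snd (as ! j)"
    have "\<phi> (KHead j, Suc t, shift ?d (pos j))"
      using tableau_satD[OF sat rules.head[OF v j], of t "pos j" 0] pre hd[OF j] pos[OF j] W0 t
      by (simp add: rule_sat_simps tr)
    moreover have "shift ?d (pos j) = nat (head y (Suc t) j + int (T x))"
      unfolding step(2)[OF j] using pos[OF j] by (auto simp: shift_def move_head_def split: direction.splits)
    ultimately show ?thesis by simp
  qed
  moreover have "\<phi> (KCell j (cell y (Suc t) j (int a - int (T x))), Suc t, a)" if j: "j < k" and a: "a < W x" for j a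
  proof (cases "a = pos j")
    case True
    have "\<phi> (KCell j (fst (as ! j)), Suc t, a)"
      using tableau_satD[OF sat rules.writing[OF v j], of t a 0] pre hd[OF j] True a W0 t
      by (simp add: rule_sat_simps tr)
    moreover have "cell y (Suc t) j (int a - int (T x)) = fst (as ! j)"
      unfolding step(3)[OF j] using pos(1)[OF j] True by simp
    ultimately show ?thesis by simp
  next
    case False
    let ?c = "cell y t j (int a - int (T x))"
    have "?c < g" by (rule cell_bound[OF j])
    then have "\<phi> (KCell j ?c, Suc t, a)"
      using tableau_satD[OF sat rules.frame[OF j], of ?c t a "pos j"] hd[OF j] ce[OF j a] pos[OF j] False a t
      by (simp add: rule_sat_simps)
    moreover have "cell y (Suc t) j (int a - int (T x)) = ?c"
      unfolding step(3)[OF j] using pos(1)[OF j] False by auto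
    ultimately show ?thesis by simp
  qed
  ultimately show ?thesis unfolding covers_def step(1) by blast
qed

text \<open>The fact for the actual answer is forced at time \<open>T x\<close>, where position
  \<open>T x\<close> is cell 0, and the final clause rules out symbol 1.\<close>

lemma tableau_sound:
  assumes sat: "tableau_sat x \<phi>"
  shows "\<exists>u. length u \<le> poly p (length x) \<and> pair_words x u \<in> L"
proof -
  obtain u where u: "length u \<le> poly p (length x)"
    and cells: "\<And>a. a < W x \<Longrightarrow> \<phi> (KCell 0 (cell (pair_words x u) 0 0 (int a - int (T x))), 0, a)"
    by (rule tableau_init[OF sat]) blast
  let ?y = "pair_words x u"
  have "t \<le> T x \<Longrightarrow> covers x ?y \<phi> t" for t
  proof (induction t)
    case 0
    show ?case using covers_0[OF sat cells] .
  next
    case (Suc t)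
    then show ?case using covers_Suc[OF sat] by simp
  qed
  then have "covers x ?y \<phi> (T x)" by simp
  moreover have "k - 1 < k" "T x < W x" using k_pos by (simp_all add: W_def)
  ultimately have "\<phi> (KCell (k - 1) (cell ?y (T x) (k - 1) (int (T x) - int (T x))), T x, T x)"
    unfolding covers_def by blast
  then have c: "\<phi> (KCell (k - 1) (bit_symbol (?y \<in> L)), T x, T x)" using output_cell[OF u] by simp
  have "\<not> \<phi> (KCell (k - 1) 1, T x, T x)"
    using tableau_satD[OF sat rules.final, of 0 0 0] by (simp add: rule_sat_simps W_def)
  then have "?y \<in> L" using c by (auto simp: bit_symbol_def split: if_splits)
  then show ?thesis using u by blast
qed

theorem tableau_iff:
  "(\<exists>u. length u \<le> poly p (length x) \<and> pair_words x u \<in> L) \<longleftrightarrow> (\<exists>\<phi>. tableau_sat x \<phi>)"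
  using tableau_complete tableau_sound by blast

end

section \<open>Numbering facts and clauses\<close>

lemma mixed_radix_inject:
  fixes a b :: nat
  assumes "a < K" "a' < K" "a + K * b = a' + K * b'"
  shows "a = a' \<and> b = b'"
proof -
  have "(a + K * b) mod K = a" "(a' + K * b') mod K = a'" "(a + K * b) div K = b" "(a' + K * b') div K = b'"
    using assms(1,2) by auto
  then show ?thesis using assms(3) by metis
qed

lemma mixed_radix_less: "a < K \<Longrightarrow> b < B \<Longrightarrow> a + K * b < K * B" for a b :: nat
proof -
  assume "a < K" "b < B"
  then have "a + K * b < K * Suc b" "Suc b \<le> B" by auto
  then show ?thesis using mult_le_mono2 less_le_trans by blast
qed

context verifier
begin

section \<open>Clauses as arithmetic expressions\<close>

lemma definable_T: "definable d (\<lambda>x R. T x)"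
  unfolding T_def len_bound_def by (intro definable_intros)

lemma definable_W: "definable d (\<lambda>x R. W x)"
  unfolding W_def by (intro definable_intros definable_T)

lemma definable_len_bound: "definable d (\<lambda>x R. len_bound x)"
  unfolding len_bound_def by (intro definable_intros)

lemma definable_guess_from: "definable d (\<lambda>x R. guess_from x)"
  unfolding guess_from_def by (intro definable_intros definable_T)

lemma definable_shift: "definable d f \<Longrightarrow> definable d (\<lambda>x R. shift dir (f x R))"
  by (cases dir) (auto simp: shift_def intro!: definable_Suc definable_diff[OF _ definable_const, of _ _ 1, simplified])

lemma decidable_fixed_guard:
  assumes "definable d f"
  shows "decidable d (\<lambda>x R. fixed_guard c x (f x R))"
proof -
  note di = definable_intros definable_T definable_len_bound assms
  have bit: "decidable d (\<lambda>x R. (f x R - T x) div 2 < length x \<and> x ! ((f x R - T x) div 2))"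
    by (rule decidable_input_bit) (intro di, simp)
  consider "c = 0" | "c = 1" | "c \<noteq> 0" "c \<noteq> 1" by blast
  then show ?thesis
  proof cases
    case 1
    show ?thesis unfolding fixed_guard_def Let_def using 1
      by simp (intro decidable_disj decidable_not decidable_less di)
  next
    case 2
    have "decidable d (\<lambda>x R. \<not> f x R < T x \<and> (f x R - T x = 2 * length x \<or> f x R - T x < 2 * length x \<and>
        (f x R - T x) mod 2 = 1 \<and> \<not> ((f x R - T x) div 2 < length x \<and> x ! ((f x R - T x) div 2))))"
      by (rule decidable_conj decidable_disj decidable_not decidable_less decidable_eq di bit zero_less_numeral)+
    then show ?thesis using 2 by (simp add: fixed_guard_def Let_def)
  next
    case 3
    have "decidable d (\<lambda>x R. \<not> f x R < T x \<and> f x R - T x < 2 * length x \<and>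
        ((f x R - T x) mod 2 = 0 \<or> (f x R - T x) div 2 < length x \<and> x ! ((f x R - T x) div 2)))"
      by (rule bit decidable_conj decidable_disj decidable_not decidable_less decidable_eq di zero_less_numeral)+
    then show ?thesis using 3 by (simp add: fixed_guard_def Let_def)
  qed
qed

lemmas rule_defs = init_state_rule_def init_head_rule_def init_blank_rule_def fixed_rule_def guess_rule_def
  chain_rule_def read_rule_def frame_rule_def state_rule_def head_rule_def write_rule_def final_rule_def

text \<open>Time and positions are functions of the registers here, because they will be computed
  from the clause number.\<close>

lemma rule_definable:
  assumes r: "(G, ns, ps) \<in> rules" and tab: "definable d t" "definable d a" "definable d b"
  shows "decidable d (\<lambda>x R. G x (t x R) (a x R) (b x R))"
    and "(\<kappa>, f, h) \<in> set ns \<union> set ps \<Longrightarrow> definable d (\<lambda>x R. f x (t x R) (a x R) (b x R))"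
    and "(\<kappa>, f, h) \<in> set ns \<union> set ps \<Longrightarrow> definable d (\<lambda>x R. h x (t x R) (a x R) (b x R))"
proof -
  note di = tab definable_T definable_W definable_len_bound definable_guess_from definable_shift
    definable_const definable_Suc definable_add
  have *: "decidable d (\<lambda>x R. G x (t x R) (a x R) (b x R)) \<and>
    (\<forall>(\<kappa>, f, h) \<in> set ns \<union> set ps. definable d (\<lambda>x R. f x (t x R) (a x R) (b x R)) \<and>
       definable d (\<lambda>x R. h x (t x R) (a x R) (b x R)))"
    using r
    by cases (auto simp: rule_defs pre_def intro!: decidable_fixed_guard decidable_intros di)
  show "decidable d (\<lambda>x R. G x (t x R) (a x R) (b x R))" using * by blast
  show "definable d (\<lambda>x R. f x (t x R) (a x R) (b x R))" "definable d (\<lambda>x R. h x (t x R) (a x R) (b x R))"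
    if "(\<kappa>, f, h) \<in> set ns \<union> set ps" for \<kappa> f h
    using * that by fastforce+
qed

text \<open>The third property says that no clause contains a fact with both signs, as the column
  gadget requires; the first two give the digit bounds for numbering.\<close>

lemma rule_facts:
  assumes r: "(G, ns, ps) \<in> rules" and G: "G x t a b" and t: "t \<le> T x"
  shows "l \<in> set ns \<union> set ps \<Longrightarrow> inst x t a b l = (\<kappa>, t', a') \<Longrightarrow> t' \<le> T x"
    and "l \<in> set ns \<union> set ps \<Longrightarrow> a < W x \<Longrightarrow> b < W x \<Longrightarrow> inst x t a b l = (\<kappa>, t', a') \<Longrightarrow> a' < W x"
    and "l \<in> set ns \<Longrightarrow> l' \<in> set ps \<Longrightarrow> inst x t a b l \<noteq> inst x t a b l'"
proof -
  have W: "T x < W x" "T x + len_bound x \<le> W x" by (simp_all add: W_def T_def)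
  have sh: "shift d a < W x" if "Suc a < W x" for d using that by (cases d) (auto simp: shift_def)
  show "l \<in> set ns \<union> set ps \<Longrightarrow> inst x t a b l = (\<kappa>, t', a') \<Longrightarrow> t' \<le> T x"
    using r G t by cases (auto simp: rule_defs pre_def inst_def)
  show "l \<in> set ns \<union> set ps \<Longrightarrow> a < W x \<Longrightarrow> b < W x \<Longrightarrow> inst x t a b l = (\<kappa>, t', a') \<Longrightarrow> a' < W x"
    using r G t W sh by cases (auto simp: rule_defs pre_def inst_def)
  show "l \<in> set ns \<Longrightarrow> l' \<in> set ps \<Longrightarrow> inst x t a b l \<noteq> inst x t a b l'"
    using r G t by cases (auto simp: rule_defs pre_def inst_def)
qed

end

text \<open>\<open>rl\<close> lists the rules in some order and \<open>K\<close> bounds the codes of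
  their kinds. Both depend on the verifier only, so they are constants for the reduction.\<close>

locale numbered_verifier = verifier +
  fixes rl :: "rule list" and K :: nat
  assumes rl: "set rl = rules"
    and K: "\<And>G ns ps \<kappa> f h. (G, ns, ps) \<in> rules \<Longrightarrow> (\<kappa>, f, h) \<in> set ns \<union> set ps \<Longrightarrow> to_nat \<kappa> < K"
begin

lemma rl_pos: "0 < length rl"
  using rl rules.init_state by (cases rl) auto

text \<open>A mixed radix number with the position as leading digit; \<open>Suc\<close> reserves
  variable 0.\<close>

fun enc :: "bool list \<Rightarrow> fact \<Rightarrow> nat" where
  "enc x (\<kappa>, t, a) = Suc (to_nat \<kappa> + K * (t + Suc (T x) * a))"

definition num_vars :: "bool list \<Rightarrow> nat" where
  "num_vars x = Suc (K * (Suc (T x) * W x))"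

definition num_clauses :: "bool list \<Rightarrow> nat" where
  "num_clauses x = length rl * (Suc (T x) * (W x * W x))"

text \<open>A clause number has the digits rule index, time, first and second position, lowest
  first.\<close>

definition time_of :: "bool list \<Rightarrow> nat \<Rightarrow> nat" where
  "time_of x c = c div length rl mod Suc (T x)"

definition pos1_of :: "bool list \<Rightarrow> nat \<Rightarrow> nat" where
  "pos1_of x c = c div length rl div Suc (T x) mod W x"

definition pos2_of :: "bool list \<Rightarrow> nat \<Rightarrow> nat" where
  "pos2_of x c = c div length rl div Suc (T x) div W x"

definition guard :: "rule \<Rightarrow> bool list \<Rightarrow> nat \<Rightarrow> bool" where
  "guard r x c = fst r x (time_of x c) (pos1_of x c) (pos2_of x c)"

definition occurs :: "literal list \<Rightarrow> bool list \<Rightarrow> nat \<Rightarrow> nat \<Rightarrow> bool" where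
  "occurs ls x v c = (\<exists>l\<in>set ls. v = enc x (inst x (time_of x c) (pos1_of x c) (pos2_of x c) l))"

text \<open>Variable 0 stands for truth; it makes the clauses with a failing guard trivial.\<close>

definition pos_lit :: "bool list \<Rightarrow> nat \<Rightarrow> nat \<Rightarrow> bool" where
  "pos_lit x v c = (let r = rl ! (c mod length rl) in
     if guard r x c then occurs (snd (snd r)) x v c else v = 0)"

definition neg_lit :: "bool list \<Rightarrow> nat \<Rightarrow> nat \<Rightarrow> bool" where
  "neg_lit x v c = (let r = rl ! (c mod length rl) in guard r x c \<and> occurs (fst (snd r)) x v c)"

lemma time_of_le: "time_of x c \<le> T x"
  unfolding time_of_def by (meson less_Suc_eq_le mod_less_divisor zero_less_Suc)

lemma pos1_of_less: "pos1_of x c < W x"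
  unfolding pos1_of_def by (simp add: W_def)

lemma pos2_of_less: "c < num_clauses x \<Longrightarrow> pos2_of x c < W x"
  unfolding pos2_of_def num_clauses_def
  by (simp add: less_mult_imp_div_less mult.commute mult.left_commute mult.assoc)

lemma clause_decode:
  assumes "i < length rl" "t \<le> T x" "a < W x" "b < W x"
  defines "c \<equiv> i + length rl * (t + Suc (T x) * (a + W x * b))"
  shows "c < num_clauses x" "c mod length rl = i" "time_of x c = t" "pos1_of x c = a" "pos2_of x c = b"
proof -
  show "c < num_clauses x" unfolding c_def num_clauses_def
    using assms(1-4) by (intro mixed_radix_less) auto
  have d: "c div length rl = t + Suc (T x) * (a + W x * b)" and "c mod length rl = i"
    using assms(1) rl_pos by (auto simp: c_def)
  then show "c mod length rl = i" by simp
  have e: "(t + Suc (T x) * (a + W x * b)) mod Suc (T x) = t" "(t + Suc (T x) * (a + W x * b)) div Suc (T x) = a + W x * b"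
    using assms(2) by (auto simp del: mult_Suc)
  show "time_of x c = t" "pos1_of x c = a" "pos2_of x c = b"
    unfolding time_of_def pos1_of_def pos2_of_def d e using assms(3) by auto
qed

lemma enc_inject:
  assumes "to_nat \<kappa> < K" "to_nat \<kappa>' < K" "t \<le> T x" "t' \<le> T x" "enc x (\<kappa>, t, a) = enc x (\<kappa>', t', a')"
  shows "(\<kappa>, t, a) = (\<kappa>', t', a')"
proof -
  have "to_nat \<kappa> + K * (t + Suc (T x) * a) = to_nat \<kappa>' + K * (t' + Suc (T x) * a')"
    using assms(5) by simp
  then have "to_nat \<kappa> = to_nat \<kappa>'" and 1: "t + Suc (T x) * a = t' + Suc (T x) * a'"
    using mixed_radix_inject[OF assms(1,2)] by auto
  moreover have "t = t' \<and> a = a'" using mixed_radix_inject[OF _ _ 1] assms(3,4) by simp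
  ultimately show ?thesis by simp
qed

lemma enc_less: "to_nat \<kappa> < K \<Longrightarrow> t \<le> T x \<Longrightarrow> a < W x \<Longrightarrow> enc x (\<kappa>, t, a) < num_vars x"
  using mixed_radix_less[of "to_nat \<kappa>" K "t + Suc (T x) * a" "Suc (T x) * W x"]
    mixed_radix_less[of t "Suc (T x)" a "W x"]
  by (simp add: num_vars_def del: mult_Suc)

lemma clause_rule: "rl ! (c mod length rl) \<in> rules"
  using rl rl_pos by (metis mod_less_divisor nth_mem)

text \<open>Kind code and time stay below their radices, so equal variables come from equal facts,
  which \<open>rule_facts\<close> excludes.\<close>

lemma lits_disjoint: "\<not> (pos_lit x v c \<and> neg_lit x v c)"
proof
  assume *: "pos_lit x v c \<and> neg_lit x v c"
  obtain G ns ps where r: "rl ! (c mod length rl) = (G, ns, ps)" by (metis prod_cases3)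
  let ?i = "inst x (time_of x c) (pos1_of x c) (pos2_of x c)"
  have rr: "(G, ns, ps) \<in> rules" using clause_rule[of c] r by simp
  have G: "G x (time_of x c) (pos1_of x c) (pos2_of x c)"
    using * by (simp add: neg_lit_def r Let_def guard_def)
  obtain l l' where l: "l \<in> set ns" "v = enc x (?i l)" and l': "l' \<in> set ps" "v = enc x (?i l')"
    using * by (auto simp: neg_lit_def pos_lit_def r Let_def occurs_def)
  obtain \<kappa> f h where lk: "l = (\<kappa>, f, h)" by (metis prod_cases3)
  obtain \<kappa>' f' h' where lk': "l' = (\<kappa>', f', h')" by (metis prod_cases3)
  obtain t a where i: "?i l = (\<kappa>, t, a)" by (simp add: lk inst_def)
  obtain t' a' where i': "?i l' = (\<kappa>', t', a')" by (simp add: lk' inst_def)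
  note facts = rule_facts[OF rr G time_of_le]
  have "t \<le> T x" "t' \<le> T x" using facts(1)[OF _ i] facts(1)[OF _ i'] l l' by auto
  moreover have "to_nat \<kappa> < K" "to_nat \<kappa>' < K" using K[OF rr] l l' lk lk' by auto
  ultimately have "?i l = ?i l'" using enc_inject l(2) l'(2) i i' by metis
  then show False using facts(3)[OF l(1) l'(1)] by blast
qed

theorem cnf_iff_tableau:
  "cnf_sat (num_vars x) (num_clauses x) (pos_lit x) (neg_lit x) \<longleftrightarrow> (\<exists>\<phi>. tableau_sat x \<phi>)"
proof
  assume "cnf_sat (num_vars x) (num_clauses x) (pos_lit x) (neg_lit x)"
  then obtain A where A: "\<And>c. c < num_clauses x \<Longrightarrow> \<exists>v. pos_lit x v c \<and> A v \<or> neg_lit x v c \<and> \<not> A v"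
    unfolding cnf_sat_def by blast
  have "tableau_sat x (\<lambda>f. A (enc x f))"
    unfolding tableau_sat_def
  proof (intro ballI allI impI)
    fix r t a b assume "r \<in> rules" and *: "t \<le> T x" "a < W x" "b < W x"
    then obtain i where i: "i < length rl" "rl ! i = r" by (metis rl in_set_conv_nth)
    define c where "c = i + length rl * (t + Suc (T x) * (a + W x * b))"
    note dec = clause_decode[OF i(1) *, folded c_def]
    obtain G ns ps where r: "r = (G, ns, ps)" by (metis prod_cases3)
    show "rule_sat x (\<lambda>f. A (enc x f)) t a b r"
      using A[OF dec(1)] i(2)
      by (auto simp: rule_sat_def r pos_lit_def neg_lit_def dec guard_def occurs_def Let_def)
  qed
  then show "\<exists>\<phi>. tableau_sat x \<phi>" by blast
next
  assume "\<exists>\<phi>. tableau_sat x \<phi>"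
  then obtain \<phi> where sat: "tableau_sat x \<phi>" by blast
  \<comment> \<open>\<open>enc\<close> is injective only for bounded kind codes and times, hence the
    restriction; the position is the leading digit and may be arbitrary.\<close>
  define A where "A v \<longleftrightarrow> v = 0 \<or> (\<exists>\<kappa> t a. to_nat \<kappa> < K \<and> t \<le> T x \<and> enc x (\<kappa>, t, a) = v \<and> \<phi> (\<kappa>, t, a))" for v
  have A_enc: "A (enc x (\<kappa>, t, a)) \<longleftrightarrow> \<phi> (\<kappa>, t, a)" if "to_nat \<kappa> < K" "t \<le> T x" for \<kappa> t a
  proof
    assume "A (enc x (\<kappa>, t, a))"
    then obtain \<kappa>' t' a' where "to_nat \<kappa>' < K" "t' \<le> T x" "enc x (\<kappa>', t', a') = enc x (\<kappa>, t, a)" "\<phi> (\<kappa>', t', a')"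
      by (auto simp: A_def simp del: enc.simps) (simp only: enc.simps)
    then show "\<phi> (\<kappa>, t, a)" using enc_inject that by metis
  qed (use that in \<open>auto simp: A_def simp del: enc.simps\<close>)
  have "\<exists>v<num_vars x. pos_lit x v c \<and> A v \<or> neg_lit x v c \<and> \<not> A v" if c: "c < num_clauses x" for c
  proof -
    obtain G ns ps where r: "rl ! (c mod length rl) = (G, ns, ps)" by (metis prod_cases3)
    let ?i = "inst x (time_of x c) (pos1_of x c) (pos2_of x c)"
    have rr: "(G, ns, ps) \<in> rules" using clause_rule[of c] r by simp
    show ?thesis
    proof (cases "G x (time_of x c) (pos1_of x c) (pos2_of x c)")
      case False
      then have "pos_lit x 0 c \<and> A 0" by (simp add: pos_lit_def r Let_def guard_def A_def)
      then show ?thesis by (intro exI[of _ 0]) (simp add: num_vars_def)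
    next
      case G: True
      note facts = rule_facts[OF rr G time_of_le]
      have lit: "enc x (?i l) < num_vars x \<and> (A (enc x (?i l)) \<longleftrightarrow> \<phi> (?i l))" if "l \<in> set ns \<union> set ps" for l
      proof -
        obtain \<kappa> f h where lk: "l = (\<kappa>, f, h)" by (metis prod_cases3)
        obtain t a where i: "?i l = (\<kappa>, t, a)" by (simp add: lk inst_def)
        have "to_nat \<kappa> < K" using K[OF rr] that lk by blast
        moreover have "t \<le> T x" using facts(1)[OF that i] .
        moreover have "a < W x" using facts(2)[OF that pos1_of_less pos2_of_less[OF c] i] .
        ultimately show ?thesis unfolding i using A_enc enc_less by blast
      qed
      have "rule_sat x \<phi> (time_of x c) (pos1_of x c) (pos2_of x c) (G, ns, ps)"
        by (rule tableau_satD[OF sat rr time_of_le pos1_of_less pos2_of_less[OF c]])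
      then have "(\<exists>l\<in>set ns. \<not> \<phi> (?i l)) \<or> (\<exists>l\<in>set ps. \<phi> (?i l))" using G by (simp add: rule_sat_def)
      then show ?thesis
      proof
        assume "\<exists>l\<in>set ns. \<not> \<phi> (?i l)"
        then obtain l where l: "l \<in> set ns" "\<not> \<phi> (?i l)" by blast
        then have "neg_lit x (enc x (?i l)) c" using G by (auto simp: neg_lit_def r Let_def guard_def occurs_def)
        then show ?thesis using lit[of l] l by auto
      next
        assume "\<exists>l\<in>set ps. \<phi> (?i l)"
        then obtain l where l: "l \<in> set ps" "\<phi> (?i l)" by blast
        then have "pos_lit x (enc x (?i l)) c" using G by (auto simp: pos_lit_def r Let_def guard_def occurs_def)
        then show ?thesis using lit[of l] l by auto
      qed
    qed
  qed
  then show "cnf_sat (num_vars x) (num_clauses x) (pos_lit x) (neg_lit x)" unfolding cnf_sat_def by blast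
qed

lemma definable_clause_params:
  assumes "definable d c"
  shows "definable d (\<lambda>x R. time_of x (c x R))" "definable d (\<lambda>x R. pos1_of x (c x R))"
    "definable d (\<lambda>x R. pos2_of x (c x R))"
  unfolding time_of_def pos1_of_def pos2_of_def W_def
  by (rule definable_div definable_mod definable_div_const definable_mult definable_T definable_const rl_pos assms)+

lemma decidable_lits:
  assumes c: "definable d c" and v: "definable d v"
  shows "decidable d (\<lambda>x R. pos_lit x (v x R) (c x R))" "decidable d (\<lambda>x R. neg_lit x (v x R) (c x R))"
proof -
  note par = definable_clause_params[OF c]
  have guard: "decidable d (\<lambda>x R. guard r x (c x R))" if "r \<in> rules" for r
  proof -
    obtain G ns ps where r: "r = (G, ns, ps)" by (metis prod_cases3)
    show ?thesis using rule_definable(1)[OF _ par, of G ns ps] that by (simp add: guard_def r)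
  qed
  have occurs: "decidable d (\<lambda>x R. occurs ls x (v x R) (c x R))" if r: "(G, ns, ps) \<in> rules" and ls: "ls = ns \<or> ls = ps" for G ns ps ls
    unfolding occurs_def
  proof (rule decidable_Bex_list)
    fix l assume l: "l \<in> set ls"
    obtain \<kappa> f h where lk: "l = (\<kappa>, f, h)" by (metis prod_cases3)
    have "(\<kappa>, f, h) \<in> set ns \<union> set ps" using l ls lk by auto
    note di = rule_definable(2,3)[OF r par this]
    show "decidable d (\<lambda>x R. v x R = enc x (inst x (time_of x (c x R)) (pos1_of x (c x R)) (pos2_of x (c x R)) l))"
      unfolding lk inst_def prod.case enc.simps
      by (rule decidable_eq definable_Suc definable_add definable_mult definable_const definable_T v di)+
  qed
  have sel: "c x R mod length rl \<in> set [0..<length rl]" for x R using rl_pos by simp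
  \<comment> \<open>Expressions cannot index into \<open>rl\<close>, so the choice of the rule
    becomes a case distinction over its finitely many indices.\<close>
  have pe: "pos_lit x (v x R) (c x R) = (\<exists>i\<in>set [0..<length rl]. c x R mod length rl = i \<and>
     (guard (rl ! i) x (c x R) \<and> occurs (snd (snd (rl ! i))) x (v x R) (c x R) \<or> \<not> guard (rl ! i) x (c x R) \<and> v x R = 0))" for x R
    unfolding pos_lit_def Let_def using sel[of x R] by auto
  have ne: "neg_lit x (v x R) (c x R) = (\<exists>i\<in>set [0..<length rl]. c x R mod length rl = i \<and>
     (guard (rl ! i) x (c x R) \<and> occurs (fst (snd (rl ! i))) x (v x R) (c x R)))" for x R
    unfolding neg_lit_def Let_def using sel[of x R] by auto
  have parts: "rl ! i \<in> rules" "decidable d (\<lambda>x R. guard (rl ! i) x (c x R))"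
    "decidable d (\<lambda>x R. occurs (snd (snd (rl ! i))) x (v x R) (c x R))"
    "decidable d (\<lambda>x R. occurs (fst (snd (rl ! i))) x (v x R) (c x R))"
    if "i \<in> set [0..<length rl]" for i
  proof -
    show r: "rl ! i \<in> rules" using that nth_mem[of i rl] unfolding rl by simp
    then show "decidable d (\<lambda>x R. guard (rl ! i) x (c x R))" by (rule guard)
    have "(fst (rl ! i), fst (snd (rl ! i)), snd (snd (rl ! i))) \<in> rules" using r by simp
    from occurs[OF this] show "decidable d (\<lambda>x R. occurs (snd (snd (rl ! i))) x (v x R) (c x R))"
      "decidable d (\<lambda>x R. occurs (fst (snd (rl ! i))) x (v x R) (c x R))" by blast+
  qed
  show "decidable d (\<lambda>x R. pos_lit x (v x R) (c x R))"
    unfolding pe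
    by (rule decidable_Bex_list)
      (rule decidable_conj decidable_disj decidable_not decidable_eq definable_mod_const definable_const c v rl_pos parts | assumption)+
  show "decidable d (\<lambda>x R. neg_lit x (v x R) (c x R))"
    unfolding ne
    by (rule decidable_Bex_list)
      (rule decidable_conj decidable_eq definable_mod_const definable_const c v rl_pos parts | assumption)+
qed

section \<open>The instance and its computation\<close>

abbreviation graph :: "bool list \<Rightarrow> (nat \<times> nat) set" where
  "graph x \<equiv> cnf_graph (num_vars x) (num_clauses x) (pos_lit x) (neg_lit x)"

lemma decidable_gadget:
  assumes c: "definable d c" and i: "definable d i"
  shows "decidable d (\<lambda>x R. gadget (\<lambda>v. pos_lit x v (c x R)) (\<lambda>v. neg_lit x v (c x R)) (i x R))"
proof -
  have six: "0 < (6::nat)" by simp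
  note lits = decidable_lits[OF c definable_div_const[OF i six]]
  have "gadget (\<lambda>v. pos_lit x v (c x R)) (\<lambda>v. neg_lit x v (c x R)) (i x R) \<longleftrightarrow>
      i x R mod 6 = 0 \<and> \<not> neg_lit x (i x R div 6) (c x R) \<or>
      i x R mod 6 = 1 \<and> \<not> pos_lit x (i x R div 6) (c x R) \<or> i x R mod 6 = 2 \<or>
      i x R mod 6 = 3 \<and> (pos_lit x (i x R div 6) (c x R) \<or> neg_lit x (i x R div 6) (c x R))" for x R
    by (auto simp: gadget_def Let_def)
  then show ?thesis
    by (simp only:) (rule decidable_conj decidable_disj decidable_not decidable_eq definable_mod_const definable_const lits i six)+
qed

lemma instance_poly_time:
  "poly_time_computable (\<lambda>x. encode_near_chain (6 * num_vars x) (num_clauses x) (graph x) Suc 1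
     (num_clauses x * (3 * num_vars x - 1)))"
proof -
  note di = definable_const definable_mult definable_Suc definable_diff definable_T definable_W
  have "definable 0 (\<lambda>x R. 6 * num_vars x)" "definable 0 (\<lambda>x R. num_clauses x)"
    "definable 0 (\<lambda>x R. num_clauses x * (3 * num_vars x - 1))"
    unfolding num_vars_def num_clauses_def by (rule di)+
  \<comment> \<open>Two nested loops occupy registers 0 to 3: \<open>R 1\<close> is the row and
    \<open>R 3\<close> the column of the matrix.\<close>
  moreover have "decidable 4 (\<lambda>x R. gadget (\<lambda>v. pos_lit x v (R 3)) (\<lambda>v. neg_lit x v (R 3)) (R 1))"
    by (intro decidable_gadget definable_var) simp_all
  ultimately obtain en em et eb where vars: "vars_below en 0" "vars_below em 0" "vars_below et 0" "vars_below eb 4"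
    and ev: "\<And>x R. eval x en R = 6 * num_vars x" "\<And>x R. eval x em R = num_clauses x"
      "\<And>x R. eval x et R = num_clauses x * (3 * num_vars x - 1)"
      "\<And>x R. eval x eb R = of_bool (gadget (\<lambda>v. pos_lit x v (R 3)) (\<lambda>v. neg_lit x v (R 3)) (R 1))"
    unfolding decidable_def definable_def by blast
  \<comment> \<open>Unary numbers are loops printing \<open>True\<close>, followed by
    \<open>False\<close>. In the loop over students \<open>Var 1\<close> is \<open>i\<close>, so
    \<open>Add (Var 1) (Const 1)\<close> prints the rank \<open>Suc i\<close>.\<close>
  define P where "P = Then (For en (Put (Const 1))) (Then (Put (Const 0)) (Then (For em (Put (Const 1)))
    (Then (Put (Const 0)) (Then (For en (For em (Put eb))) (Then (For en (PutNat (Add (Var 1) (Const 1))))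
    (Then (PutNat (Const 1)) (PutNat et)))))))"
  have "pgm_vars_below P 0"
    using vars vars_below_mono[of em 0 2] by (simp add: P_def eval_nat_numeral)
  then have "poly_time_computable (\<lambda>x. printed x P 0 (\<lambda>_. 0))" by (rule poly_time_computable_output)
  moreover have "printed x P 0 (\<lambda>_. 0) = encode_near_chain (6 * num_vars x) (num_clauses x) (graph x) Suc 1
     (num_clauses x * (3 * num_vars x - 1))" for x
  proof -
    have sing: "concat (map (\<lambda>i. [f i]) xs) = map f xs" for f :: "nat \<Rightarrow> bool" and xs by (induction xs) auto
    have mat: "concat (map (\<lambda>i. map (\<lambda>j. gadget (\<lambda>v. pos_lit x v j) (\<lambda>v. neg_lit x v j) i) [0..<num_clauses x]) [0..<6 * num_vars x]) =
        concat (map (\<lambda>i. map (\<lambda>j. (i, j) \<in> graph x) [0..<num_clauses x]) [0..<6 * num_vars x])"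
      by (intro arg_cong[where f = concat] map_cong) (auto simp: cnf_graph_def)
    show ?thesis
      unfolding encode_near_chain_def mat[symmetric]
      by (simp add: P_def ev Let_def sing map_replicate_const encode_unary_def del: upt_Suc)
  qed
  ultimately show ?thesis by simp
qed

end

text \<open>Membership only provides some instance with the same code, so injectivity is needed. It
  determines \<open>\<alpha>\<close> only below \<open>n\<close>, which is all that
  \<open>k_near\<close> inspects.\<close>

lemma encode_near_chain_in_language_iff:
  assumes inst: "near_chain_instance {..<n} {..<m} E \<alpha> k"
  shows "encode_near_chain n m E \<alpha> k t \<in> UNCONSTRAINED_NEAR_CHAIN_EDITING \<longleftrightarrow>
    (\<exists>F. chain_edit_set {..<n} {..<m} E \<alpha> k F \<and> card F \<le> t)"
proof
  assume "encode_near_chain n m E \<alpha> k t \<in> UNCONSTRAINED_NEAR_CHAIN_EDITING"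
  then obtain n' m' E' \<alpha>' k' t' F where eq: "encode_near_chain n m E \<alpha> k t = encode_near_chain n' m' E' \<alpha>' k' t'"
    and i': "near_chain_instance {..<n'} {..<m'} E' \<alpha>' k'" and F: "chain_edit_set {..<n'} {..<m'} E' \<alpha>' k' F" "card F \<le> t'"
    unfolding UNCONSTRAINED_NEAR_CHAIN_EDITING_def by blast
  have "n = n' \<and> m = m' \<and> E = E' \<and> (\<forall>i < n. \<alpha> i = \<alpha>' i) \<and> k = k' \<and> t = t'"
    by (rule encode_near_chain_inject[OF _ _ eq]) (use inst i' in \<open>auto simp: near_chain_instance_def\<close>)
  then show "\<exists>F. chain_edit_set {..<n} {..<m} E \<alpha> k F \<and> card F \<le> t"
    using F by (intro exI[of _ F]) (auto simp: chain_edit_set_def k_near_def)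
next
  assume "\<exists>F. chain_edit_set {..<n} {..<m} E \<alpha> k F \<and> card F \<le> t"
  then show "encode_near_chain n m E \<alpha> k t \<in> UNCONSTRAINED_NEAR_CHAIN_EDITING"
    unfolding UNCONSTRAINED_NEAR_CHAIN_EDITING_def using inst by blast
qed

theorem theorem4:
  shows "NP_hard UNCONSTRAINED_NEAR_CHAIN_EDITING"
  unfolding NP_hard_def
proof
  fix A assume "A \<in> class_NP"
  then obtain L p where "L \<in> class_P"
    and A: "\<And>x. x \<in> A \<longleftrightarrow> (\<exists>u. length u \<le> poly p (length x) \<and> pair_words x u \<in> L)"
    unfolding class_NP_def by blast
  then obtain M q where "wf_tm M" "tm_computes_in_time M (\<lambda>x. [x \<in> L]) (poly q)"
    unfolding class_P_def poly_time_computable_def by blast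
  then interpret verifier M q p L by unfold_locales
  \<comment> \<open>The verifier is fixed from here on; finiteness of its rule set yields the list
    and the radix.\<close>
  obtain rl where rl: "set rl = rules" using finite_list[OF finite_rules] by blast
  let ?kinds = "\<Union>r\<in>rules. fst ` (set (fst (snd r)) \<union> set (snd (snd r)))"
  have fin: "finite (to_nat ` ?kinds)" using finite_rules by auto
  then obtain K where K: "to_nat ` ?kinds \<subseteq> {..<K}" using finite_nat_iff_bounded by blast
  have "to_nat \<kappa> < K" if "(G, ns, ps) \<in> rules" "(\<kappa>, f, h) \<in> set ns \<union> set ps" for G ns ps \<kappa> f h
  proof -
    have "\<kappa> \<in> ?kinds" using that by (force intro!: bexI[of _ "(G, ns, ps)"])
    then show ?thesis using K by auto
  qed
  then interpret numbered_verifier M q p L rl K using rl by unfold_locales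
  let ?f = "\<lambda>x. encode_near_chain (6 * num_vars x) (num_clauses x) (graph x) Suc 1
     (num_clauses x * (3 * num_vars x - 1))"
  have "x \<in> A \<longleftrightarrow> ?f x \<in> UNCONSTRAINED_NEAR_CHAIN_EDITING" for x
  proof -
    have "bij_betw Suc {..<6 * num_vars x} {1..6 * num_vars x}"
      by (simp add: bij_betw_def image_Suc_lessThan)
    then have "near_chain_instance {..<6 * num_vars x} {..<num_clauses x} (graph x) Suc 1"
      by (auto simp: near_chain_instance_def cnf_graph_def is_ordering_def)
    from encode_near_chain_in_language_iff[OF this] have "?f x \<in> UNCONSTRAINED_NEAR_CHAIN_EDITING \<longleftrightarrow>
        cnf_sat (num_vars x) (num_clauses x) (pos_lit x) (neg_lit x)"
      using cnf_sat_iff_chain_edit[of "pos_lit x" "neg_lit x" "num_vars x" "num_clauses x", OF lits_disjoint]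
      by (simp add: num_vars_def)
    then show ?thesis unfolding A tableau_iff cnf_iff_tableau by blast
  qed
  then show "poly_reducible A UNCONSTRAINED_NEAR_CHAIN_EDITING"
    unfolding poly_reducible_def using instance_poly_time by blast
qed

end
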